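(* Let $\bm P$ and $\bm P^{(n)}$ ($n\ge1$) be proper lazy Markov stick-breaking processes with parameters $(\rho,\bm\pi,P_0)$ and $(\rho^{(n)},\bm\pi^{(n)},P_0^{(n)})$, and let $\bm w,\bm w^{(n)}$ be their weights. If $\rho^{(n)}\to\rho$ in $[0,1]$, $P_0^{(n)}\to P_0$ weakly, and $\pi_j^{(n)}\to\pi_j$ weakly for every $j\ge1$, then $\bm P^{(n)}\to\bm P$ weakly in distribution and $\bm w^{(n)}\to\bm w$ in distribution. In particular: (i) if $\rho=0$, the length variables of $\bm P$ are independent with $v_j\sim\pi_j$; if moreover $\pi_j=\mathrm{Beta}(1-\sigma,\theta+j\sigma)$ with $0\le\sigma<1$, $\theta>-\sigma$, then $\bm P$ is a Pitman–Yor process and $\bm w$ is invariant under size-biased permutations; (ii) if $\rho=1$, $\bm P$ is the completely dependent stick-breaking process with parameters $(\bm\pi,P_0)$; if moreover $\pi_j=\mathrm{Beta}(1-\sigma,\theta+j\sigma)$ with $0\le\sigma<1$, $\theta>-\sigma$, then $\bm w$ is a.s. non-increasing.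
   Context: For probability measures $\pi_j$ on $[0,1]$ with continuous strictly increasing distribution functions $F_j$ (assumed for all $\bm\pi$ and $\bm\pi^{(n)}$), $\Upsilon_j=F_{j+1}^{-1}\circ F_j$. A lazy Markov stick-breaking process with parameters $(\rho,\bm\pi,P_0)$, $\rho\in[0,1]$, is $\bm P=\sum_jw_j\delta_{\theta_j}+(1-\sum_jw_j)P_0$, where $w_1=v_1$, $w_j=v_j\prod_{i<j}(1-v_i)$, $\bm v$ is a Markov chain with $v_1\sim\pi_1$ and $\mathbb P[v_{j+1}\in\cdot\mid v_j]=\rho\,\delta_{\Upsilon_j(v_j)}+(1-\rho)\pi_{j+1}$, $P_0$ diffuse on a complete separable metric space $\mathbb X$, $\theta_j$ iid $P_0$ independent of $\bm w$. Proper: $\sum_jw_j=1$ a.s. The completely dependent stick-breaking process uses $v_1\sim\pi_1$, $v_{j+1}=\Upsilon_j(v_j)$. Pitman–Yor process: independent $v_j\sim\mathrm{Beta}(1-\sigma,\theta+j\sigma)$. Size-biased permutation: $(w_{\varrho_j})$ with $\mathbb P[\varrho_1=j\mid\bm w]=w_j$, $\mathbb P[\varrho_{k+1}=j\mid\bm w,\varrho_{1..k}]=w_j(1-\sum_{i\le k}w_{\varrho_i})^{-1}\mathbb 1\{j\notin\{\varrho_1,\dots,\varrho_k\}\}$; invariance means $(w_{\varrho_j})\overset d=(w_j)$. Weak convergence in distribution: $\int f d\bm P^{(n)}\to\int fd\bm P$ in distribution for all bounded continuous $f$. *)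

theory Defs
  imports "HOL-Probability.Probability"
begin

text \<open>Indexing convention: the paper's index j >= 1 corresponds to Isabelle index j - 1 >= 0.
  So ps 0 is the paper's pi_1, v 0 is v_1, etc.\<close>

definition weak_conv_meas :: "(nat \<Rightarrow> 'b::topological_space measure) \<Rightarrow> 'b measure \<Rightarrow> bool" where
  "weak_conv_meas Ms M \<longleftrightarrow>
     (\<forall>f::'b \<Rightarrow> real. continuous_on UNIV f \<longrightarrow> bounded (range f) \<longrightarrow>
        (\<lambda>n. \<integral>x. f x \<partial>(Ms n)) \<longlonglongrightarrow> (\<integral>x. f x \<partial>M))"

definition admissible_len :: "real measure \<Rightarrow> bool" where
  "admissible_len p \<longleftrightarrow> prob_space p \<and> sets p = sets borel \<and> measure p {0..1} = 1 \<and>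
     continuous_on UNIV (cdf p) \<and> strict_mono_on {0..1} (cdf p)"

definition Upsilon :: "(nat \<Rightarrow> real measure) \<Rightarrow> nat \<Rightarrow> real \<Rightarrow> real" where
  "Upsilon ps j x = the_inv_into {0..1} (cdf (ps (Suc j))) (cdf (ps j) x)"

definition sb_weights :: "(nat \<Rightarrow> real) \<Rightarrow> nat \<Rightarrow> real" where
  "sb_weights v j = v j * (\<Prod>i<j. 1 - v i)"

text \<open>The integral of f against the random measure
  P = sum_j w_j delta_{theta_j} + (1 - sum_j w_j) P0, at outcome omega.\<close>
definition sb_integral ::
  "(nat \<Rightarrow> 'a \<Rightarrow> real) \<Rightarrow> (nat \<Rightarrow> 'a \<Rightarrow> 'x) \<Rightarrow> 'x measure \<Rightarrow> ('x \<Rightarrow> real) \<Rightarrow> 'a \<Rightarrow> real" where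
  "sb_integral v \<theta> P0 f \<omega> =
     (\<Sum>j. sb_weights (\<lambda>i. v i \<omega>) j * f (\<theta> j \<omega>))
     + (1 - (\<Sum>j. sb_weights (\<lambda>i. v i \<omega>) j)) * (\<integral>x. f x \<partial>P0)"

text \<open>(M, v, theta) realises a proper lazy Markov stick-breaking process with parameters
  (rho, ps, P0) on the space 'x: v is a Markov chain with v_1 ~ pi_1 and transition
  kernel rho delta_{Upsilon_j(v_j)} + (1 - rho) pi_{j+1} (expressed by the joint law of
  (v_1..v_j) and v_{j+1}); the atoms theta_j are iid P0 and independent of the weights;
  the weights sum to 1 almost surely.\<close>
definition proper_lazy_MSB ::
  "'a measure \<Rightarrow> real \<Rightarrow> (nat \<Rightarrow> real measure) \<Rightarrow> 'x::topological_space measure \<Rightarrow>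
   (nat \<Rightarrow> 'a \<Rightarrow> real) \<Rightarrow> (nat \<Rightarrow> 'a \<Rightarrow> 'x) \<Rightarrow> bool" where
  "proper_lazy_MSB M \<rho> ps P0 v \<theta> \<longleftrightarrow>
     prob_space M \<and>
     (\<forall>j. v j \<in> borel_measurable M) \<and> (\<forall>j. \<theta> j \<in> measurable M borel) \<and>
     distr M borel (v 0) = ps 0 \<and>
     (\<forall>j. \<forall>A \<in> sets (Pi\<^sub>M {..j} (\<lambda>_. borel)). \<forall>B \<in> sets (borel :: real measure).
        measure M {\<omega> \<in> space M. (\<lambda>i\<in>{..j}. v i \<omega>) \<in> A \<and> v (Suc j) \<omega> \<in> B} =
        (\<integral>\<omega>. indicator A (\<lambda>i\<in>{..j}. v i \<omega>) *
              (\<rho> * indicator B (Upsilon ps j (v j \<omega>)) + (1 - \<rho>) * measure (ps (Suc j)) B) \<partial>M)) \<and>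
     prob_space.indep_vars M (\<lambda>_. borel) \<theta> UNIV \<and>
     (\<forall>j. distr M borel (\<theta> j) = P0) \<and>
     (\<forall>A \<in> sets (Pi\<^sub>M UNIV (\<lambda>_. borel :: 'x measure)).
      \<forall>B \<in> sets (Pi\<^sub>M UNIV (\<lambda>_. borel :: real measure)).
        measure M {\<omega> \<in> space M. (\<lambda>j. \<theta> j \<omega>) \<in> A \<and> (\<lambda>j. sb_weights (\<lambda>i. v i \<omega>) j) \<in> B} =
        measure M {\<omega> \<in> space M. (\<lambda>j. \<theta> j \<omega>) \<in> A} *
        measure M {\<omega> \<in> space M. (\<lambda>j. sb_weights (\<lambda>i. v i \<omega>) j) \<in> B}) \<and>
     (AE \<omega> in M. (\<lambda>j. sb_weights (\<lambda>i. v i \<omega>) j) sums 1)"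

definition beta_measure :: "real \<Rightarrow> real \<Rightarrow> real measure" where
  "beta_measure a b = density lborel
     (\<lambda>x. ennreal (indicator {0<..<1} x * x powr (a - 1) * (1 - x) powr (b - 1) / Beta a b))"

text \<open>rho is a size-biased permutation (random index sequence) for the random weights W on N:
  P[rho_1 = i_1, ..., rho_k = i_k | W] =
     prod_m W_{i_m} / (1 - sum_{l<m} W_{i_l}) * 1{i's distinct},
  expressed jointly with events of W.\<close>
definition size_biased_perm :: "'b measure \<Rightarrow> ('b \<Rightarrow> nat \<Rightarrow> real) \<Rightarrow> (nat \<Rightarrow> 'b \<Rightarrow> nat) \<Rightarrow> bool" where
  "size_biased_perm N W rk \<longleftrightarrow>
     (\<forall>k. rk k \<in> measurable N (count_space UNIV)) \<and>
     (\<forall>ixs :: nat list. \<forall>A \<in> sets (borel :: (nat \<Rightarrow> real) measure).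
        measure N {\<omega> \<in> space N. W \<omega> \<in> A \<and> (\<forall>m < length ixs. rk m \<omega> = ixs ! m)} =
        (\<integral>\<omega>. indicator A (W \<omega>) *
              (if distinct ixs then
                 (\<Prod>m<length ixs. W \<omega> (ixs ! m) / (1 - (\<Sum>l<m. W \<omega> (ixs ! l)))) else 0) \<partial>N))"

end

theory Submission
  imports Defs
begin

text \<open>All lengths lie in the compact set [0,1], so by Stone--Weierstrass weak convergence of the length
  sequences only has to be tested on products of functions of single coordinates. For these, the
  Markov property gives a recursion in the number of coordinates, which passes to the limit because
  the maps Upsilon converge uniformly (Polya's theorem). The weights are continuous functions of the
  lengths, and the random integral is truncated to finitely many atoms at a cost controlled by the
  expected remaining mass, which is small since the limit is proper.

  Size-biased invariance: write the weights as w = (x, (1 - x) w') with w' again of the same type,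
  with parameter theta + sigma, and independent of x. Picking an index i with probability w_i and
  moving w_i to the front preserves the law: after conditioning on x this reduces to w' and to the
  symmetry of (1 - x) times the joint law of the first two weights. Repeating this for the later
  positions turns the first k size-biased draws into the first k weights.

  For sigma >= 0 the Beta laws of the lengths decrease stochastically in j, so each Upsilon lies
  below the identity, and this makes the completely dependent weights non-increasing.\<close>

section \<open>Test functions that determine weak convergence\<close>

text \<open>The space carrying the atoms need not be compact, so the atoms themselves offer no
  compactness. For a fixed bounded continuous f only the real numbers \<open>f (\<theta> j)\<close>
  matter; together with the weights they lie in a compact box, and independence of atoms and weights
  makes product test functions factorise.

  No hypothesis controls the tails of the approximating series uniformly in n. The truncation level
  is therefore chosen from the limit alone: the expected mass beyond it is the expectation of a
  continuous function of finitely many weights, hence also small for all large n.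

  In the Beta case the first two weights are not exchangeable. The extra factor 1 - x, the
  probability that a pick falls into the tail, makes their law symmetric because b + 1 = a + c for a
  = 1 - \<sigma>, b = \<theta> + \<sigma>, c = \<theta> + 2 \<sigma>. That the Beta weights sum to
  one is not computed from the parameters; it is inherited from the properness of P.\<close>

inductive_set real_span :: "('a \<Rightarrow> real) set \<Rightarrow> ('a \<Rightarrow> real) set" for F where
  real_span_scale: "f \<in> F \<Longrightarrow> (\<lambda>x. c * f x) \<in> real_span F"
| real_span_add: "f \<in> real_span F \<Longrightarrow> g \<in> real_span F \<Longrightarrow> (\<lambda>x. f x + g x) \<in> real_span F"

lemma real_span_mult:
  assumes mult: "\<And>f g. f \<in> F \<Longrightarrow> g \<in> F \<Longrightarrow> (\<lambda>x. f x * g x) \<in> F"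
    and "f \<in> real_span F" "g \<in> real_span F"
  shows "(\<lambda>x. f x * g x) \<in> real_span F"
  using assms(2)
proof induction
  case (real_span_scale f c)
  show ?case using assms(3)
  proof induction
    case (real_span_scale g d)
    have "(\<lambda>x. (c * d) * (f x * g x)) \<in> real_span F"
      using mult[OF \<open>f \<in> F\<close> \<open>g \<in> F\<close>] by (rule real_span.real_span_scale)
    then show ?case by (simp add: mult_ac)
  next
    case (real_span_add g h)
    from real_span.real_span_add[OF this(3,4)] show ?case by (simp add: distrib_left)
  qed
next
  case (real_span_add f h)
  from real_span.real_span_add[OF this(3,4)] show ?case by (simp add: distrib_right)
qed

text \<open>Closure of F under products makes its span an algebra, and scaling the constant 1
  supplies all constants, so Stone-Weierstrass applies on K.\<close>

lemma span_approximation: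
  fixes F :: "('a::t2_space \<Rightarrow> real) set" and h :: "'a \<Rightarrow> real"
  assumes K: "compact K"
    and cont: "\<And>f. f \<in> F \<Longrightarrow> continuous_on K f"
    and one: "(\<lambda>_. 1) \<in> F"
    and mult: "\<And>f g. f \<in> F \<Longrightarrow> g \<in> F \<Longrightarrow> (\<lambda>x. f x * g x) \<in> F"
    and sep: "\<And>x y. x \<in> K \<Longrightarrow> y \<in> K \<Longrightarrow> x \<noteq> y \<Longrightarrow> \<exists>f\<in>F. f x \<noteq> f y"
    and h: "continuous_on K h" and e: "0 < e"
  shows "\<exists>g \<in> real_span F. \<forall>x\<in>K. \<bar>h x - g x\<bar> < e"
proof -
  interpret function_ring_on "real_span F" K
  proof
    show "continuous_on K f" if "f \<in> real_span F" for f
      using that by induction (intro continuous_intros; simp add: cont)+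
    show "(\<lambda>_. c) \<in> real_span F" for c
      using real_span_scale[OF one, of c] by simp
    show "\<exists>f\<in>real_span F. f x \<noteq> f y" if xy: "x \<in> K" "y \<in> K" "x \<noteq> y" for x y
    proof -
      obtain f where "f \<in> F" "f x \<noteq> f y" using sep[OF xy] by blast
      then show ?thesis using real_span_scale[of f F 1] by (intro bexI[of _ f]) auto
    qed
    show "(\<lambda>x. f x * g x) \<in> real_span F" if "f \<in> real_span F" "g \<in> real_span F" for f g
      using mult that by (rule real_span_mult)
  qed (fact K real_span_add)+
  show ?thesis using Stone_Weierstrass_basic[OF h e] .
qed

lemma integrable_bounded_on:
  fixes h :: "'a \<Rightarrow> real"
  assumes "prob_space \<mu>" "AE x in \<mu>. x \<in> K" "h \<in> borel_measurable \<mu>" "\<And>x. x \<in> K \<Longrightarrow> \<bar>h x\<bar> \<le> B"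
  shows "integrable \<mu> h"
proof -
  interpret prob_space \<mu> by fact
  show ?thesis using assms(2-4) by (intro integrable_const_bound[of _ B]) auto
qed

lemma integral_dist_le:
  fixes h g :: "'a \<Rightarrow> real"
  assumes "prob_space \<mu>" "AE x in \<mu>. x \<in> K" "integrable \<mu> h" "integrable \<mu> g"
    and "\<And>x. x \<in> K \<Longrightarrow> \<bar>h x - g x\<bar> \<le> e"
  shows "\<bar>(\<integral>x. h x \<partial>\<mu>) - (\<integral>x. g x \<partial>\<mu>)\<bar> \<le> e"
proof -
  interpret prob_space \<mu> by fact
  have "\<bar>(\<integral>x. h x \<partial>\<mu>) - (\<integral>x. g x \<partial>\<mu>)\<bar> = \<bar>\<integral>x. h x - g x \<partial>\<mu>\<bar>"
    using assms by simp
  also have "\<dots> \<le> (\<integral>x. \<bar>h x - g x\<bar> \<partial>\<mu>)"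
    by (rule integral_abs_bound)
  also have "\<dots> \<le> (\<integral>x. e \<partial>\<mu>)"
    using assms by (intro integral_mono_AE) auto
  finally show ?thesis by (simp add: prob_space)
qed

text \<open>A three-term estimate: replacing h by a uniformly close g from the span costs at most
  r/3 under the limit and under every approximating measure. This is uniform in n because one
  compact set K carries all the measures. Off K nothing is known about h, hence its separate
  measurability assumption.\<close>

lemma weak_convergence_from_class:
  fixes F :: "('a::t2_space \<Rightarrow> real) set" and h :: "'a \<Rightarrow> real" and \<mu> :: "'a measure"
  assumes K: "compact K"
    and cont: "\<And>f. f \<in> F \<Longrightarrow> continuous_on K f"
    and meas: "\<And>f. f \<in> F \<Longrightarrow> f \<in> borel_measurable borel"
    and one: "(\<lambda>_. 1) \<in> F"
    and mult: "\<And>f g. f \<in> F \<Longrightarrow> g \<in> F \<Longrightarrow> (\<lambda>x. f x * g x) \<in> F"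
    and sep: "\<And>x y. x \<in> K \<Longrightarrow> y \<in> K \<Longrightarrow> x \<noteq> y \<Longrightarrow> \<exists>f\<in>F. f x \<noteq> f y"
    and \<mu>: "prob_space \<mu>" "sets \<mu> = sets borel" "AE x in \<mu>. x \<in> K"
    and \<mu>n: "\<And>n. prob_space (\<mu>n n)" "\<And>n. sets (\<mu>n n) = sets borel" "\<And>n. AE x in \<mu>n n. x \<in> K"
    and conv: "\<And>f. f \<in> F \<Longrightarrow> (\<lambda>n. \<integral>x. f x \<partial>\<mu>n n) \<longlonglongrightarrow> (\<integral>x. f x \<partial>\<mu>)"
    and h: "continuous_on K h" "h \<in> borel_measurable borel"
  shows "(\<lambda>n. \<integral>x. h x \<partial>\<mu>n n) \<longlonglongrightarrow> (\<integral>x. h x \<partial>\<mu>)"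
proof -
  have span_cont: "continuous_on K f" and span_meas: "f \<in> borel_measurable borel" if "f \<in> real_span F" for f
    using that by (induction) (intro continuous_intros borel_measurable_add borel_measurable_times borel_measurable_const; simp add: cont meas)+
  have bdd: "\<exists>B. \<forall>x\<in>K. \<bar>f x\<bar> \<le> B" if "continuous_on K f" for f :: "'a \<Rightarrow> real"
    using compact_imp_bounded[OF compact_continuous_image[OF that K]] by (auto simp: bounded_iff)
  have int: "integrable \<nu> f" if f: "continuous_on K f" "f \<in> borel_measurable borel"
    and \<nu>: "prob_space \<nu>" "sets \<nu> = sets borel" "AE x in \<nu>. x \<in> K" for f :: "'a \<Rightarrow> real" and \<nu>
  proof -
    obtain B where "\<forall>x\<in>K. \<bar>f x\<bar> \<le> B" using bdd[OF f(1)] by blast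
    then show ?thesis
      using f(2) \<nu> by (intro integrable_bounded_on[OF \<nu>(1) \<nu>(3), of _ B])
        (auto simp: measurable_cong_sets[OF \<nu>(2) refl])
  qed
  have span: "(\<lambda>n. \<integral>x. f x \<partial>\<mu>n n) \<longlonglongrightarrow> (\<integral>x. f x \<partial>\<mu>)" if "f \<in> real_span F" for f
    using that
  proof induction
    case (real_span_scale f c)
    then show ?case by (simp add: tendsto_mult_left conv)
  next
    case (real_span_add f g)
    have "(\<integral>x. f x + g x \<partial>\<nu>) = (\<integral>x. f x \<partial>\<nu>) + (\<integral>x. g x \<partial>\<nu>)"
      if "prob_space \<nu>" "sets \<nu> = sets borel" "AE x in \<nu>. x \<in> K" for \<nu>
      by (intro Bochner_Integration.integral_add int[OF span_cont span_meas that] real_span_add.hyps)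
    then show ?case using tendsto_add[OF real_span_add.IH] \<mu> \<mu>n by simp
  qed
  show ?thesis
  proof (rule LIMSEQ_I)
    fix r :: real assume "0 < r"
    then have "0 < r/3" by simp
    have "\<exists>g \<in> real_span F. \<forall>x\<in>K. \<bar>h x - g x\<bar> < r/3"
      by (rule span_approximation[OF K _ one _ _ h(1) \<open>0 < r/3\<close>]) (fact cont mult sep)+
    then obtain g where g: "g \<in> real_span F" "\<And>x. x \<in> K \<Longrightarrow> \<bar>h x - g x\<bar> < r/3"
      by blast
    have close: "\<bar>(\<integral>x. h x \<partial>\<nu>) - (\<integral>x. g x \<partial>\<nu>)\<bar> \<le> r/3"
      if "prob_space \<nu>" "sets \<nu> = sets borel" "AE x in \<nu>. x \<in> K" for \<nu>
      by (intro integral_dist_le[OF that(1,3)] int[OF _ _ that] h span_cont span_meas g(1) less_imp_le g(2))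
    obtain N where N: "\<And>n. n \<ge> N \<Longrightarrow> \<bar>(\<integral>x. g x \<partial>\<mu>n n) - (\<integral>x. g x \<partial>\<mu>)\<bar> < r/3"
      using LIMSEQ_D[OF span[OF g(1)], of "r/3"] \<open>0 < r\<close> by auto
    show "\<exists>N. \<forall>n\<ge>N. norm ((\<integral>x. h x \<partial>\<mu>n n) - (\<integral>x. h x \<partial>\<mu>)) < r"
    proof (intro exI allI impI)
      fix n assume "N \<le> n"
      from N[OF this] close[OF \<mu>] close[OF \<mu>n, of n]
      show "norm ((\<integral>x. h x \<partial>\<mu>n n) - (\<integral>x. h x \<partial>\<mu>)) < r" unfolding real_norm_def by linarith
    qed
  qed
qed

section \<open>Beta distributions and independent Beta sticks\<close>

definition beta_kernel :: "real \<Rightarrow> real \<Rightarrow> real \<Rightarrow> real" where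
  "beta_kernel a b x = indicator {0<..<1} x * x powr (a - 1) * (1 - x) powr (b - 1)"

lemma beta_kernel_measurable [measurable]: "beta_kernel a b \<in> borel_measurable borel"
  unfolding beta_kernel_def by measurable

lemma beta_kernel_nonneg: "0 \<le> beta_kernel a b x"
  by (simp add: beta_kernel_def)

lemma beta_measure_eq: "beta_measure a b = density lborel (\<lambda>x. ennreal (beta_kernel a b x / Beta a b))"
  by (simp add: beta_measure_def beta_kernel_def)

lemma sets_beta_measure [simp, measurable_cong]: "sets (beta_measure a b) = sets borel"
  by (simp add: beta_measure_eq)

lemma space_beta_measure [simp]: "space (beta_measure a b) = UNIV"
  by (simp add: beta_measure_eq)

lemma Beta_real_pos: "0 < Beta a b" if "0 < a" "0 < b" for a b :: real
  using that by (simp add: Beta_def)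

lemma nn_integral_beta_measure:
  assumes [measurable]: "f \<in> borel_measurable borel"
  shows "(\<integral>\<^sup>+x. f x \<partial>beta_measure a b) = (\<integral>\<^sup>+x. ennreal (beta_kernel a b x / Beta a b) * f x \<partial>lborel)"
  unfolding beta_measure_eq by (subst nn_integral_density) auto

lemma prob_space_beta_measure:
  assumes "0 < a" "0 < b"
  shows "prob_space (beta_measure a b)"
proof (rule prob_spaceI)
  have "((\<lambda>x. x powr (a - 1) * (1 - x) powr (b - 1)) has_integral Beta a b) {0<..<1}"
    using has_integral_Beta_real[OF assms] by (simp add: has_integral_Icc_iff_Ioo)
  then have "(beta_kernel a b has_integral Beta a b) UNIV"
    unfolding beta_kernel_def
    by (subst (asm) has_integral_restrict_UNIV[symmetric])
      (erule has_integral_eq[rotated], simp add: indicator_def)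
  then have "((\<lambda>x. beta_kernel a b x / Beta a b) has_integral Beta a b / Beta a b) UNIV"
    by (rule has_integral_divide)
  then have "(\<integral>\<^sup>+x. ennreal (beta_kernel a b x / Beta a b) \<partial>lborel) = ennreal 1"
    using Beta_real_pos[OF assms]
    by (intro nn_integral_has_integral_lborel) (auto intro!: divide_nonneg_pos beta_kernel_nonneg)
  then show "emeasure (beta_measure a b) (space (beta_measure a b)) = 1"
    using nn_integral_beta_measure[of "\<lambda>_. 1" a b] by simp
qed

lemma AE_beta_measure: "AE x in beta_measure a b. 0 < x \<and> x < 1"
  unfolding beta_measure_eq
  by (subst AE_density) (auto simp: beta_kernel_def indicator_def)

text \<open>The substitution u = (1 - x) y turns (1 - x) times the joint density of (x, y) into the
  Dirichlet-type kernel on the right, which is symmetric in (x, u); this is where the relation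
  between the second Beta parameters enters.\<close>

lemma beta_swap:
  fixes H :: "real \<Rightarrow> real \<Rightarrow> ennreal"
  assumes H [measurable]: "case_prod H \<in> borel_measurable (borel \<Otimes>\<^sub>M borel)"
    and pos: "0 < a" "0 < b" "0 < c" and rel: "b + 1 = a + c"
  shows "(\<integral>\<^sup>+x. \<integral>\<^sup>+y. ennreal (1 - x) * H x ((1 - x) * y) \<partial>beta_measure a c \<partial>beta_measure a b) =
    (\<integral>\<^sup>+x. \<integral>\<^sup>+y. ennreal (1 - x) * H ((1 - x) * y) x \<partial>beta_measure a c \<partial>beta_measure a b)"
proof -
  \<comment> \<open>The joint density of the first two weights x and u, multiplied by 1 - x. The
    condition x + u < 1 is the image of y < 1.\<close>
  define k where "k x u = (if 0 < x \<and> 0 < u \<and> x + u < 1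
    then x powr (a - 1) * u powr (a - 1) * (1 - x - u) powr (c - 1) / (Beta a b * Beta a c) else 0)" for x u :: real
  have k [measurable]: "case_prod k \<in> borel_measurable (borel \<Otimes>\<^sub>M borel)"
    unfolding k_def by measurable
  have k_sym: "k x u = k u x" for x u
    unfolding k_def by (simp add: ac_simps diff_diff_eq)
  have key: "(\<integral>\<^sup>+x. \<integral>\<^sup>+y. ennreal (1 - x) * H x ((1 - x) * y) \<partial>beta_measure a c \<partial>beta_measure a b) =
    (\<integral>\<^sup>+x. \<integral>\<^sup>+u. ennreal (k x u) * H x u \<partial>lborel \<partial>lborel)"
    if H [measurable]: "case_prod H \<in> borel_measurable (borel \<Otimes>\<^sub>M borel)" for H :: "real \<Rightarrow> real \<Rightarrow> ennreal"
  proof -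
    interpret c: prob_space "beta_measure a c" using pos by (intro prob_space_beta_measure)
    have "(\<integral>\<^sup>+x. \<integral>\<^sup>+y. ennreal (1 - x) * H x ((1 - x) * y) \<partial>beta_measure a c \<partial>beta_measure a b) =
      (\<integral>\<^sup>+x. ennreal (beta_kernel a b x / Beta a b) *
         (\<integral>\<^sup>+y. ennreal (1 - x) * H x ((1 - x) * y) \<partial>beta_measure a c) \<partial>lborel)"
      by (subst nn_integral_beta_measure) auto
    also have "\<dots> = (\<integral>\<^sup>+x. \<integral>\<^sup>+u. ennreal (k x u) * H x u \<partial>lborel \<partial>lborel)"
    proof (intro nn_integral_cong)
      fix x :: real
      show "ennreal (beta_kernel a b x / Beta a b) *
         (\<integral>\<^sup>+y. ennreal (1 - x) * H x ((1 - x) * y) \<partial>beta_measure a c) = (\<integral>\<^sup>+u. ennreal (k x u) * H x u \<partial>lborel)"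
      proof (cases "0 < x \<and> x < 1")
        case False
        then have "beta_kernel a b x = 0" "\<And>u. k x u = 0" by (auto simp: beta_kernel_def k_def)
        then show ?thesis by simp
      next
        case True
        \<comment> \<open>The summand 0 brings the substitution into the affine form expected by
          \<open>nn_integral_real_affine\<close>.\<close>
        have *: "beta_kernel a b x / Beta a b * (beta_kernel a c y / Beta a c) = k x (0 + (1 - x) * y)" for y
        proof (cases "0 < y \<and> y < 1")
          case False
          then have "\<not> (0 < (1 - x) * y \<and> x + (1 - x) * y < 1)"
          proof -
            have "(1 - x) * y < 1 - x \<longleftrightarrow> y < 1" using True by simp
            then have "x + (1 - x) * y < 1 \<longleftrightarrow> y < 1" by linarith
            with False True show ?thesis by (auto simp: zero_less_mult_iff)
          qed
          with False show ?thesis by (auto simp: beta_kernel_def k_def)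
        next
          case y: True
          have "(1 - x) * y < 1 - x" using y True by simp
          then have "k x (0 + (1 - x) * y) = x powr (a - 1) * ((1 - x) * y) powr (a - 1) * ((1 - x) * (1 - y)) powr (c - 1) / (Beta a b * Beta a c)"
            using y True by (simp add: k_def algebra_simps)
          also have "\<dots> = x powr (a - 1) * ((1 - x) powr (a - 1) * (1 - x) powr (c - 1)) * y powr (a - 1) * (1 - y) powr (c - 1) / (Beta a b * Beta a c)"
            using y True by (simp add: powr_mult)
          \<comment> \<open>All powers of 1 - x created by the substitution are absorbed by the
            density of x, so none is left to break the symmetry.\<close>
          also have "(1 - x) powr (a - 1) * (1 - x) powr (c - 1) = (1 - x) powr (b - 1)"
          proof -
            have "b - 1 = (a - 1) + (c - 1)" using rel by simp
            then show ?thesis by (simp only: powr_add)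
          qed
          finally show ?thesis using y True by (simp add: beta_kernel_def)
        qed
        have "ennreal (beta_kernel a b x / Beta a b) * (\<integral>\<^sup>+y. ennreal (1 - x) * H x ((1 - x) * y) \<partial>beta_measure a c)
          = ennreal (beta_kernel a b x / Beta a b) * (\<integral>\<^sup>+y. ennreal (beta_kernel a c y / Beta a c) * (ennreal (1 - x) * H x ((1 - x) * y)) \<partial>lborel)"
          by (subst nn_integral_beta_measure) auto
        also have "\<dots> = (\<integral>\<^sup>+y. ennreal (beta_kernel a b x / Beta a b) * (ennreal (beta_kernel a c y / Beta a c) * (ennreal (1 - x) * H x ((1 - x) * y))) \<partial>lborel)"
          by (subst nn_integral_cmult) auto
        also have "\<dots> = (\<integral>\<^sup>+y. ennreal (1 - x) * (ennreal (k x (0 + (1 - x) * y)) * H x (0 + (1 - x) * y)) \<partial>lborel)"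
        proof (intro nn_integral_cong)
          fix y :: real
          have "ennreal (k x (0 + (1 - x) * y)) = ennreal (beta_kernel a b x / Beta a b) * ennreal (beta_kernel a c y / Beta a c)"
            unfolding *[symmetric] using Beta_real_pos[of a b] Beta_real_pos[of a c] pos
            by (intro ennreal_mult divide_nonneg_pos beta_kernel_nonneg) auto
          then show "ennreal (beta_kernel a b x / Beta a b) * (ennreal (beta_kernel a c y / Beta a c) * (ennreal (1 - x) * H x ((1 - x) * y)))
            = ennreal (1 - x) * (ennreal (k x (0 + (1 - x) * y)) * H x (0 + (1 - x) * y))"
            by (simp add: ac_simps)
        qed
        also have "\<dots> = ennreal (1 - x) * (\<integral>\<^sup>+y. ennreal (k x (0 + (1 - x) * y)) * H x (0 + (1 - x) * y) \<partial>lborel)"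
          by (subst nn_integral_cmult) auto
        \<comment> \<open>The remaining weight 1 - x is exactly the Jacobian of u = (1 - x)
          y.\<close>
        also have "\<dots> = (\<integral>\<^sup>+u. ennreal (k x u) * H x u \<partial>lborel)"
          using True nn_integral_real_affine[of "\<lambda>u. ennreal (k x u) * H x u" "1 - x" 0] by simp
        finally show ?thesis .
      qed
    qed
    finally show ?thesis .
  qed
  have H': "case_prod (\<lambda>x y. H y x) \<in> borel_measurable (borel \<Otimes>\<^sub>M borel)"
    by measurable
  have "(\<integral>\<^sup>+x. \<integral>\<^sup>+u. ennreal (k x u) * H x u \<partial>lborel \<partial>lborel) = (\<integral>\<^sup>+u. \<integral>\<^sup>+x. ennreal (k x u) * H x u \<partial>lborel \<partial>lborel)"
    by (rule lborel_pair.Fubini'[symmetric]) measurable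
  also have "\<dots> = (\<integral>\<^sup>+x. \<integral>\<^sup>+u. ennreal (k x u) * H u x \<partial>lborel \<partial>lborel)"
    by (simp add: k_sym)
  finally show ?thesis
    unfolding key[OF H] key[OF H'] .
qed

section \<open>Splitting off the first stick\<close>

lemma PiM_case_nat:
  fixes M :: "nat \<Rightarrow> 'a measure"
  assumes M: "\<And>i. prob_space (M i)"
  shows "distr (M 0 \<Otimes>\<^sub>M PiM UNIV (\<lambda>i. M (Suc i))) (PiM UNIV M) (\<lambda>(x, v). case_nat x v) = PiM UNIV M"
    (is "?L = _")
proof (rule measure_eqI_PiM_infinite[symmetric, OF refl])
  interpret P: prob_space "PiM UNIV M" using M by (intro prob_space_PiM) auto
  interpret P': prob_space "PiM UNIV (\<lambda>i. M (Suc i))" using M by (intro prob_space_PiM) auto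
  interpret M0: prob_space "M 0" by fact
  show "finite_measure (PiM UNIV M)" by unfold_locales
  have meas: "(\<lambda>(x, v). case_nat x v) \<in> measurable (M 0 \<Otimes>\<^sub>M PiM UNIV (\<lambda>i. M (Suc i))) (PiM UNIV M)"
  proof (rule measurable_PiM_single)
    show "(\<lambda>(x, v). case_nat x v) \<in> space (M 0 \<Otimes>\<^sub>M PiM UNIV (\<lambda>i. M (Suc i))) \<rightarrow> (\<Pi>\<^sub>E i\<in>UNIV. space (M i))"
      by (auto simp: space_pair_measure space_PiM PiE_iff split: nat.split)
    fix A :: "'a set" and i :: nat assume "A \<in> sets (M i)"
    then show "{\<omega> \<in> space (M 0 \<Otimes>\<^sub>M PiM UNIV (\<lambda>i. M (Suc i))). (case \<omega> of (x, v) \<Rightarrow> case_nat x v) i \<in> A}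
      \<in> sets (M 0 \<Otimes>\<^sub>M PiM UNIV (\<lambda>i. M (Suc i)))"
      by (cases i) (auto simp: split_beta' intro!: measurable_sets_Collect)
  qed
  fix J A assume J: "finite J" and A: "\<And>i. i \<in> J \<Longrightarrow> A i \<in> sets (M i)"
  \<comment> \<open>Filling up with the whole space replaces J by an initial segment, which splits
    cleanly into coordinate 0 and the shifted rest.\<close>
  define B where "B i = (if i \<in> J then A i else space (M i))" for i
  have B: "B i \<in> sets (M i)" for i using A by (auto simp: B_def)
  obtain n where n: "J \<subseteq> {..n}" using J by (auto simp: finite_nat_iff_bounded_le)
  have 1: "prod_emb UNIV M J (Pi\<^sub>E J A) = prod_emb UNIV M {..n} (Pi\<^sub>E {..n} B)"
    using n by (fastforce simp: prod_emb_def B_def PiE_iff split: if_splits)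
  have "(M 0 \<Otimes>\<^sub>M PiM UNIV (\<lambda>i. M (Suc i))) ((\<lambda>(x, v). case_nat x v) -` prod_emb UNIV M {..n} (Pi\<^sub>E {..n} B) \<inter> space (M 0 \<Otimes>\<^sub>M PiM UNIV (\<lambda>i. M (Suc i)))) =
     (M 0 \<Otimes>\<^sub>M PiM UNIV (\<lambda>i. M (Suc i))) (B 0 \<times> prod_emb UNIV (\<lambda>i. M (Suc i)) {..<n} (\<Pi>\<^sub>E i\<in>{..<n}. B (Suc i)))"
  proof (intro arg_cong2[where f=emeasure] refl set_eqI)
    fix xv :: "'a \<times> (nat \<Rightarrow> 'a)"
    obtain x v where xv: "xv = (x, v)" by force
    have "x \<in> B 0 \<Longrightarrow> x \<in> space (M 0)" using B[THEN sets.sets_into_space] by auto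
    moreover have "(\<forall>i\<in>{..n}. case_nat x v i \<in> B i) \<longleftrightarrow> x \<in> B 0 \<and> (\<forall>i<n. v i \<in> B (Suc i))"
      using All_less_Suc2[of n "\<lambda>i. case_nat x v i \<in> B i"] by (simp add: Ball_def less_Suc_eq_le)
    ultimately show "xv \<in> (\<lambda>(x, v). case_nat x v) -` prod_emb UNIV M {..n} (Pi\<^sub>E {..n} B) \<inter> space (M 0 \<Otimes>\<^sub>M PiM UNIV (\<lambda>i. M (Suc i))) \<longleftrightarrow>
      xv \<in> B 0 \<times> prod_emb UNIV (\<lambda>i. M (Suc i)) {..<n} (\<Pi>\<^sub>E i\<in>{..<n}. B (Suc i))"
      by (auto simp: xv prod_emb_def space_pair_measure space_PiM PiE_iff split: nat.split)
  qed
  also have "\<dots> = M 0 (B 0) * (\<Prod>i<n. M (Suc i) (B (Suc i)))"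
    using B by (subst P'.emeasure_pair_measure_Times) (auto simp: emeasure_PiM_emb M intro!: sets_PiM_I)
  also have "\<dots> = (\<Prod>i\<le>n. M i (B i))"
    by (simp only: lessThan_Suc_atMost[symmetric] prod.lessThan_Suc_shift)
  also have "\<dots> = PiM UNIV M (prod_emb UNIV M {..n} (Pi\<^sub>E {..n} B))"
    using B by (subst emeasure_PiM_emb) (auto simp: M)
  finally show "PiM UNIV M (prod_emb UNIV M J (Pi\<^sub>E J A)) = ?L (prod_emb UNIV M J (Pi\<^sub>E J A))"
    unfolding 1 using B by (subst emeasure_distr[OF meas]) (auto intro!: sets_PiM_I)
qed (simp_all add: sets_distr)

text \<open>The remaining sticks break the residual mass 1 - x in the same way as a unit mass. This
  self-similarity drives the inductions on the weights of the Beta case.\<close>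

lemma sb_weights_case_nat:
  "sb_weights (case_nat x v) = case_nat x (\<lambda>j. (1 - x) * sb_weights v j)"
  by (rule ext) (auto simp: sb_weights_def prod.lessThan_Suc_shift simp del: prod.lessThan_Suc split: nat.split)

lemma one_minus_sum_sb_weights: "1 - (\<Sum>j<n. sb_weights v j) = (\<Prod>j<n. 1 - v j)"
  by (induction n) (simp_all add: sb_weights_def algebra_simps)

lemma measurable_sb_weights [measurable]:
  "sb_weights \<in> measurable (PiM UNIV (\<lambda>_. borel)) (PiM UNIV (\<lambda>_. borel))"
  by (rule measurable_PiM_single') (auto simp: sb_weights_def)

text \<open>The law of the lengths of a Pitman-Yor process; its image under
  \<open>sb_weights\<close> is the two-parameter GEM law. The sticks rather than the weights are the
  basic object because their law is a product measure.\<close>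

definition gem_sticks :: "real \<Rightarrow> real \<Rightarrow> (nat \<Rightarrow> real) measure" where
  "gem_sticks \<sigma> \<theta> = PiM UNIV (\<lambda>j. beta_measure (1 - \<sigma>) (\<theta> + real (Suc j) * \<sigma>))"

lemma sets_gem_sticks [simp, measurable_cong]: "sets (gem_sticks \<sigma> \<theta>) = sets (PiM UNIV (\<lambda>_. borel))"
  unfolding gem_sticks_def by (intro sets_PiM_cong) auto

lemma prob_space_gem_factor:
  assumes "0 \<le> \<sigma>" "\<sigma> < 1" "- \<sigma> < \<theta>"
  shows "prob_space (beta_measure (1 - \<sigma>) (\<theta> + real (Suc j) * \<sigma>))"
proof (rule prob_space_beta_measure)
  show "0 < \<theta> + real (Suc j) * \<sigma>"
  proof -
    have "0 \<le> real j * \<sigma>" using assms by simp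
    with assms show ?thesis unfolding of_nat_Suc distrib_right by linarith
  qed
qed (use assms in auto)

lemma prob_space_gem_sticks:
  assumes "0 \<le> \<sigma>" "\<sigma> < 1" "- \<sigma> < \<theta>"
  shows "prob_space (gem_sticks \<sigma> \<theta>)"
  unfolding gem_sticks_def by (intro prob_space_PiM prob_space_gem_factor assms)

lemma AE_gem_sticks:
  assumes "0 \<le> \<sigma>" "\<sigma> < 1" "- \<sigma> < \<theta>"
  shows "AE v in gem_sticks \<sigma> \<theta>. \<forall>j. 0 < v j \<and> v j < 1"
  unfolding AE_all_countable gem_sticks_def
  by (intro allI AE_PiM_component prob_space_gem_factor assms AE_beta_measure) auto

text \<open>Since \<theta> + (j + 2) \<sigma> = (\<theta> + \<sigma>) + (j + 1) \<sigma>, the sticks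
  after the first belong to the same family with \<theta> + \<sigma> in place of \<theta>.\<close>

lemma gem_sticks_case_nat:
  assumes "0 \<le> \<sigma>" "\<sigma> < 1" "- \<sigma> < \<theta>"
  shows "distr (beta_measure (1 - \<sigma>) (\<theta> + \<sigma>) \<Otimes>\<^sub>M gem_sticks \<sigma> (\<theta> + \<sigma>)) (PiM UNIV (\<lambda>_. borel)) (\<lambda>(x, v). case_nat x v)
    = gem_sticks \<sigma> \<theta>"
proof -
  have "gem_sticks \<sigma> (\<theta> + \<sigma>) = PiM UNIV (\<lambda>j. beta_measure (1 - \<sigma>) (\<theta> + real (Suc (Suc j)) * \<sigma>))"
    unfolding gem_sticks_def by (intro PiM_cong refl arg_cong2[where f=beta_measure]) (simp add: algebra_simps)
  moreover have "distr N (PiM UNIV (\<lambda>_. borel)) f = distr N (gem_sticks \<sigma> \<theta>) f" for N :: "(real \<times> (nat \<Rightarrow> real)) measure" and f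
    by (intro distr_cong) simp_all
  ultimately show ?thesis
    using PiM_case_nat[of "\<lambda>j. beta_measure (1 - \<sigma>) (\<theta> + real (Suc j) * \<sigma>)", OF prob_space_gem_factor[OF assms]]
    by (simp add: gem_sticks_def)
qed

lemma nn_integral_gem_sticks:
  assumes "0 \<le> \<sigma>" "\<sigma> < 1" "- \<sigma> < \<theta>" and [measurable]: "f \<in> borel_measurable (PiM UNIV (\<lambda>_. borel))"
  shows "(\<integral>\<^sup>+v. f v \<partial>gem_sticks \<sigma> \<theta>) =
    (\<integral>\<^sup>+x. \<integral>\<^sup>+v. f (case_nat x v) \<partial>gem_sticks \<sigma> (\<theta> + \<sigma>) \<partial>beta_measure (1 - \<sigma>) (\<theta> + \<sigma>))"
proof -
  interpret G: prob_space "gem_sticks \<sigma> (\<theta> + \<sigma>)" using assms by (intro prob_space_gem_sticks) auto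
  have "(\<integral>\<^sup>+v. f v \<partial>gem_sticks \<sigma> \<theta>) =
      (\<integral>\<^sup>+xv. f ((\<lambda>(x, v). case_nat x v) xv) \<partial>(beta_measure (1 - \<sigma>) (\<theta> + \<sigma>) \<Otimes>\<^sub>M gem_sticks \<sigma> (\<theta> + \<sigma>)))"
    unfolding gem_sticks_case_nat[OF assms(1-3), symmetric] by (rule nn_integral_distr) measurable
  also have "\<dots> = (\<integral>\<^sup>+x. \<integral>\<^sup>+v. f ((\<lambda>(x, v). case_nat x v) (x, v)) \<partial>gem_sticks \<sigma> (\<theta> + \<sigma>) \<partial>beta_measure (1 - \<sigma>) (\<theta> + \<sigma>))"
    by (subst G.nn_integral_fst) simp_all
  finally show ?thesis by simp
qed

text \<open>Fubini for null sets; it serves to hand properness down to the tail of the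
  sequence.\<close>

lemma AE_gem_sticks_case_nat:
  assumes "0 \<le> \<sigma>" "\<sigma> < 1" "- \<sigma> < \<theta>" and [measurable]: "Measurable.pred (PiM UNIV (\<lambda>_. borel)) P"
    and "AE v in gem_sticks \<sigma> \<theta>. P v"
  shows "AE x in beta_measure (1 - \<sigma>) (\<theta> + \<sigma>). AE v in gem_sticks \<sigma> (\<theta> + \<sigma>). P (case_nat x v)"
proof -
  interpret G: prob_space "gem_sticks \<sigma> (\<theta> + \<sigma>)" using assms by (intro prob_space_gem_sticks) auto
  interpret B: prob_space "beta_measure (1 - \<sigma>) (\<theta> + \<sigma>)"
    using assms by (intro prob_space_beta_measure) auto
  interpret pair: pair_sigma_finite "beta_measure (1 - \<sigma>) (\<theta> + \<sigma>)" "gem_sticks \<sigma> (\<theta> + \<sigma>)" ..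
  have "AE xv in beta_measure (1 - \<sigma>) (\<theta> + \<sigma>) \<Otimes>\<^sub>M gem_sticks \<sigma> (\<theta> + \<sigma>). P ((\<lambda>(x, v). case_nat x v) xv)"
    using assms(5) unfolding gem_sticks_case_nat[OF assms(1-3), symmetric]
    by (subst (asm) AE_distr_iff) auto
  from pair.AE_pair[OF this] show ?thesis by simp
qed

section \<open>Moving a size-biased pick to a given position\<close>

text \<open>The sequence w o move_to m i is w with its entry i moved to position m and the entries m, ..., i - 1
  shifted by one.\<close>

definition move_to :: "nat \<Rightarrow> nat \<Rightarrow> nat \<Rightarrow> nat" where
  "move_to m i j = (if j < m then j else if j = m then i else if j \<le> i then j - 1 else j)"

lemma bij_move_to: "m \<le> i \<Longrightarrow> bij (move_to m i)"
  by (rule o_bij[of "\<lambda>k. if k < m then k else if k = i then m else if k < i then k + 1 else k"])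
    (auto simp: move_to_def fun_eq_iff)

lemma move_to_same: "move_to m m = id"
  by (auto simp: move_to_def fun_eq_iff)

lemma case_nat_move_to: "case_nat x u \<circ> move_to (Suc m) (Suc i) = case_nat x (u \<circ> move_to m i)"
  by (auto simp: move_to_def fun_eq_iff split: nat.split) 

text \<open>A pick inside the tail is first moved to the front of the tail and then jumps over x.
  This last exchange of two entries is what \<open>beta_swap\<close> has to compensate.\<close>

lemma case_nat_move_to_0:
  "case_nat x u \<circ> move_to 0 (Suc i) = (\<lambda>w. case_nat (w 0) (case_nat x (\<lambda>j. w (Suc j)))) (u \<circ> move_to 0 i)"
  by (auto simp: move_to_def fun_eq_iff split: nat.split)


lemma measurable_PiM_comp [measurable (raw)]:
  assumes [measurable]: "f \<in> measurable N (PiM UNIV (\<lambda>_. M))"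
  shows "(\<lambda>x. f x \<circ> g) \<in> measurable N (PiM UNIV (\<lambda>_. M))"
proof (rule measurable_PiM_single')
  show "(\<lambda>x. (f x \<circ> g) i) \<in> measurable N M" for i unfolding comp_def by measurable
qed (use measurable_space[OF assms] in \<open>auto simp: space_PiM PiE_iff\<close>)

lemma measurable_PiM_scale [measurable (raw)]:
  fixes f :: "'a \<Rightarrow> nat \<Rightarrow> real"
  assumes [measurable]: "f \<in> measurable N (PiM UNIV (\<lambda>_. borel))" "c \<in> borel_measurable N"
  shows "(\<lambda>x j. c x * f x (g j)) \<in> measurable N (PiM UNIV (\<lambda>_. borel))"
  by (rule measurable_PiM_single') auto

text \<open>With n = infinity this is invariance under moving a size-biased pick to the front; keeping the
  remainder term makes the truncated identity exact, so that it can be proved by induction on n.\<close>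

lemma gem_move_to_front_partial:
  assumes "0 \<le> \<sigma>" "\<sigma> < 1" "- \<sigma> < \<theta>" and F: "F \<in> borel_measurable (PiM UNIV (\<lambda>_. borel))"
  shows "(\<integral>\<^sup>+v. (\<Sum>i<n. ennreal (sb_weights v i) * F (sb_weights v \<circ> move_to 0 i))
      + ennreal (1 - (\<Sum>i<n. sb_weights v i)) * F (sb_weights v \<circ> move_to 0 n) \<partial>gem_sticks \<sigma> \<theta>)
    = (\<integral>\<^sup>+v. F (sb_weights v) \<partial>gem_sticks \<sigma> \<theta>)"
  using assms
proof (induction n arbitrary: \<theta> F)
  case 0
  then show ?case by (simp add: move_to_same)
next
  case (Suc n)
  note par = Suc.prems(1-3) and F [measurable] = Suc.prems(4)
  have par': "- \<sigma> < \<theta> + \<sigma>" "- \<sigma> < \<theta> + \<sigma> + \<sigma>" using par by auto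
  let ?b = "beta_measure (1 - \<sigma>) (\<theta> + \<sigma>)" and ?G = "gem_sticks \<sigma> (\<theta> + \<sigma>)"
  let ?b' = "beta_measure (1 - \<sigma>) (\<theta> + \<sigma> + \<sigma>)" and ?G' = "gem_sticks \<sigma> (\<theta> + \<sigma> + \<sigma>)"
  interpret G: prob_space ?G using par par' by (intro prob_space_gem_sticks) auto
  interpret G': prob_space ?G' using par par' by (intro prob_space_gem_sticks) auto
  interpret b': prob_space ?b' using par par' by (intro prob_space_beta_measure) auto
  \<comment> \<open>\<open>A\<close> belongs to the case that the pick is the first weight x,
    \<open>B\<close> to a pick from the tail, once the induction hypothesis has replaced that pick
    by the first entry of the tail. \<open>H a c\<close> averages F over everything beyond the first
    two weights a and c; \<open>A\<close> and \<open>B\<close> turn out to use it with the arguments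
    in opposite order.\<close>
  define A where "A x = (\<integral>\<^sup>+v. F (case_nat x (\<lambda>j. (1 - x) * sb_weights v j)) \<partial>?G)" for x
  define Fx where "Fx x u = F (case_nat ((1 - x) * u 0) (case_nat x (\<lambda>j. (1 - x) * u (Suc j))))" for x u
  define B where "B x = (\<integral>\<^sup>+v. Fx x (sb_weights v) \<partial>?G)" for x
  define H where "H a c = (\<integral>\<^sup>+v. F (case_nat a (case_nat c (\<lambda>j. (1 - a - c) * sb_weights v j))) \<partial>?G')" for a c
  have Fx [measurable]: "Fx x \<in> borel_measurable (PiM UNIV (\<lambda>_. borel))" for x
    unfolding Fx_def by measurable
  have H [measurable]: "case_prod H \<in> borel_measurable (borel \<Otimes>\<^sub>M borel)"
    unfolding H_def by measurable
  have A_meas [measurable]: "A \<in> borel_measurable borel"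
    unfolding A_def by measurable
  have B_meas [measurable]: "B \<in> borel_measurable borel"
    unfolding B_def Fx_def by measurable
  \<comment> \<open>Conditioning on the second stick y makes the second weight (1 - x) y. The mass
    then left over is symmetric in the two weights, so the same \<open>H\<close> also serves for
    \<open>B\<close>.\<close>
  have A: "A x = (\<integral>\<^sup>+y. H x ((1 - x) * y) \<partial>?b')" for x
  proof -
    have "A x = (\<integral>\<^sup>+y. \<integral>\<^sup>+v. F (case_nat x (\<lambda>j. (1 - x) * sb_weights (case_nat y v) j)) \<partial>?G' \<partial>?b')"
      unfolding A_def by (rule nn_integral_gem_sticks) (use par par' in auto)
    moreover have "(\<lambda>j. (1 - x) * sb_weights (case_nat y v) j) = case_nat ((1 - x) * y) (\<lambda>j. (1 - x - (1 - x) * y) * sb_weights v j)" for y v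
      by (rule ext) (simp add: sb_weights_case_nat algebra_simps split: nat.split)
    ultimately show ?thesis by (simp add: H_def)
  qed
  have B: "B x = (\<integral>\<^sup>+y. H ((1 - x) * y) x \<partial>?b')" for x
  proof -
    have "B x = (\<integral>\<^sup>+y. \<integral>\<^sup>+v. Fx x (sb_weights (case_nat y v)) \<partial>?G' \<partial>?b')"
      unfolding B_def by (rule nn_integral_gem_sticks) (use par par' in auto)
    moreover have "Fx x (sb_weights (case_nat y v)) = F (case_nat ((1 - x) * y) (case_nat x (\<lambda>j. (1 - (1 - x) * y - x) * sb_weights v j)))" for y v
      by (simp add: Fx_def sb_weights_case_nat algebra_simps)
    ultimately show ?thesis by (simp add: H_def)
  qed
  have "(\<integral>\<^sup>+v. (\<Sum>i<Suc n. ennreal (sb_weights v i) * F (sb_weights v \<circ> move_to 0 i))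
      + ennreal (1 - (\<Sum>i<Suc n. sb_weights v i)) * F (sb_weights v \<circ> move_to 0 (Suc n)) \<partial>gem_sticks \<sigma> \<theta>)
    = (\<integral>\<^sup>+x. \<integral>\<^sup>+v. (\<Sum>i<Suc n. ennreal (sb_weights (case_nat x v) i) * F (sb_weights (case_nat x v) \<circ> move_to 0 i))
      + ennreal (1 - (\<Sum>i<Suc n. sb_weights (case_nat x v) i)) * F (sb_weights (case_nat x v) \<circ> move_to 0 (Suc n)) \<partial>?G \<partial>?b)"
    by (rule nn_integral_gem_sticks[OF par]) measurable
  also have "\<dots> = (\<integral>\<^sup>+x. ennreal x * A x + ennreal (1 - x) * B x \<partial>?b)"
    using AE_beta_measure
  proof (rule nn_integral_cong_AE[OF AE_mp], intro AE_I2 impI)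
    fix x :: real assume x: "0 < x \<and> x < 1"
    have front: "F (sb_weights (case_nat x v) \<circ> move_to 0 (Suc i)) = Fx x (sb_weights v \<circ> move_to 0 i)" for v i
      by (simp only: sb_weights_case_nat case_nat_move_to_0 Fx_def) (simp add: comp_def)
    have rest: "1 - (\<Sum>i<Suc n. sb_weights (case_nat x v) i) = (1 - x) * (1 - (\<Sum>i<n. sb_weights v i))" for v
      unfolding one_minus_sum_sb_weights by (simp add: prod.lessThan_Suc_shift del: prod.lessThan_Suc)
    have "(\<integral>\<^sup>+v. (\<Sum>i<Suc n. ennreal (sb_weights (case_nat x v) i) * F (sb_weights (case_nat x v) \<circ> move_to 0 i))
      + ennreal (1 - (\<Sum>i<Suc n. sb_weights (case_nat x v) i)) * F (sb_weights (case_nat x v) \<circ> move_to 0 (Suc n)) \<partial>?G)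
      = (\<integral>\<^sup>+v. ennreal x * F (case_nat x (\<lambda>j. (1 - x) * sb_weights v j)) + ennreal (1 - x) *
          ((\<Sum>i<n. ennreal (sb_weights v i) * Fx x (sb_weights v \<circ> move_to 0 i))
            + ennreal (1 - (\<Sum>i<n. sb_weights v i)) * Fx x (sb_weights v \<circ> move_to 0 n)) \<partial>?G)"
      unfolding front rest
    proof (intro nn_integral_cong)
      fix v
      have *: "ennreal (sb_weights (case_nat x v) (Suc i)) * F (sb_weights (case_nat x v) \<circ> move_to 0 (Suc i))
          = ennreal (1 - x) * (ennreal (sb_weights v i) * Fx x (sb_weights v \<circ> move_to 0 i))" for i
        using x unfolding front by (simp add: sb_weights_case_nat ennreal_mult' mult.assoc)
      have **: "ennreal (sb_weights (case_nat x v) 0) * F (sb_weights (case_nat x v) \<circ> move_to 0 0)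
          = ennreal x * F (case_nat x (\<lambda>j. (1 - x) * sb_weights v j))"
        by (simp add: sb_weights_case_nat move_to_same)
      show "(\<Sum>i<Suc n. ennreal (sb_weights (case_nat x v) i) * F (sb_weights (case_nat x v) \<circ> move_to 0 i))
          + ennreal ((1 - x) * (1 - (\<Sum>i<n. sb_weights v i))) * Fx x (sb_weights v \<circ> move_to 0 n)
        = ennreal x * F (case_nat x (\<lambda>j. (1 - x) * sb_weights v j)) + ennreal (1 - x) *
          ((\<Sum>i<n. ennreal (sb_weights v i) * Fx x (sb_weights v \<circ> move_to 0 i))
            + ennreal (1 - (\<Sum>i<n. sb_weights v i)) * Fx x (sb_weights v \<circ> move_to 0 n))"
        unfolding sum.lessThan_Suc_shift * **
        using x by (simp add: ennreal_mult' sum_distrib_left distrib_left mult.assoc add.assoc)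
    qed
    also have "\<dots> = ennreal x * A x + ennreal (1 - x) * (\<integral>\<^sup>+v. (\<Sum>i<n. ennreal (sb_weights v i) * Fx x (sb_weights v \<circ> move_to 0 i))
            + ennreal (1 - (\<Sum>i<n. sb_weights v i)) * Fx x (sb_weights v \<circ> move_to 0 n) \<partial>?G)"
      unfolding A_def by (subst nn_integral_add, measurable) (simp add: nn_integral_cmult)
    also have "\<dots> = ennreal x * A x + ennreal (1 - x) * B x"
      unfolding B_def by (subst Suc.IH) (use par par' in auto)
    finally show "(\<integral>\<^sup>+v. (\<Sum>i<Suc n. ennreal (sb_weights (case_nat x v) i) * F (sb_weights (case_nat x v) \<circ> move_to 0 i))
      + ennreal (1 - (\<Sum>i<Suc n. sb_weights (case_nat x v) i)) * F (sb_weights (case_nat x v) \<circ> move_to 0 (Suc n)) \<partial>?G)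
      = ennreal x * A x + ennreal (1 - x) * B x" .
  qed
  also have "\<dots> = (\<integral>\<^sup>+x. ennreal x * A x \<partial>?b) + (\<integral>\<^sup>+x. ennreal (1 - x) * B x \<partial>?b)"
    by (rule nn_integral_add) measurable
  also have "(\<integral>\<^sup>+x. ennreal (1 - x) * B x \<partial>?b) = (\<integral>\<^sup>+x. \<integral>\<^sup>+y. ennreal (1 - x) * H ((1 - x) * y) x \<partial>?b' \<partial>?b)"
    unfolding B by (simp add: nn_integral_cmult)
  \<comment> \<open>The instance of \<open>beta_swap\<close> is b = \<theta> + \<sigma>, c =
    \<theta> + 2 \<sigma>. Afterwards both cases carry \<open>A x\<close>, with weights x and 1 - x
    that add up to one.\<close>
  also have "\<dots> = (\<integral>\<^sup>+x. \<integral>\<^sup>+y. ennreal (1 - x) * H x ((1 - x) * y) \<partial>?b' \<partial>?b)"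
    by (rule beta_swap[symmetric, OF H]) (use par par' in auto)
  also have "\<dots> = (\<integral>\<^sup>+x. ennreal (1 - x) * A x \<partial>?b)"
    unfolding A by (simp add: nn_integral_cmult)
  also have "(\<integral>\<^sup>+x. ennreal x * A x \<partial>?b) + \<dots> = (\<integral>\<^sup>+x. ennreal x * A x + ennreal (1 - x) * A x \<partial>?b)"
    by (rule nn_integral_add[symmetric]) measurable
  also have "\<dots> = (\<integral>\<^sup>+x. A x \<partial>?b)"
    using AE_beta_measure
    by (rule nn_integral_cong_AE[OF AE_mp], intro AE_I2 impI)
       (simp add: distrib_right[symmetric] ennreal_plus[symmetric] del: ennreal_plus)
  also have "\<dots> = (\<integral>\<^sup>+v. F (sb_weights v) \<partial>gem_sticks \<sigma> \<theta>)"
    by (subst nn_integral_gem_sticks[OF par]) (simp_all add: sb_weights_case_nat flip: A_def)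
  finally show ?case .
qed

lemma suminf_ennreal_Suc:
  fixes f :: "nat \<Rightarrow> ennreal"
  assumes "f 0 = 0"
  shows "(\<Sum>i. f i) = (\<Sum>i. f (Suc i))"
proof -
  have "(\<lambda>i. f (Suc i)) sums (\<Sum>i. f (Suc i))" by (simp add: summable_sums)
  then have "(\<lambda>n. \<Sum>i<Suc n. f i) \<longlonglongrightarrow> (\<Sum>i. f (Suc i))"
    unfolding sum.lessThan_Suc_shift sums_def using assms by simp
  then have "f sums (\<Sum>i. f (Suc i))"
    unfolding sums_def by (rule LIMSEQ_imp_Suc)
  then show ?thesis by (rule sums_unique[symmetric])
qed

lemma suminf_ennreal_bij:
  fixes f :: "nat \<Rightarrow> ennreal"
  assumes "bij \<pi>"
  shows "(\<Sum>i. f (\<pi> i)) = (\<Sum>i. f i)"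
  unfolding nn_integral_count_space_nat[symmetric] by (rule nn_integral_bij_count_space[OF assms])

lemma suminf_ennreal_real_sums:
  assumes "\<And>i. 0 \<le> w i" "(\<Sum>i. ennreal (w i)) = 1"
  shows "w sums 1"
proof -
  have "(\<lambda>i. ennreal (w i)) sums ennreal 1"
    using assms(2) summable_sums[of "\<lambda>i. ennreal (w i)"] by simp
  with assms(1) show ?thesis by (subst (asm) sums_ennreal) auto
qed

lemma sb_weights_nonneg: "0 \<le> sb_weights v j" if "\<And>j. 0 \<le> v j \<and> v j \<le> 1"
  unfolding sb_weights_def using that by (intro mult_nonneg_nonneg prod_nonneg) auto

text \<open>The limit n to infinity of the exact truncated identity. Boundedness of F bounds the
  remainder \<open>r n\<close> by C times the expected mass beyond n sticks, which vanishes by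
  properness and dominated convergence.\<close>

lemma gem_move_to_front_bounded:
  assumes par: "0 \<le> \<sigma>" "\<sigma> < 1" "- \<sigma> < \<theta>" and F [measurable]: "F \<in> borel_measurable (PiM UNIV (\<lambda>_. borel))"
    and proper: "AE v in gem_sticks \<sigma> \<theta>. (\<Sum>i. ennreal (sb_weights v i)) = 1"
    and bdd: "\<And>w. F w \<le> C" "C < \<infinity>"
  shows "(\<integral>\<^sup>+v. (\<Sum>i. ennreal (sb_weights v i) * F (sb_weights v \<circ> move_to 0 i)) \<partial>gem_sticks \<sigma> \<theta>)
    = (\<integral>\<^sup>+v. F (sb_weights v) \<partial>gem_sticks \<sigma> \<theta>)"
proof -
  let ?G = "gem_sticks \<sigma> \<theta>"
  interpret G: prob_space ?G by (rule prob_space_gem_sticks[OF par])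
  define a where "a n = (\<integral>\<^sup>+v. (\<Sum>i<n. ennreal (sb_weights v i) * F (sb_weights v \<circ> move_to 0 i)) \<partial>?G)" for n
  define r where "r n = (\<integral>\<^sup>+v. ennreal (1 - (\<Sum>i<n. sb_weights v i)) * F (sb_weights v \<circ> move_to 0 n) \<partial>?G)" for n
  have sum: "a n + r n = (\<integral>\<^sup>+v. F (sb_weights v) \<partial>?G)" for n
    unfolding a_def r_def by (subst nn_integral_add[symmetric]) (auto simp: gem_move_to_front_partial[OF par F])
  have "(\<lambda>n. \<Sum>i<n. \<integral>\<^sup>+v. ennreal (sb_weights v i) * F (sb_weights v \<circ> move_to 0 i) \<partial>?G)
      \<longlonglongrightarrow> (\<Sum>i. \<integral>\<^sup>+v. ennreal (sb_weights v i) * F (sb_weights v \<circ> move_to 0 i) \<partial>?G)"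
    by (intro summable_LIMSEQ) simp
  then have a: "a \<longlonglongrightarrow> (\<integral>\<^sup>+v. (\<Sum>i. ennreal (sb_weights v i) * F (sb_weights v \<circ> move_to 0 i)) \<partial>?G)"
    unfolding a_def by (subst nn_integral_suminf) (simp_all add: nn_integral_sum)
  have "(\<lambda>n. \<integral>\<^sup>+v. ennreal (1 - (\<Sum>i<n. sb_weights v i)) \<partial>?G) \<longlonglongrightarrow> (\<integral>\<^sup>+v. 0 \<partial>?G)"
  proof (rule nn_integral_dominated_convergence[where w="\<lambda>_. 1"])
    show "AE v in ?G. ennreal (1 - (\<Sum>i<j. sb_weights v i)) \<le> 1" for j
      using AE_gem_sticks[OF par]
    proof eventually_elim
      case (elim v)
      then have "(\<Prod>i<j. 1 - v i) \<le> 1" by (intro prod_le_1) (auto intro: less_imp_le)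
      then show ?case unfolding one_minus_sum_sb_weights by (simp add: ennreal_le_1)
    qed
    show "AE v in ?G. (\<lambda>n. ennreal (1 - (\<Sum>i<n. sb_weights v i))) \<longlonglongrightarrow> 0"
      using AE_gem_sticks[OF par] proper
    proof eventually_elim
      case (elim v)
      then have "sb_weights v sums 1"
        by (intro suminf_ennreal_real_sums sb_weights_nonneg) (auto intro: less_imp_le)
      then have "(\<lambda>n. 1 - (\<Sum>i<n. sb_weights v i)) \<longlonglongrightarrow> 1 - 1"
        unfolding sums_def by (intro tendsto_intros)
      from tendsto_ennrealI[OF this] show ?case by simp
    qed
  qed (auto simp: G.emeasure_space_1)
  then have "(\<lambda>n. C * (\<integral>\<^sup>+v. ennreal (1 - (\<Sum>i<n. sb_weights v i)) \<partial>?G)) \<longlonglongrightarrow> C * 0"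
    using bdd(2) by (intro ennreal_tendsto_cmult) auto
  moreover have "r n \<le> C * (\<integral>\<^sup>+v. ennreal (1 - (\<Sum>i<n. sb_weights v i)) \<partial>?G)" for n
    unfolding r_def
    by (subst nn_integral_cmult[symmetric]) (auto intro!: nn_integral_mono mult_mono bdd(1) simp: mult.commute[of C])
  ultimately have "r \<longlonglongrightarrow> 0"
    by (intro tendsto_sandwich[OF _ _ tendsto_const[of 0], of r _ "\<lambda>n. C * (\<integral>\<^sup>+v. ennreal (1 - (\<Sum>i<n. sb_weights v i)) \<partial>?G)"])
       auto
  from tendsto_add[OF a this] show ?thesis
    unfolding sum by (simp add: LIMSEQ_const_iff)
qed

text \<open>The bound on F is removed by monotone convergence along the truncations min F k.\<close>

lemma gem_move_to_front:
  assumes par: "0 \<le> \<sigma>" "\<sigma> < 1" "- \<sigma> < \<theta>" and F [measurable]: "F \<in> borel_measurable (PiM UNIV (\<lambda>_. borel))"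
    and proper: "AE v in gem_sticks \<sigma> \<theta>. (\<Sum>i. ennreal (sb_weights v i)) = 1"
  shows "(\<integral>\<^sup>+v. (\<Sum>i. ennreal (sb_weights v i) * F (sb_weights v \<circ> move_to 0 i)) \<partial>gem_sticks \<sigma> \<theta>)
    = (\<integral>\<^sup>+v. F (sb_weights v) \<partial>gem_sticks \<sigma> \<theta>)"
proof -
  let ?G = "gem_sticks \<sigma> \<theta>"
  define Fk where "Fk k w = min (F w) (of_nat k)" for k :: nat and w
  have Fk [measurable]: "Fk k \<in> borel_measurable (PiM UNIV (\<lambda>_. borel))" for k
    unfolding Fk_def by measurable
  have Fk_mono: "Fk k w \<le> Fk l w" if "k \<le> l" for k l w
    unfolding Fk_def using that by (intro min.mono) auto
  have Fk_SUP: "F w = (SUP k. Fk k w)" for w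
    unfolding Fk_def inf_min[symmetric] inf_SUP[symmetric] ennreal_SUP_of_nat_eq_top by simp
  have "(\<integral>\<^sup>+v. (\<Sum>i. ennreal (sb_weights v i) * F (sb_weights v \<circ> move_to 0 i)) \<partial>?G)
      = (\<integral>\<^sup>+v. (SUP k. (\<Sum>i. ennreal (sb_weights v i) * Fk k (sb_weights v \<circ> move_to 0 i))) \<partial>?G)"
    unfolding Fk_SUP SUP_mult_left_ennreal
    by (subst ennreal_suminf_SUP_eq) (auto simp: incseq_def intro!: mult_left_mono Fk_mono)
  also have "\<dots> = (SUP k. \<integral>\<^sup>+v. (\<Sum>i. ennreal (sb_weights v i) * Fk k (sb_weights v \<circ> move_to 0 i)) \<partial>?G)"
    by (intro nn_integral_monotone_convergence_SUP)
      (auto simp: incseq_def le_fun_def intro!: suminf_le mult_left_mono Fk_mono)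
  also have "\<dots> = (SUP k. \<integral>\<^sup>+v. Fk k (sb_weights v) \<partial>?G)"
  proof (intro SUP_cong refl)
    fix k :: nat
    show "(\<integral>\<^sup>+v. (\<Sum>i. ennreal (sb_weights v i) * Fk k (sb_weights v \<circ> move_to 0 i)) \<partial>?G) = (\<integral>\<^sup>+v. Fk k (sb_weights v) \<partial>?G)"
      by (rule gem_move_to_front_bounded[OF par Fk proper, where C="of_nat k"]) (auto simp: Fk_def of_nat_less_top)
  qed
  also have "\<dots> = (\<integral>\<^sup>+v. (SUP k. Fk k (sb_weights v)) \<partial>?G)"
    by (intro nn_integral_monotone_convergence_SUP[symmetric]) (auto simp: incseq_def le_fun_def intro!: Fk_mono)
  finally show ?thesis unfolding Fk_SUP .
qed

text \<open>From x + (1 - x) s = 1 with x < 1 follows s = 1, where s is the total mass of the tail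
  weights. The conclusion does not mention x, so a single good value of x is enough.\<close>

lemma gem_proper_tail:
  assumes par: "0 \<le> \<sigma>" "\<sigma> < 1" "- \<sigma> < \<theta>"
    and proper: "AE v in gem_sticks \<sigma> \<theta>. (\<Sum>i. ennreal (sb_weights v i)) = 1"
  shows "AE v in gem_sticks \<sigma> (\<theta> + \<sigma>). (\<Sum>i. ennreal (sb_weights v i)) = 1"
proof -
  interpret b: prob_space "beta_measure (1 - \<sigma>) (\<theta> + \<sigma>)"
    using par by (intro prob_space_beta_measure) auto
  have "AE x in beta_measure (1 - \<sigma>) (\<theta> + \<sigma>). 0 < x \<and> x < 1 \<and>
      (AE v in gem_sticks \<sigma> (\<theta> + \<sigma>). (\<Sum>i. ennreal (sb_weights (case_nat x v) i)) = 1)"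
    using AE_beta_measure AE_gem_sticks_case_nat[OF par _ proper] by simp
  \<comment> \<open>A property that holds almost surely under a probability measure holds
    somewhere.\<close>
  then have "\<exists>x. 0 < x \<and> x < 1 \<and> (AE v in gem_sticks \<sigma> (\<theta> + \<sigma>). (\<Sum>i. ennreal (sb_weights (case_nat x v) i)) = 1)"
  proof (rule contrapos_pp)
    assume neg: "\<not> (\<exists>x. 0 < x \<and> x < 1 \<and> (AE v in gem_sticks \<sigma> (\<theta> + \<sigma>). (\<Sum>i. ennreal (sb_weights (case_nat x v) i)) = 1))"
    have "\<not> (AE x in beta_measure (1 - \<sigma>) (\<theta> + \<sigma>). False)" by simp
    then show "\<not> (AE x in beta_measure (1 - \<sigma>) (\<theta> + \<sigma>). 0 < x \<and> x < 1 \<and>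
      (AE v in gem_sticks \<sigma> (\<theta> + \<sigma>). (\<Sum>i. ennreal (sb_weights (case_nat x v) i)) = 1))"
      by (rule contrapos_nn) (erule eventually_mono, use neg in blast)
  qed
  then obtain x where x: "0 < x" "x < 1"
    and AE: "AE v in gem_sticks \<sigma> (\<theta> + \<sigma>). (\<Sum>i. ennreal (sb_weights (case_nat x v) i)) = 1"
    by blast
  from AE show ?thesis
  proof eventually_elim
    case (elim v)
    let ?f = "\<lambda>i. ennreal (sb_weights (case_nat x v) i)"
    have "(\<Sum>i. ?f i) = ennreal x + (\<Sum>i. ?f (Suc i))"
      using suminf_offset[of ?f 1] by (simp add: sb_weights_case_nat)
    also have "(\<Sum>i. ?f (Suc i)) = ennreal (1 - x) * (\<Sum>i. ennreal (sb_weights v i))"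
      using x by (simp add: sb_weights_case_nat ennreal_mult')
    finally have *: "1 = ennreal x + ennreal (1 - x) * (\<Sum>i. ennreal (sb_weights v i))"
      using elim by simp
    show ?case
    proof (cases "\<Sum>i. ennreal (sb_weights v i)")
      case (real s)
      with * x have "ennreal 1 = ennreal (x + (1 - x) * s)"
        by (simp add: ennreal_mult ennreal_plus)
      then have "1 = x + (1 - x) * s" using x real by (subst (asm) ennreal_inj) auto
      then have "(1 - x) * (1 - s) = 0" by (simp add: algebra_simps)
      with x real show ?thesis by simp
    next
      case top
      with * x show ?thesis by (simp add: ennreal_mult_top)
    qed
  qed
qed


text \<open>The conditional pick probability is a ratio of a weight and a residual mass, so the
  common factor 1 - x cancels when the first weight is removed. A pick at position m + 1 becomes a
  pick at position m in the tail, and the induction ends with a pick moved to the front.\<close>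

lemma gem_move_to:
  assumes "0 \<le> \<sigma>" "\<sigma> < 1" "- \<sigma> < \<theta>" and "F \<in> borel_measurable (PiM UNIV (\<lambda>_. borel))"
    and "AE v in gem_sticks \<sigma> \<theta>. (\<Sum>i. ennreal (sb_weights v i)) = 1"
  shows "(\<integral>\<^sup>+v. (\<Sum>i. ennreal (if i < m then 0 else sb_weights v i / (1 - (\<Sum>l<m. sb_weights v l)))
        * F (sb_weights v \<circ> move_to m i)) \<partial>gem_sticks \<sigma> \<theta>)
    = (\<integral>\<^sup>+v. F (sb_weights v) \<partial>gem_sticks \<sigma> \<theta>)"
  using assms
proof (induction m arbitrary: \<theta> F)
  case 0
  then show ?case using gem_move_to_front[of \<sigma> \<theta> F] by (simp add: comp_def)
next
  case (Suc m)
  note par = Suc.prems(1-3) and F [measurable] = Suc.prems(4) and proper = Suc.prems(5)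
  have par': "- \<sigma> < \<theta> + \<sigma>" using par by auto
  let ?b = "beta_measure (1 - \<sigma>) (\<theta> + \<sigma>)" and ?G = "gem_sticks \<sigma> (\<theta> + \<sigma>)"
  define Fx where "Fx x u = F (case_nat x (\<lambda>j. (1 - x) * u j))" for x u
  have Fx [measurable]: "Fx x \<in> borel_measurable (PiM UNIV (\<lambda>_. borel))" for x
    unfolding Fx_def by measurable
  let ?L = "\<lambda>m F w. \<Sum>i. ennreal (if i < m then 0 else w i / (1 - (\<Sum>l<m. w l))) * F (w \<circ> move_to m i)"
  have "(\<integral>\<^sup>+v. ?L (Suc m) F (sb_weights v) \<partial>gem_sticks \<sigma> \<theta>)
    = (\<integral>\<^sup>+x. \<integral>\<^sup>+v. ?L (Suc m) F (sb_weights (case_nat x v)) \<partial>?G \<partial>?b)"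
    by (rule nn_integral_gem_sticks[OF par]) measurable
  also have "\<dots> = (\<integral>\<^sup>+x. \<integral>\<^sup>+v. Fx x (sb_weights v) \<partial>?G \<partial>?b)"
    using AE_beta_measure
  proof (rule nn_integral_cong_AE[OF AE_mp], intro AE_I2 impI)
    fix x :: real assume x: "0 < x \<and> x < 1"
    have *: "?L (Suc m) F (sb_weights (case_nat x v)) = ?L m (Fx x) (sb_weights v)" for v
    proof -
      have rest: "1 - (\<Sum>l<Suc m. sb_weights (case_nat x v) l) = (1 - x) * (1 - (\<Sum>l<m. sb_weights v l))"
        unfolding one_minus_sum_sb_weights by (simp add: prod.lessThan_Suc_shift del: prod.lessThan_Suc)
      have "F (sb_weights (case_nat x v) \<circ> move_to (Suc m) (Suc i)) = Fx x (sb_weights v \<circ> move_to m i)" for i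
        by (simp only: sb_weights_case_nat case_nat_move_to Fx_def) (simp add: comp_def)
      moreover have "sb_weights (case_nat x v) (Suc i) / ((1 - x) * (1 - (\<Sum>l<m. sb_weights v l)))
          = sb_weights v i / (1 - (\<Sum>l<m. sb_weights v l))" for i
        using x by (simp add: sb_weights_case_nat)
      ultimately have "ennreal (if Suc i < Suc m then 0 else sb_weights (case_nat x v) (Suc i) / (1 - (\<Sum>l<Suc m. sb_weights (case_nat x v) l)))
          * F (sb_weights (case_nat x v) \<circ> move_to (Suc m) (Suc i))
        = ennreal (if i < m then 0 else sb_weights v i / (1 - (\<Sum>l<m. sb_weights v l))) * Fx x (sb_weights v \<circ> move_to m i)" for i
        unfolding rest by (simp only: Suc_less_eq)
      \<comment> \<open>The term i = 0 vanishes because 0 < Suc m, so the sum may start at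
        1.\<close>
      then show ?thesis
        by (subst suminf_ennreal_Suc) simp_all
    qed
    show "(\<integral>\<^sup>+v. ?L (Suc m) F (sb_weights (case_nat x v)) \<partial>?G) = (\<integral>\<^sup>+v. Fx x (sb_weights v) \<partial>?G)"
      by (simp only: * Suc.IH[OF par(1,2) par' Fx gem_proper_tail[OF par proper]])
  qed
  also have "\<dots> = (\<integral>\<^sup>+v. F (sb_weights v) \<partial>gem_sticks \<sigma> \<theta>)"
    by (subst nn_integral_gem_sticks[OF par]) (simp_all add: sb_weights_case_nat Fx_def)
  finally show ?case .
qed

text \<open>The probability that the next r draws without replacement, after the indices ixs have been
  drawn, produce values in the prescribed sets.\<close>

fun draw_prob :: "(nat \<Rightarrow> real set) \<Rightarrow> nat \<Rightarrow> nat list \<Rightarrow> (nat \<Rightarrow> real) \<Rightarrow> ennreal" where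
  "draw_prob A 0 ixs w = (\<Prod>m<length ixs. indicator (A m) (w (ixs ! m)))"
| "draw_prob A (Suc r) ixs w = (\<Sum>i. ennreal (if i \<in> set ixs then 0 else w i / (1 - (\<Sum>l<length ixs. w (ixs ! l))))
      * draw_prob A r (ixs @ [i]) w)"

lemma draw_prob_measurable [measurable]:
  assumes [measurable]: "\<And>m. A m \<in> sets borel"
  shows "draw_prob A r ixs \<in> borel_measurable (PiM UNIV (\<lambda>_. borel))"
proof (induction r arbitrary: ixs)
  case 0
  show ?case by (rule measurable_cong[THEN iffD2, OF draw_prob.simps(1)]) measurable
next
  case (Suc r)
  note [measurable] = Suc
  show ?case by (rule measurable_cong[THEN iffD2, OF draw_prob.simps(2)]) measurable
qed

text \<open>Each draw sums over all indices, so relabelling them by a bijection only relabels the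
  indices already drawn.\<close>

lemma draw_prob_comp:
  assumes "bij \<pi>"
  shows "draw_prob A r ixs (w \<circ> \<pi>) = draw_prob A r (map \<pi> ixs) w"
proof (induction r arbitrary: ixs)
  case (Suc r)
  let ?f = "\<lambda>i. ennreal (if i \<in> set (map \<pi> ixs) then 0 else w i / (1 - (\<Sum>l<length ixs. w (map \<pi> ixs ! l))))
      * draw_prob A r (map \<pi> ixs @ [i]) w"
  have "\<pi> i \<in> set (map \<pi> ixs) \<longleftrightarrow> i \<in> set ixs" for i
    using bij_is_inj[OF assms] by (auto dest: injD)
  moreover have "(\<Sum>l<length ixs. w (map \<pi> ixs ! l)) = (\<Sum>l<length ixs. w (\<pi> (ixs ! l)))"
    by (rule sum.cong) auto
  ultimately have "draw_prob A (Suc r) ixs (w \<circ> \<pi>) = (\<Sum>i. ?f (\<pi> i))"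
    unfolding draw_prob.simps by (intro suminf_cong) (simp only: Suc.IH o_apply map_append list.map)
  also have "\<dots> = (\<Sum>i. ?f i)" by (rule suminf_ennreal_bij[OF assms])
  finally show ?case by (simp only: draw_prob.simps length_map)
qed simp

text \<open>If indices 0, ..., m - 1 have been drawn, a next draw i can be moved to position m
  without changing the law of the weights. Since \<open>move_to m i\<close> fixes everything below m
  and sends m to i, the draw may be taken to be the index m itself.\<close>

lemma gem_draw_prob_step:
  assumes par: "0 \<le> \<sigma>" "\<sigma> < 1" "- \<sigma> < \<theta>" and [measurable]: "\<And>m. A m \<in> sets borel"
    and proper: "AE v in gem_sticks \<sigma> \<theta>. (\<Sum>i. ennreal (sb_weights v i)) = 1"
  shows "(\<integral>\<^sup>+v. draw_prob A (Suc r) [0..<m] (sb_weights v) \<partial>gem_sticks \<sigma> \<theta>)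
    = (\<integral>\<^sup>+v. draw_prob A r [0..<Suc m] (sb_weights v) \<partial>gem_sticks \<sigma> \<theta>)"
proof -
  have *: "draw_prob A r [0..<Suc m] (w \<circ> move_to m i) = draw_prob A r ([0..<m] @ [i]) w" if "m \<le> i" for i w
  proof -
    have "map (move_to m i) [0..<Suc m] = [0..<m] @ [i]"
      using map_idI[of "[0..<m]" "move_to m i"] by (simp add: move_to_def)
    then show ?thesis by (simp add: draw_prob_comp[OF bij_move_to[OF that]])
  qed
  have "draw_prob A (Suc r) [0..<m] w = (\<Sum>i. ennreal (if i < m then 0 else w i / (1 - (\<Sum>l<m. w l)))
        * draw_prob A r [0..<Suc m] (w \<circ> move_to m i))" for w
    unfolding draw_prob.simps by (intro suminf_cong) (simp add: * del: upt_Suc)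
  then show ?thesis
    by (simp only: gem_move_to[OF par draw_prob_measurable proper] assms)
qed

lemma gem_draw_prob:
  assumes "0 \<le> \<sigma>" "\<sigma> < 1" "- \<sigma> < \<theta>" "\<And>m. A m \<in> sets borel"
    and "AE v in gem_sticks \<sigma> \<theta>. (\<Sum>i. ennreal (sb_weights v i)) = 1"
  shows "(\<integral>\<^sup>+v. draw_prob A r [0..<m] (sb_weights v) \<partial>gem_sticks \<sigma> \<theta>)
    = (\<integral>\<^sup>+v. (\<Prod>j<m + r. indicator (A j) (sb_weights v j)) \<partial>gem_sticks \<sigma> \<theta>)"
proof (induction r arbitrary: m)
  case (Suc r)
  show ?case
    unfolding gem_draw_prob_step[OF assms] Suc by simp
qed simp

section \<open>Size-biased permutations\<close>

text \<open>A finite index set lies in an initial segment, and the additional coordinates are left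
  unconstrained.\<close>

lemma measure_eqI_initial_boxes:
  fixes P Q :: "(nat \<Rightarrow> 'a::topological_space) measure"
  assumes [simp]: "sets P = sets (PiM UNIV (\<lambda>_. borel))" "sets Q = sets (PiM UNIV (\<lambda>_. borel))"
    and fin: "finite_measure P"
    and eq: "\<And>k A. (\<And>m. A m \<in> sets borel) \<Longrightarrow> emeasure P {w. \<forall>m<k. w m \<in> A m} = emeasure Q {w. \<forall>m<k. w m \<in> A m}"
  shows "P = Q"
proof (rule measure_eqI_PiM_infinite[OF _ _ _ fin])
  fix J :: "nat set" and A :: "nat \<Rightarrow> 'a set"
  assume J: "finite J" and A: "\<And>i. i \<in> J \<Longrightarrow> A i \<in> sets borel"
  define B where "B i = (if i \<in> J then A i else UNIV)" for i
  obtain k where "J \<subseteq> {..<k}" using J by (auto simp: finite_nat_iff_bounded)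
  then have "prod_emb UNIV (\<lambda>_. borel) J (Pi\<^sub>E J A) = {w. \<forall>m<k. w m \<in> B m}"
    by (fastforce simp: prod_emb_def B_def PiE_iff split: if_splits)
  then show "emeasure P (prod_emb UNIV (\<lambda>_. borel) J (Pi\<^sub>E J A)) = emeasure Q (prod_emb UNIV (\<lambda>_. borel) J (Pi\<^sub>E J A))"
    using eq[of B k] A by (simp add: B_def)
qed simp_all

definition draw_weight :: "nat list \<Rightarrow> (nat \<Rightarrow> real) \<Rightarrow> real" where
  "draw_weight ixs w = (if distinct ixs then (\<Prod>m<length ixs. w (ixs ! m) / (1 - (\<Sum>l<m. w (ixs ! l)))) else 0)"

lemma draw_weight_measurable [measurable]: "draw_weight ixs \<in> borel_measurable (PiM UNIV (\<lambda>_. borel))"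
  by (cases "distinct ixs") (auto simp: draw_weight_def[abs_def])

text \<open>One more draw contributes exactly the factor that occurs in the recursion of
  \<open>draw_prob\<close>; this links the closed formula of \<open>size_biased_perm\<close> with
  that recursion.\<close>

lemma draw_weight_snoc:
  "draw_weight (ixs @ [i]) w = draw_weight ixs w * (if i \<in> set ixs then 0 else w i / (1 - (\<Sum>l<length ixs. w (ixs ! l))))"
proof -
  have "(\<Prod>m<length ixs. w ((ixs @ [i]) ! m) / (1 - (\<Sum>l<m. w ((ixs @ [i]) ! l)))) =
    (\<Prod>m<length ixs. w (ixs ! m) / (1 - (\<Sum>l<m. w (ixs ! l))))"
    by (intro prod.cong refl arg_cong2[where f="(/)"] arg_cong2[where f="(-)"] sum.cong) (auto simp: nth_append)
  moreover have "(\<Sum>l<length ixs. w ((ixs @ [i]) ! l)) = (\<Sum>l<length ixs. w (ixs ! l))"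
    by (intro sum.cong) (auto simp: nth_append)
  ultimately show ?thesis by (auto simp: draw_weight_def)
qed

text \<open>Distinct indices carry disjoint parts of the total mass 1, so the next weight never
  exceeds what is left. Strict positivity of that weight keeps the denominator positive.\<close>

lemma draw_factor_bounds:
  fixes w :: "nat \<Rightarrow> real"
  assumes w: "\<And>i. 0 < w i" "w sums 1" and ixs: "distinct ixs" "m < length ixs"
  shows "0 \<le> w (ixs ! m) / (1 - (\<Sum>l<m. w (ixs ! l)))" "w (ixs ! m) / (1 - (\<Sum>l<m. w (ixs ! l))) \<le> 1"
proof -
  have "(\<Sum>l<Suc m. w (ixs ! l)) = sum w ((!) ixs ` {..<Suc m})"
    using ixs by (subst sum.reindex) (auto simp: inj_on_def nth_eq_iff_index_eq)
  also have "\<dots> \<le> 1"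
    using sum_le_suminf[OF sums_summable[OF w(2)], of "(!) ixs ` {..<Suc m}"] w(1) sums_unique[OF w(2)]
    by (auto intro: less_imp_le)
  finally have *: "w (ixs ! m) \<le> 1 - (\<Sum>l<m. w (ixs ! l))" by simp
  then show "0 \<le> w (ixs ! m) / (1 - (\<Sum>l<m. w (ixs ! l)))" "w (ixs ! m) / (1 - (\<Sum>l<m. w (ixs ! l))) \<le> 1"
    using w(1)[of "ixs ! m"] by (auto simp: divide_simps)
qed

lemma draw_weight_bounds:
  assumes w: "\<And>i. 0 < w i" "w sums 1"
  shows "0 \<le> draw_weight ixs w" "draw_weight ixs w \<le> 1"
  unfolding draw_weight_def using draw_factor_bounds[OF w]
  by (auto intro!: prod_nonneg prod_le_1)

text \<open>The event is split according to the next index drawn until only prescribed indices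
  remain. Then the values W (rk m) are values at fixed positions, the event concerns W alone, and
  the defining formula applies.\<close>

lemma size_biased_draws:
  assumes N: "prob_space N" and W [measurable]: "W \<in> measurable N (PiM UNIV (\<lambda>_. borel))"
    and nice: "AE \<omega> in N. (\<forall>i. 0 < W \<omega> i) \<and> W \<omega> sums 1"
    and sb: "size_biased_perm N W rk"
    and A [measurable]: "\<And>m. A m \<in> sets borel"
  shows "emeasure N {\<omega> \<in> space N. (\<forall>m<length ixs. rk m \<omega> = ixs ! m) \<and> (\<forall>m<length ixs + r. W \<omega> (rk m \<omega>) \<in> A m)} =
    (\<integral>\<^sup>+\<omega>. ennreal (draw_weight ixs (W \<omega>)) * draw_prob A r ixs (W \<omega>) \<partial>N)"
proof (induction r arbitrary: ixs)
  interpret N: prob_space N by fact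
  have rk [measurable]: "rk m \<in> measurable N (count_space UNIV)" for m
    using sb by (simp add: size_biased_perm_def)
  case 0
  let ?B = "{w. \<forall>m<length ixs. w (ixs ! m) \<in> A m}"
  have "?B = {w \<in> space (PiM UNIV (\<lambda>_. borel)). \<forall>m<length ixs. w (ixs ! m) \<in> A m}"
    by (simp add: space_PiM)
  also have "\<dots> \<in> sets (PiM UNIV (\<lambda>_. borel :: real measure))" by measurable
  finally have B [measurable]: "?B \<in> sets (PiM UNIV (\<lambda>_. borel :: real measure))" .
  \<comment> \<open>\<open>size_biased_perm\<close> speaks of Borel sets of the sequence space; they
    coincide with the sets of the product sigma-algebra.\<close>
  have B': "?B \<in> sets (borel :: (nat \<Rightarrow> real) measure)"
    using B by (simp add: sets_PiM_equal_borel)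
  have set: "{\<omega> \<in> space N. (\<forall>m<length ixs. rk m \<omega> = ixs ! m) \<and> (\<forall>m<length ixs + 0. W \<omega> (rk m \<omega>) \<in> A m)}
      = {\<omega> \<in> space N. W \<omega> \<in> ?B \<and> (\<forall>m<length ixs. rk m \<omega> = ixs ! m)}"
    by auto
  have bnd: "AE \<omega> in N. 0 \<le> draw_weight ixs (W \<omega>) \<and> draw_weight ixs (W \<omega>) \<le> 1"
    using nice by eventually_elim (auto intro: draw_weight_bounds)
  then have bnd': "AE \<omega> in N. 0 \<le> draw_weight ixs (W \<omega>)" by eventually_elim simp
  have int: "integrable N (\<lambda>\<omega>. indicator ?B (W \<omega>) * draw_weight ixs (W \<omega>))"
    using bnd by (intro N.integrable_const_bound[of _ 1], eventually_elim) (auto simp: indicator_def)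
  have "measure N {\<omega> \<in> space N. W \<omega> \<in> ?B \<and> (\<forall>m<length ixs. rk m \<omega> = ixs ! m)}
      = (\<integral>\<omega>. indicator ?B (W \<omega>) * draw_weight ixs (W \<omega>) \<partial>N)"
    using sb[unfolded size_biased_perm_def, THEN conjunct2, rule_format, OF B', of ixs] by (simp add: draw_weight_def)
  then have "emeasure N {\<omega> \<in> space N. W \<omega> \<in> ?B \<and> (\<forall>m<length ixs. rk m \<omega> = ixs ! m)}
      = ennreal (\<integral>\<omega>. indicator ?B (W \<omega>) * draw_weight ixs (W \<omega>) \<partial>N)"
    by (simp add: N.emeasure_eq_measure)
  also have "\<dots> = (\<integral>\<^sup>+\<omega>. ennreal (indicator ?B (W \<omega>) * draw_weight ixs (W \<omega>)) \<partial>N)"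
    using bnd' by (intro nn_integral_eq_integral[symmetric] int, eventually_elim) auto
  also have "\<dots> = (\<integral>\<^sup>+\<omega>. ennreal (draw_weight ixs (W \<omega>)) * draw_prob A 0 ixs (W \<omega>) \<partial>N)"
  proof (intro nn_integral_cong)
    fix \<omega>
    have p: "(\<Prod>m<length ixs. indicator (A m) (W \<omega> (ixs ! m)) :: ennreal) = indicator ?B (W \<omega>)"
      by (auto simp: indicator_def prod_eq_1_iff intro!: prod_zero)
    show "ennreal (indicator ?B (W \<omega>) * draw_weight ixs (W \<omega>)) = ennreal (draw_weight ixs (W \<omega>)) * draw_prob A 0 ixs (W \<omega>)"
      unfolding draw_prob.simps p by (simp split: split_indicator)
  qed
  finally show ?case unfolding set .
next
  interpret N: prob_space N by fact
  have rk [measurable]: "rk m \<in> measurable N (count_space UNIV)" for m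
    using sb by (simp add: size_biased_perm_def)
  case (Suc r)
  have WA [measurable]: "Measurable.pred N (\<lambda>\<omega>. W \<omega> (rk m \<omega>) \<in> A m)" for m
    by measurable
  let ?E = "\<lambda>i. {\<omega> \<in> space N. (\<forall>m<length (ixs @ [i]). rk m \<omega> = (ixs @ [i]) ! m) \<and> (\<forall>m<length (ixs @ [i]) + r. W \<omega> (rk m \<omega>) \<in> A m)}"
  have Ei: "?E i = {\<omega> \<in> space N. rk (length ixs) \<omega> = i \<and> (\<forall>m<length ixs. rk m \<omega> = ixs ! m) \<and> (\<forall>m<length ixs + Suc r. W \<omega> (rk m \<omega>) \<in> A m)}" for i
    by (auto simp: nth_append less_Suc_eq)
  have "{\<omega> \<in> space N. (\<forall>m<length ixs. rk m \<omega> = ixs ! m) \<and> (\<forall>m<length ixs + Suc r. W \<omega> (rk m \<omega>) \<in> A m)} = (\<Union>i. ?E i)"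
    unfolding Ei by auto
  then have "emeasure N {\<omega> \<in> space N. (\<forall>m<length ixs. rk m \<omega> = ixs ! m) \<and> (\<forall>m<length ixs + Suc r. W \<omega> (rk m \<omega>) \<in> A m)}
      = emeasure N (\<Union>i. ?E i)" by (rule arg_cong)
  also have "\<dots> = (\<Sum>i. emeasure N (?E i))"
  proof (rule suminf_emeasure[symmetric])
    show "range ?E \<subseteq> sets N" unfolding Ei by (auto, measurable)
    show "disjoint_family ?E" unfolding Ei by (auto simp: disjoint_family_on_def)
  qed
  also have "\<dots> = (\<Sum>i. \<integral>\<^sup>+\<omega>. ennreal (draw_weight (ixs @ [i]) (W \<omega>)) * draw_prob A r (ixs @ [i]) (W \<omega>) \<partial>N)"
    by (rule suminf_cong) (rule Suc.IH[of "ixs @ [_]"])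
  also have "\<dots> = (\<integral>\<^sup>+\<omega>. (\<Sum>i. ennreal (draw_weight (ixs @ [i]) (W \<omega>)) * draw_prob A r (ixs @ [i]) (W \<omega>)) \<partial>N)"
    by (intro nn_integral_suminf[symmetric] borel_measurable_times_ennreal measurable_compose[OF W]
        measurable_compose[OF _ measurable_ennreal] draw_weight_measurable draw_prob_measurable A)
  also have "\<dots> = (\<integral>\<^sup>+\<omega>. ennreal (draw_weight ixs (W \<omega>)) * draw_prob A (Suc r) ixs (W \<omega>) \<partial>N)"
  proof (rule nn_integral_cong_AE[OF AE_mp[OF nice]], intro AE_I2 impI)
    fix \<omega> assume "(\<forall>i. 0 < W \<omega> i) \<and> W \<omega> sums 1"
    then have "0 \<le> draw_weight ixs (W \<omega>)" by (intro draw_weight_bounds) auto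
    then show "(\<Sum>i. ennreal (draw_weight (ixs @ [i]) (W \<omega>)) * draw_prob A r (ixs @ [i]) (W \<omega>))
      = ennreal (draw_weight ixs (W \<omega>)) * draw_prob A (Suc r) ixs (W \<omega>)"
      unfolding draw_weight_snoc draw_prob.simps ennreal_suminf_cmult[symmetric]
      by (intro suminf_cong) (simp only: ennreal_mult' mult.assoc)
  qed
  finally show ?case .
qed

text \<open>Laws of sequences are compared on initial boxes. With no index drawn at the start, the
  probability of a box for the size-biased sequence is an integral of \<open>draw_prob\<close>, and
  \<open>gem_draw_prob\<close> exchanges the k draws for the first k weights.\<close>

theorem gem_size_biased_invariant:
  assumes par: "0 \<le> \<sigma>" "\<sigma> < 1" "- \<sigma> < \<theta>"
    and proper': "AE v in gem_sticks \<sigma> \<theta>. (\<Sum>i. ennreal (sb_weights v i)) = 1"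
    and N: "prob_space N" and W [measurable]: "W \<in> measurable N (PiM UNIV (\<lambda>_. borel))"
    and law: "distr N (PiM UNIV (\<lambda>_. borel)) W = distr (gem_sticks \<sigma> \<theta>) (PiM UNIV (\<lambda>_. borel)) sb_weights"
    and sb: "size_biased_perm N W rk"
  shows "distr N (PiM UNIV (\<lambda>_. borel)) (\<lambda>\<omega> j. W \<omega> (rk j \<omega>)) = distr (gem_sticks \<sigma> \<theta>) (PiM UNIV (\<lambda>_. borel)) sb_weights"
proof -
  let ?G = "gem_sticks \<sigma> \<theta>" and ?S = "PiM UNIV (\<lambda>_. borel) :: (nat \<Rightarrow> real) measure"
  interpret N: prob_space N by fact
  have rk [measurable]: "rk m \<in> measurable N (count_space UNIV)" for m
    using sb by (simp add: size_biased_perm_def)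
  have nonneg: "AE v in ?G. \<forall>i. 0 < sb_weights v i"
    using AE_gem_sticks[OF par] by eventually_elim (auto simp: sb_weights_def intro!: mult_pos_pos prod_pos)
  have "AE w in distr ?G ?S sb_weights. (\<forall>i. 0 < w i) \<and> (\<Sum>i. ennreal (w i)) = 1"
    using nonneg proper' by (subst AE_distr_iff) auto
  then have "AE \<omega> in N. (\<forall>i. 0 < W \<omega> i) \<and> (\<Sum>i. ennreal (W \<omega> i)) = 1"
    unfolding law[symmetric] by (subst (asm) AE_distr_iff) auto
  then have nice: "AE \<omega> in N. (\<forall>i. 0 < W \<omega> i) \<and> W \<omega> sums 1"
    by eventually_elim (auto intro!: suminf_ennreal_real_sums less_imp_le)
  have WR [measurable]: "(\<lambda>\<omega> j. W \<omega> (rk j \<omega>)) \<in> measurable N ?S"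
    by (rule measurable_PiM_single') (auto simp: space_PiM)
  show ?thesis
  proof (rule measure_eqI_initial_boxes)
    show "finite_measure (distr N ?S (\<lambda>\<omega> j. W \<omega> (rk j \<omega>)))"
      by (intro finite_measureI) (simp add: emeasure_distr)
    fix k and A :: "nat \<Rightarrow> real set" assume A [measurable]: "\<And>m. A m \<in> sets borel"
    let ?B = "{w. \<forall>m<k. w m \<in> A m}"
    have "?B = {w \<in> space ?S. \<forall>m<k. w m \<in> A m}" by (simp add: space_PiM)
    also have "\<dots> \<in> sets ?S" by measurable
    finally have B [measurable]: "?B \<in> sets ?S" .
    have "emeasure (distr N ?S (\<lambda>\<omega> j. W \<omega> (rk j \<omega>))) ?B = emeasure N {\<omega> \<in> space N. \<forall>m<k. W \<omega> (rk m \<omega>) \<in> A m}"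
      by (subst emeasure_distr[OF WR B]) (auto intro!: arg_cong2[where f=emeasure])
    also have "\<dots> = (\<integral>\<^sup>+\<omega>. draw_prob A k [] (W \<omega>) \<partial>N)"
      using size_biased_draws[OF N W nice sb A, of "[]" k] by (simp add: draw_weight_def)
    also have "\<dots> = (\<integral>\<^sup>+w. draw_prob A k [] w \<partial>distr N ?S W)"
      by (rule nn_integral_distr[symmetric]) measurable
    also have "\<dots> = (\<integral>\<^sup>+v. draw_prob A k [0..<0] (sb_weights v) \<partial>?G)"
      unfolding law by (subst nn_integral_distr) auto
    also have "\<dots> = (\<integral>\<^sup>+v. (\<Prod>j<k. indicator (A j) (sb_weights v j)) \<partial>?G)"
      using gem_draw_prob[OF par A proper', where r=k and m=0] by simp
    also have "\<dots> = (\<integral>\<^sup>+v. indicator ?B (sb_weights v) \<partial>?G)"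
      by (intro nn_integral_cong) (auto simp: indicator_def prod_eq_1_iff intro!: prod_zero)
    also have "\<dots> = (\<integral>\<^sup>+w. indicator ?B w \<partial>distr ?G ?S sb_weights)"
      by (rule nn_integral_distr[symmetric]) measurable
    also have "\<dots> = emeasure (distr ?G ?S sb_weights) ?B"
      by (rule nn_integral_indicator) simp
    finally show "emeasure (distr N ?S (\<lambda>\<omega> j. W \<omega> (rk j \<omega>))) ?B = emeasure (distr ?G ?S sb_weights) ?B" .
  qed simp_all
qed

section \<open>The maps Upsilon\<close>

lemma admissible_lenD:
  assumes "admissible_len p"
  shows "real_distribution p" "measure p {0..1} = 1" "continuous_on A (cdf p)" "strict_mono_on {0..1} (cdf p)"
proof -
  show "real_distribution p"
    using assms by (simp add: admissible_len_def real_distribution_def real_distribution_axioms_def)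
  show "continuous_on A (cdf p)"
    using assms continuous_on_subset by (auto simp: admissible_len_def)
qed (use assms in \<open>auto simp: admissible_len_def\<close>)

lemma admissible_len_AE:
  assumes "admissible_len p"
  shows "AE x in p. x \<in> {0..1}"
proof -
  interpret real_distribution p using assms by (rule admissible_lenD)
  show ?thesis using admissible_lenD(2)[OF assms] by (intro AE_prob_1) auto
qed

text \<open>There is no mass below 0, and continuity of the distribution function excludes an atom
  at 0.\<close>

lemma cdf_admissible_le_0:
  assumes "admissible_len p" "x \<le> 0"
  shows "cdf p x = 0"
proof -
  interpret real_distribution p using assms(1) by (rule admissible_lenD)
  have neg: "cdf p y = 0" if "y < 0" for y
  proof -
    have "AE z in p. z \<notin> {..y}"
      using admissible_len_AE[OF assms(1)] by eventually_elim (use that in auto)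
    then have "emeasure p {..y} = 0" by (subst (asm) AE_iff_measurable[OF _ refl]) (auto simp: atMost_def)
    then show ?thesis by (simp add: cdf_def measure_def atMost_def)
  qed
  have "isCont (cdf p) 0"
    using admissible_lenD(3)[OF assms(1), of UNIV] by (simp add: continuous_on_eq_continuous_at)
  then have "(cdf p \<longlongrightarrow> cdf p 0) (at_left 0)"
    by (simp add: isCont_def filterlim_at_split)
  moreover have "(cdf p \<longlongrightarrow> 0) (at_left 0)"
    by (rule tendsto_eventually) (auto simp: eventually_at_filter neg)
  ultimately have "cdf p 0 = 0" by (rule tendsto_unique[rotated]) simp
  with neg assms(2) show ?thesis by (cases "x = 0") auto
qed

lemma cdf_admissible_ge_1:
  assumes "admissible_len p" "1 \<le> x"
  shows "cdf p x = 1"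
proof -
  interpret real_distribution p using assms(1) by (rule admissible_lenD)
  have "measure p {0..1} \<le> cdf p x"
    unfolding cdf_def using assms(2) by (intro finite_measure_mono) auto
  with admissible_lenD(2)[OF assms(1)] cdf_bounded_prob[of x] show ?thesis by simp
qed

lemma bij_betw_cdf_admissible:
  assumes "admissible_len p"
  shows "bij_betw (cdf p) {0..1} {0..1}"
proof -
  interpret real_distribution p using assms by (rule admissible_lenD)
  have "inj_on (cdf p) {0..1}"
    using admissible_lenD(4)[OF assms] by (rule strict_mono_on_imp_inj_on)
  moreover have "\<exists>x\<in>{0..1}. cdf p x = u" if "u \<in> {0..1}" for u
    using IVT'[of "cdf p" 0 u 1] that cdf_admissible_le_0[OF assms, of 0] cdf_admissible_ge_1[OF assms, of 1]
      admissible_lenD(3)[OF assms] by auto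
  ultimately show ?thesis
    using cdf_nonneg cdf_bounded_prob by (auto simp: bij_betw_def image_iff) (metis)
qed

text \<open>The inverse is restricted to [0,1], since the distribution function is constant on
  either side of this interval.\<close>

definition quantile :: "real measure \<Rightarrow> real \<Rightarrow> real" where
  "quantile p = the_inv_into {0..1} (cdf p)"

lemma
  assumes "admissible_len p"
  shows quantile_mem: "u \<in> {0..1} \<Longrightarrow> quantile p u \<in> {0..1}"
    and cdf_quantile: "u \<in> {0..1} \<Longrightarrow> cdf p (quantile p u) = u"
    and quantile_cdf: "x \<in> {0..1} \<Longrightarrow> quantile p (cdf p x) = x"
    and continuous_on_quantile: "continuous_on {0..1} (quantile p)"
proof -
  note bij = bij_betw_cdf_admissible[OF assms]
  show "u \<in> {0..1} \<Longrightarrow> quantile p u \<in> {0..1}"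
    using bij_betw_the_inv_into[OF bij] unfolding quantile_def by (auto simp: bij_betw_def)
  show "u \<in> {0..1} \<Longrightarrow> cdf p (quantile p u) = u"
    unfolding quantile_def using bij by (rule f_the_inv_into_f_bij_betw)
  show 3: "x \<in> {0..1} \<Longrightarrow> quantile p (cdf p x) = x" for x
    unfolding quantile_def using bij by (intro the_inv_into_f_f) (auto simp: bij_betw_def)
  have "continuous_on (cdf p ` {0..1}) (quantile p)"
    using admissible_lenD(3)[OF assms] 3 by (intro continuous_on_inv) auto
  then show "continuous_on {0..1} (quantile p)"
    using bij by (simp add: bij_betw_def)
qed

lemma cdf_admissible_mem: "cdf p x \<in> {0..1}" if "admissible_len p"
proof -
  interpret real_distribution p using that by (rule admissible_lenD)
  show ?thesis using cdf_nonneg[of x] cdf_bounded_prob[of x] by simp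
qed

lemma Upsilon_eq_quantile: "Upsilon ps j x = quantile (ps (Suc j)) (cdf (ps j) x)"
  by (simp add: Upsilon_def quantile_def)

lemma Upsilon_mem:
  assumes "\<And>j. admissible_len (ps j)"
  shows "Upsilon ps j x \<in> {0..1}"
  unfolding Upsilon_eq_quantile by (intro quantile_mem cdf_admissible_mem assms)

lemma cdf_Upsilon:
  assumes "\<And>j. admissible_len (ps j)"
  shows "cdf (ps (Suc j)) (Upsilon ps j x) = cdf (ps j) x"
  unfolding Upsilon_eq_quantile by (intro cdf_quantile cdf_admissible_mem assms)

lemma continuous_on_Upsilon:
  assumes "\<And>j. admissible_len (ps j)"
  shows "continuous_on A (Upsilon ps j)"
  unfolding Upsilon_eq_quantile
  by (rule continuous_on_compose2[OF continuous_on_quantile[OF assms] admissible_lenD(3)[OF assms]])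
    (use cdf_admissible_mem[OF assms] in blast)

text \<open>On a grid of mesh below d the limit oscillates by less than e/2 in each cell, and
  convergence holds at the finitely many grid points simultaneously. In between, monotonicity traps
  \<open>f n x\<close> between its two neighbouring grid values.\<close>

lemma mono_pointwise_imp_uniform_limit:
  fixes f :: "nat \<Rightarrow> real \<Rightarrow> real"
  assumes mono: "\<And>n. mono_on {0..1} (f n)" and cont: "continuous_on {0..1} g"
    and lim: "\<And>x. x \<in> {0..1} \<Longrightarrow> (\<lambda>n. f n x) \<longlonglongrightarrow> g x"
  shows "uniform_limit {0..1} f g sequentially"
proof (rule uniform_limitI)
  fix e :: real assume e: "0 < e"
  have "uniformly_continuous_on {0..1} g"
    using cont by (rule compact_uniformly_continuous) simp
  then obtain d where d: "0 < d" "\<And>x y. x \<in> {0..1} \<Longrightarrow> y \<in> {0..1} \<Longrightarrow> \<bar>x - y\<bar> < d \<Longrightarrow> \<bar>g x - g y\<bar> < e / 2"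
    unfolding uniformly_continuous_on_def dist_real_def using e by (metis half_gt_zero)
  obtain K where K: "1 / real (Suc K) < d" using d(1) nat_approx_posE by blast
  let ?x = "\<lambda>i. real i / real (Suc K)"
  have grid: "?x i \<in> {0..1}" if "i \<le> Suc K" for i using that by (auto simp: divide_simps)
  have "\<forall>\<^sub>F n in sequentially. \<forall>i\<in>{..Suc K}. dist (f n (?x i)) (g (?x i)) < e / 2"
    using e by (intro eventually_ball_finite ballI tendstoD[OF lim] grid) auto
  then show "\<forall>\<^sub>F n in sequentially. \<forall>x\<in>{0..1}. dist (f n x) (g x) < e"
  proof eventually_elim
    case (elim n)
    show ?case
    proof
      fix x :: real assume x: "x \<in> {0..1}"
      \<comment> \<open>The point 1 is treated separately because rounding down would produce the
        index Suc K, which has no cell to its right.\<close>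
      obtain i where i: "i < Suc K" "?x i \<le> x" "x \<le> ?x (Suc i)"
      proof (cases "x = 1")
        case True
        then show ?thesis using that[of K] by (simp add: divide_simps)
      next
        case False
        let ?i = "nat \<lfloor>x * real (Suc K)\<rfloor>"
        have "x * real (Suc K) < real (Suc K)" using False x by (auto simp del: of_nat_Suc)
        then have "?i < Suc K" using x by (simp add: nat_less_iff floor_less_iff del: of_nat_Suc)
        moreover have "real ?i \<le> x * real (Suc K)" using x by (simp del: of_nat_Suc)
        moreover have "x * real (Suc K) \<le> real (Suc ?i)" using x by linarith
        ultimately show ?thesis using that[of ?i] by (simp add: pos_divide_le_eq pos_le_divide_eq del: of_nat_Suc)
      qed
      have g1: "?x i \<in> {0..1}" and g2: "?x (Suc i) \<in> {0..1}" using i(1) grid by auto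
      have "?x (Suc i) - ?x i < d" using K by (simp add: diff_divide_distrib[symmetric] del: of_nat_Suc) simp
      with i(2,3) have "\<bar>?x i - x\<bar> < d" "\<bar>?x (Suc i) - x\<bar> < d" by linarith+
      then have "\<bar>g (?x i) - g x\<bar> < e / 2" "\<bar>g (?x (Suc i)) - g x\<bar> < e / 2"
        using d(2)[OF g1 x] d(2)[OF g2 x] by auto
      moreover have "dist (f n (?x i)) (g (?x i)) < e / 2" "dist (f n (?x (Suc i))) (g (?x (Suc i))) < e / 2"
        using elim[rule_format, of i] elim[rule_format, of "Suc i"] i(1) by (auto simp del: of_nat_Suc)
      moreover have "f n (?x i) \<le> f n x" "f n x \<le> f n (?x (Suc i))"
        using mono_onD[OF mono g1 x i(2)] mono_onD[OF mono x g2 i(3)] by auto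
      ultimately show "dist (f n x) (g x) < e"
        unfolding dist_real_def by linarith
    qed
  qed
qed

text \<open>The limit is continuous, so weak convergence gives convergence at every point and
  monotonicity makes it uniform on [0,1]. Outside this interval all the distribution functions
  agree, being 0 or 1.\<close>

lemma uniform_limit_cdf:
  assumes "\<And>n. admissible_len (pn n)" "admissible_len p" "weak_conv_meas pn p"
  shows "uniform_limit UNIV (\<lambda>n. cdf (pn n)) (cdf p) sequentially"
proof -
  have "weak_conv_m pn p"
  proof (rule integral_bdd_continuous_conv_imp_weak_conv)
    fix f :: "real \<Rightarrow> real" assume "\<And>x. isCont f x" "\<And>x. \<bar>f x\<bar> \<le> 1"
    then show "(\<lambda>n. integral\<^sup>L (pn n) f) \<longlonglongrightarrow> integral\<^sup>L p f"
      using assms(3) unfolding weak_conv_meas_def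
      by (auto simp: continuous_on_eq_continuous_at bounded_iff)
  qed (intro admissible_lenD assms)+
  then have lim: "(\<lambda>n. cdf (pn n) x) \<longlonglongrightarrow> cdf p x" for x
    using admissible_lenD(3)[OF assms(2), of UNIV]
    by (simp add: weak_conv_m_def weak_conv_def continuous_on_eq_continuous_at)
  have "mono_on {0..1} (cdf (pn n))" for n
    using finite_borel_measure.cdf_nondecreasing[OF real_distribution.finite_borel_measure_M[OF admissible_lenD(1)[OF assms(1)]]]
    by (auto simp: mono_on_def)
  from mono_pointwise_imp_uniform_limit[OF this admissible_lenD(3)[OF assms(2)] lim]
  have u: "uniform_limit {0..1} (\<lambda>n. cdf (pn n)) (cdf p) sequentially" .
  show ?thesis
  proof (rule uniform_limitI)
    fix e :: real assume e: "0 < e"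
    from uniform_limitD[OF u e]
    show "\<forall>\<^sub>F n in sequentially. \<forall>x\<in>UNIV. dist (cdf (pn n) x) (cdf p x) < e"
    proof eventually_elim
      case (elim n)
      show ?case
      proof
        fix x :: real
        consider "x \<le> 0" | "x \<in> {0..1}" | "1 \<le> x" by force
        then show "dist (cdf (pn n) x) (cdf p x) < e"
          using elim e by cases (auto simp: cdf_admissible_le_0 cdf_admissible_ge_1 assms)
      qed
    qed
  qed
qed

text \<open>Quantile functions of different measures are never compared. With y the value of the
  n-th map at x, the n-th distribution functions satisfy F_(j+1) y = F_j x. Two uniform
  approximations carry this over to the limiting distribution functions up to d, and the modulus of
  continuity of the single limiting quantile function turns d into e.\<close>

lemma uniform_limit_Upsilon:
  assumes psn: "\<And>n j. admissible_len (psn n j)" and ps: "\<And>j. admissible_len (ps j)"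
    and conv: "\<And>j. weak_conv_meas (\<lambda>n. psn n j) (ps j)"
  shows "uniform_limit UNIV (\<lambda>n. Upsilon (psn n) j) (Upsilon ps j) sequentially"
proof (rule uniform_limitI)
  fix e :: real assume e: "0 < e"
  have "uniformly_continuous_on {0..1} (quantile (ps (Suc j)))"
    by (intro compact_uniformly_continuous continuous_on_quantile ps) simp
  then obtain d where d: "0 < d" "\<And>u v. u \<in> {0..1} \<Longrightarrow> v \<in> {0..1} \<Longrightarrow> \<bar>u - v\<bar> < d \<Longrightarrow>
      dist (quantile (ps (Suc j)) u) (quantile (ps (Suc j)) v) < e"
    using e unfolding uniformly_continuous_on_def dist_real_def by metis
  have lim: "\<forall>\<^sub>F n in sequentially. \<forall>x\<in>UNIV. dist (cdf (psn n i) x) (cdf (ps i) x) < d / 2" for i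
    using d(1) by (intro uniform_limitD[OF uniform_limit_cdf[OF psn ps conv]]) simp
  from lim[of j] lim[of "Suc j"]
  show "\<forall>\<^sub>F n in sequentially. \<forall>x\<in>UNIV. dist (Upsilon (psn n) j x) (Upsilon ps j x) < e"
  proof eventually_elim
    case (elim n)
    show ?case
    proof
      fix x
      let ?y = "Upsilon (psn n) j x"
      have "\<bar>cdf (psn n j) x - cdf (ps j) x\<bar> < d / 2" "\<bar>cdf (psn n (Suc j)) ?y - cdf (ps (Suc j)) ?y\<bar> < d / 2"
        using elim by (auto simp: dist_real_def)
      then have "\<bar>cdf (ps (Suc j)) ?y - cdf (ps (Suc j)) (Upsilon ps j x)\<bar> < d"
        using cdf_Upsilon[of ps j x, OF ps] cdf_Upsilon[of "psn n" j x, OF psn] by linarith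
      then have "dist (quantile (ps (Suc j)) (cdf (ps (Suc j)) ?y)) (quantile (ps (Suc j)) (cdf (ps (Suc j)) (Upsilon ps j x))) < e"
        by (intro d(2) cdf_admissible_mem ps)
      then show "dist ?y (Upsilon ps j x) < e"
        by (simp only: quantile_cdf[OF ps Upsilon_mem[of "psn n", OF psn]] quantile_cdf[OF ps Upsilon_mem[of ps, OF ps]])
    qed
  qed
qed

section \<open>The Markov chain of lengths\<close>

text \<open>The relation between the three measures passes from sets to functions by induction over
  measurable functions. The factors a and c are extended nonnegative numbers because c will contain
  an integral that may be infinite.\<close>

lemma nn_integral_measure_combination:
  assumes [simp]: "sets \<mu> = sets M" "sets \<nu> = sets M" "sets \<kappa> = sets M"
    and eq: "\<And>B. B \<in> sets M \<Longrightarrow> emeasure \<mu> B = a * emeasure \<nu> B + c * emeasure \<kappa> B"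
    and g: "g \<in> borel_measurable M"
  shows "(\<integral>\<^sup>+x. g x \<partial>\<mu>) = a * (\<integral>\<^sup>+x. g x \<partial>\<nu>) + c * (\<integral>\<^sup>+x. g x \<partial>\<kappa>)"
proof -
  have sp: "space \<mu> = space M" "space \<nu> = space M" "space \<kappa> = space M"
    by (intro sets_eq_imp_space_eq; simp)+
  have [measurable_cong]: "sets \<mu> = sets M" "sets \<nu> = sets M" "sets \<kappa> = sets M" by simp_all
  show ?thesis using g
  proof induction
    case (cong f g)
    have "integral\<^sup>N \<mu> f = integral\<^sup>N \<mu> g" "integral\<^sup>N \<nu> f = integral\<^sup>N \<nu> g" "integral\<^sup>N \<kappa> f = integral\<^sup>N \<kappa> g"
      using cong(3) by (auto intro!: nn_integral_cong simp: sp)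
    with cong show ?case by simp
  next
    case (set B)
    then show ?case by (simp add: eq)
  next
    case (mult u d)
    then show ?case by (simp add: nn_integral_cmult distrib_left ac_simps)
  next
    case (add u v)
    then show ?case by (simp add: nn_integral_add distrib_left ac_simps)
  next
    case (seq U)
    have [measurable]: "U i \<in> borel_measurable M" for i using seq by auto
    have SUP: "integral\<^sup>N \<eta> (SUP i. U i) = (SUP i. \<integral>\<^sup>+x. U i x \<partial>\<eta>)" if "sets \<eta> = sets M" for \<eta>
    proof -
      note [measurable_cong] = that
      have "(SUP i. U i) = (\<lambda>x. SUP i. U i x)" by (rule ext) (simp add: image_comp)
      then show ?thesis using seq(3) by (simp only:) (intro nn_integral_monotone_convergence_SUP; simp)
    qed
    have inc: "incseq (\<lambda>i. d * (\<integral>\<^sup>+x. U i x \<partial>\<eta>))" for \<eta> d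
      using seq(3) by (auto simp: incseq_def le_fun_def intro!: mult_left_mono nn_integral_mono)
    show ?case
      unfolding SUP[OF assms(1)] SUP[OF assms(2)] SUP[OF assms(3)] SUP_mult_left_ennreal
      by (simp only: seq.IH ennreal_SUP_add[OF inc inc])
  qed
qed

text \<open>Isolates the law of the lengths from atoms and properness, so that the limit and each
  approximating process are instances.\<close>

locale lazy_chain = prob_space M for M :: "'a measure" +
  fixes \<rho> :: real and ps :: "nat \<Rightarrow> real measure" and v :: "nat \<Rightarrow> 'a \<Rightarrow> real"
  assumes rho: "\<rho> \<in> {0..1}"
    and adm: "\<And>j. admissible_len (ps j)"
    and v_measurable [measurable]: "\<And>j. v j \<in> borel_measurable M"
    and law_0: "distr M borel (v 0) = ps 0"
    and transition: "\<And>j A B. A \<in> sets (Pi\<^sub>M {..j} (\<lambda>_. borel)) \<Longrightarrow> B \<in> sets borel \<Longrightarrow>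
        measure M {\<omega> \<in> space M. (\<lambda>i\<in>{..j}. v i \<omega>) \<in> A \<and> v (Suc j) \<omega> \<in> B} =
        (\<integral>\<omega>. indicator A (\<lambda>i\<in>{..j}. v i \<omega>) *
              (\<rho> * indicator B (Upsilon ps j (v j \<omega>)) + (1 - \<rho>) * measure (ps (Suc j)) B) \<partial>M)"
begin

lemma Upsilon_measurable [measurable]: "Upsilon ps j \<in> borel_measurable borel"
  by (intro borel_measurable_continuous_onI continuous_on_Upsilon adm)

lemma prefix_measurable [measurable]:
  "(\<lambda>\<omega>. \<lambda>i\<in>{..j}. v i \<omega>) \<in> measurable M (Pi\<^sub>M {..j} (\<lambda>_. borel))"
  by measurable

lemma real_distribution_ps: "real_distribution (ps j)"
  by (rule admissible_lenD(1)[OF adm])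

lemma sets_ps [simp, measurable_cong]: "sets (ps j) = sets borel"
  using real_distribution_ps[of j] by (simp add: real_distribution_def real_distribution_axioms_def)

lemma prob_space_ps: "prob_space (ps j)"
  using real_distribution_ps[of j] by (simp add: real_distribution_def)

lemma transition_indicator:
  assumes [measurable]: "A \<in> sets (Pi\<^sub>M {..j} (\<lambda>_. borel))" "B \<in> sets borel"
  shows "emeasure M {\<omega> \<in> space M. (\<lambda>i\<in>{..j}. v i \<omega>) \<in> A \<and> v (Suc j) \<omega> \<in> B} =
    (\<integral>\<^sup>+\<omega>. (ennreal \<rho> * indicator B (Upsilon ps j (v j \<omega>)) + ennreal (1 - \<rho>) * emeasure (ps (Suc j)) B)
      * indicator A (\<lambda>i\<in>{..j}. v i \<omega>) \<partial>M)"
proof -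
  interpret p: prob_space "ps (Suc j)" by (rule prob_space_ps)
  let ?V = "\<lambda>\<omega>. \<lambda>i\<in>{..j}. v i \<omega>"
  let ?k = "\<lambda>\<omega>. \<rho> * indicator B (Upsilon ps j (v j \<omega>)) + (1 - \<rho>) * measure (ps (Suc j)) B"
  have k: "0 \<le> ?k \<omega>" "?k \<omega> \<le> 1" for \<omega>
  proof -
    show "0 \<le> ?k \<omega>" using rho by (intro add_nonneg_nonneg mult_nonneg_nonneg) auto
    have "?k \<omega> \<le> \<rho> * 1 + (1 - \<rho>) * 1"
      using rho by (intro add_mono mult_left_mono) (auto simp: indicator_def)
    then show "?k \<omega> \<le> 1" by simp
  qed
  have "emeasure M {\<omega> \<in> space M. ?V \<omega> \<in> A \<and> v (Suc j) \<omega> \<in> B} = ennreal (\<integral>\<omega>. indicator A (?V \<omega>) * ?k \<omega> \<partial>M)"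
    unfolding emeasure_eq_measure by (subst transition) auto
  also have "\<dots> = (\<integral>\<^sup>+\<omega>. ennreal (indicator A (?V \<omega>) * ?k \<omega>) \<partial>M)"
    using k by (intro nn_integral_eq_integral[symmetric] integrable_const_bound[of _ 1]) (auto simp: indicator_def)
  also have "\<dots> = (\<integral>\<^sup>+\<omega>. (ennreal \<rho> * indicator B (Upsilon ps j (v j \<omega>)) + ennreal (1 - \<rho>) * emeasure (ps (Suc j)) B)
      * indicator A (?V \<omega>) \<partial>M)"
  proof (intro nn_integral_cong)
    fix \<omega>
    have "ennreal (?k \<omega>) = ennreal \<rho> * indicator B (Upsilon ps j (v j \<omega>)) + ennreal (1 - \<rho>) * emeasure (ps (Suc j)) B"
      using rho by (subst ennreal_plus) (auto simp: ennreal_mult p.emeasure_eq_measure split: split_indicator)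
    then show "ennreal (indicator A (?V \<omega>) * ?k \<omega>) =
      (ennreal \<rho> * indicator B (Upsilon ps j (v j \<omega>)) + ennreal (1 - \<rho>) * emeasure (ps (Suc j)) B) * indicator A (?V \<omega>)"
      by (simp split: split_indicator)
  qed
  finally show ?thesis .
qed

text \<open>The kernel is extended from events to functions in two rounds: first the past, for a
  fixed target set B, then the target, for a fixed function of the past. Each round reads the known
  identity as a relation between image measures of densities with respect to M.\<close>

lemma nn_integral_transition:
  assumes \<Phi> [measurable]: "\<Phi> \<in> borel_measurable (Pi\<^sub>M {..j} (\<lambda>_. borel))" and g [measurable]: "g \<in> borel_measurable borel"
  shows "(\<integral>\<^sup>+\<omega>. \<Phi> (\<lambda>i\<in>{..j}. v i \<omega>) * g (v (Suc j) \<omega>) \<partial>M) =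
    ennreal \<rho> * (\<integral>\<^sup>+\<omega>. \<Phi> (\<lambda>i\<in>{..j}. v i \<omega>) * g (Upsilon ps j (v j \<omega>)) \<partial>M)
    + ennreal (1 - \<rho>) * (\<integral>\<^sup>+\<omega>. \<Phi> (\<lambda>i\<in>{..j}. v i \<omega>) \<partial>M) * (\<integral>\<^sup>+x. g x \<partial>ps (Suc j))"
proof -
  let ?V = "\<lambda>\<omega>. \<lambda>i\<in>{..j}. v i \<omega>" and ?S = "Pi\<^sub>M {..j} (\<lambda>_. borel) :: (nat \<Rightarrow> real) measure"
  define k where "k B \<omega> = ennreal \<rho> * indicator B (Upsilon ps j (v j \<omega>)) + ennreal (1 - \<rho>) * emeasure (ps (Suc j)) B" for B \<omega>
  have k_measurable [measurable]: "k B \<in> borel_measurable M" if [measurable]: "B \<in> sets borel" for B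
    unfolding k_def by measurable
  have 1: "(\<integral>\<^sup>+\<omega>. \<Phi> (?V \<omega>) * indicator B (v (Suc j) \<omega>) \<partial>M) = (\<integral>\<^sup>+\<omega>. \<Phi> (?V \<omega>) * k B \<omega> \<partial>M)"
    if B [measurable]: "B \<in> sets borel" for B
  proof -
    have eq: "distr (density M (\<lambda>\<omega>. indicator B (v (Suc j) \<omega>))) ?S ?V = distr (density M (k B)) ?S ?V"
    proof (rule measure_eqI)
      fix A assume "A \<in> sets (distr (density M (\<lambda>\<omega>. indicator B (v (Suc j) \<omega>))) ?S ?V)"
      then have A [measurable]: "A \<in> sets ?S" by simp
      have "emeasure (distr (density M (\<lambda>\<omega>. indicator B (v (Suc j) \<omega>))) ?S ?V) A
        = (\<integral>\<^sup>+\<omega>. indicator B (v (Suc j) \<omega>) * indicator (?V -` A \<inter> space M) \<omega> \<partial>M)"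
        by (simp add: emeasure_distr emeasure_density)
      also have "\<dots> = (\<integral>\<^sup>+\<omega>. indicator {\<omega> \<in> space M. ?V \<omega> \<in> A \<and> v (Suc j) \<omega> \<in> B} \<omega> \<partial>M)"
        by (intro nn_integral_cong) (auto simp: indicator_def)
      also have "\<dots> = emeasure M {\<omega> \<in> space M. ?V \<omega> \<in> A \<and> v (Suc j) \<omega> \<in> B}"
        by (rule nn_integral_indicator) measurable
      also have "\<dots> = (\<integral>\<^sup>+\<omega>. k B \<omega> * indicator A (?V \<omega>) \<partial>M)"
        unfolding k_def by (rule transition_indicator) fact+
      also have "\<dots> = (\<integral>\<^sup>+\<omega>. k B \<omega> * indicator (?V -` A \<inter> space M) \<omega> \<partial>M)"
        by (intro nn_integral_cong) (auto simp: indicator_def)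
      also have "\<dots> = emeasure (distr (density M (k B)) ?S ?V) A"
        by (simp add: emeasure_distr emeasure_density)
      finally show "emeasure (distr (density M (\<lambda>\<omega>. indicator B (v (Suc j) \<omega>))) ?S ?V) A = emeasure (distr (density M (k B)) ?S ?V) A" .
    qed simp
    have "(\<integral>\<^sup>+\<omega>. \<Phi> (?V \<omega>) * indicator B (v (Suc j) \<omega>) \<partial>M) = (\<integral>\<^sup>+x. \<Phi> x \<partial>distr (density M (\<lambda>\<omega>. indicator B (v (Suc j) \<omega>))) ?S ?V)"
      by (simp add: nn_integral_distr nn_integral_density mult.commute)
    also have "\<dots> = (\<integral>\<^sup>+\<omega>. \<Phi> (?V \<omega>) * k B \<omega> \<partial>M)"
      unfolding eq by (simp add: nn_integral_distr nn_integral_density mult.commute)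
    finally show ?thesis .
  qed
  \<comment> \<open>Second round: the function of the past is now frozen into the density, and only
    the law of the next length under \<open>?D\<close> is studied.\<close>
  let ?D = "density M (\<lambda>\<omega>. \<Phi> (?V \<omega>))"
  define c where "c = ennreal (1 - \<rho>) * (\<integral>\<^sup>+\<omega>. \<Phi> (?V \<omega>) \<partial>M)"
  have "(\<integral>\<^sup>+x. g x \<partial>distr ?D borel (v (Suc j))) =
    ennreal \<rho> * (\<integral>\<^sup>+x. g x \<partial>distr ?D borel (\<lambda>\<omega>. Upsilon ps j (v j \<omega>))) + c * (\<integral>\<^sup>+x. g x \<partial>ps (Suc j))"
  proof (rule nn_integral_measure_combination)
    fix B :: "real set" assume B [measurable]: "B \<in> sets borel"
    have "emeasure (distr ?D borel (v (Suc j))) B = (\<integral>\<^sup>+\<omega>. \<Phi> (?V \<omega>) * indicator (v (Suc j) -` B \<inter> space M) \<omega> \<partial>M)"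
      by (simp add: emeasure_distr emeasure_density)
    also have "\<dots> = (\<integral>\<^sup>+\<omega>. \<Phi> (?V \<omega>) * indicator B (v (Suc j) \<omega>) \<partial>M)"
      by (intro nn_integral_cong) (auto simp: indicator_def)
    also have "\<dots> = (\<integral>\<^sup>+\<omega>. \<Phi> (?V \<omega>) * k B \<omega> \<partial>M)" by (rule 1[OF B])
    also have "\<dots> = (\<integral>\<^sup>+\<omega>. ennreal \<rho> * (\<Phi> (?V \<omega>) * indicator B (Upsilon ps j (v j \<omega>)))
        + \<Phi> (?V \<omega>) * (ennreal (1 - \<rho>) * emeasure (ps (Suc j)) B) \<partial>M)"
      by (simp add: k_def distrib_left ac_simps)
    also have "\<dots> = ennreal \<rho> * (\<integral>\<^sup>+\<omega>. \<Phi> (?V \<omega>) * indicator B (Upsilon ps j (v j \<omega>)) \<partial>M) + c * emeasure (ps (Suc j)) B"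
      unfolding c_def by (subst nn_integral_add; (measurable)?) (simp add: nn_integral_cmult nn_integral_multc ac_simps)
    also have "(\<integral>\<^sup>+\<omega>. \<Phi> (?V \<omega>) * indicator B (Upsilon ps j (v j \<omega>)) \<partial>M)
      = (\<integral>\<^sup>+\<omega>. \<Phi> (?V \<omega>) * indicator ((\<lambda>\<omega>. Upsilon ps j (v j \<omega>)) -` B \<inter> space M) \<omega> \<partial>M)"
      by (intro nn_integral_cong) (auto simp: indicator_def)
    also have "\<dots> = emeasure (distr ?D borel (\<lambda>\<omega>. Upsilon ps j (v j \<omega>))) B"
      by (simp add: emeasure_distr emeasure_density)
    finally show "emeasure (distr ?D borel (v (Suc j))) B =
      ennreal \<rho> * emeasure (distr ?D borel (\<lambda>\<omega>. Upsilon ps j (v j \<omega>))) B + c * emeasure (ps (Suc j)) B" .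
  qed simp_all
  then show ?thesis
    unfolding c_def by (simp add: nn_integral_distr nn_integral_density)
qed

text \<open>The bounds C and D keep every integral finite, and nonnegativity of both functions
  allows the return from extended nonnegative integrals to real ones.\<close>

lemma expectation_transition:
  fixes \<Phi> :: "(nat \<Rightarrow> real) \<Rightarrow> real" and g :: "real \<Rightarrow> real"
  assumes [measurable]: "\<Phi> \<in> borel_measurable (Pi\<^sub>M {..j} (\<lambda>_. borel))" "g \<in> borel_measurable borel"
    and \<Phi>: "\<And>x. 0 \<le> \<Phi> x" "\<And>x. \<Phi> x \<le> C" and g: "\<And>x. 0 \<le> g x" "\<And>x. g x \<le> D"
  shows "(\<integral>\<omega>. \<Phi> (\<lambda>i\<in>{..j}. v i \<omega>) * g (v (Suc j) \<omega>) \<partial>M) =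
    \<rho> * (\<integral>\<omega>. \<Phi> (\<lambda>i\<in>{..j}. v i \<omega>) * g (Upsilon ps j (v j \<omega>)) \<partial>M)
    + (1 - \<rho>) * (\<integral>\<omega>. \<Phi> (\<lambda>i\<in>{..j}. v i \<omega>) \<partial>M) * (\<integral>x. g x \<partial>ps (Suc j))"
proof -
  interpret p: prob_space "ps (Suc j)" by (rule prob_space_ps)
  let ?V = "\<lambda>\<omega>. \<lambda>i\<in>{..j}. v i \<omega>"
  have C: "0 \<le> C" using \<Phi>(1)[of undefined] \<Phi>(2)[of undefined] by linarith
  have D: "0 \<le> D" using g(1)[of 0] g(2)[of 0] by linarith
  have nn: "ennreal (\<integral>\<omega>. \<Phi> (?V \<omega>) * g (u \<omega>) \<partial>M) = (\<integral>\<^sup>+\<omega>. ennreal (\<Phi> (?V \<omega>)) * ennreal (g (u \<omega>)) \<partial>M)"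
    if [measurable]: "u \<in> borel_measurable M" for u
  proof -
    have "integrable M (\<lambda>\<omega>. \<Phi> (?V \<omega>) * g (u \<omega>))"
      using \<Phi> g C D by (intro integrable_const_bound[of _ "C * D"]) (auto simp: abs_mult intro!: mult_mono)
    then show ?thesis
      using \<Phi> g by (subst nn_integral_eq_integral[symmetric]) (auto simp: ennreal_mult)
  qed
  have nn1: "ennreal (\<integral>\<omega>. \<Phi> (?V \<omega>) \<partial>M) = (\<integral>\<^sup>+\<omega>. ennreal (\<Phi> (?V \<omega>)) \<partial>M)"
    using \<Phi> C by (intro nn_integral_eq_integral[symmetric] integrable_const_bound[of _ C]) auto
  have nn2: "ennreal (\<integral>x. g x \<partial>ps (Suc j)) = (\<integral>\<^sup>+x. ennreal (g x) \<partial>ps (Suc j))"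
    using g D by (intro nn_integral_eq_integral[symmetric] p.integrable_const_bound[of _ D]) auto
  have pos: "0 \<le> (\<integral>\<omega>. \<Phi> (?V \<omega>) * g (u \<omega>) \<partial>M)" "0 \<le> (\<integral>\<omega>. \<Phi> (?V \<omega>) \<partial>M)" "0 \<le> (\<integral>x. g x \<partial>ps (Suc j))" for u
    using \<Phi> g by simp_all
  have "ennreal (\<integral>\<omega>. \<Phi> (?V \<omega>) * g (v (Suc j) \<omega>) \<partial>M) =
    ennreal \<rho> * ennreal (\<integral>\<omega>. \<Phi> (?V \<omega>) * g (Upsilon ps j (v j \<omega>)) \<partial>M)
    + ennreal (1 - \<rho>) * ennreal (\<integral>\<omega>. \<Phi> (?V \<omega>) \<partial>M) * ennreal (\<integral>x. g x \<partial>ps (Suc j))"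
    using nn_integral_transition[of "\<lambda>x. ennreal (\<Phi> x)" j "\<lambda>x. ennreal (g x)"] by (simp add: nn nn1 nn2)
  also have "\<dots> = ennreal (\<rho> * (\<integral>\<omega>. \<Phi> (?V \<omega>) * g (Upsilon ps j (v j \<omega>)) \<partial>M)
    + (1 - \<rho>) * (\<integral>\<omega>. \<Phi> (?V \<omega>) \<partial>M) * (\<integral>x. g x \<partial>ps (Suc j)))"
    using rho pos by (simp add: ennreal_mult ennreal_plus)
  finally show ?thesis
    using rho pos by (subst (asm) ennreal_inj) auto
qed

lemma AE_v_mem: "AE \<omega> in M. v j \<omega> \<in> {0..1}"
proof (cases j)
  case 0
  have "AE x in distr M borel (v 0). x \<in> {0..1}"
    unfolding law_0 by (rule admissible_len_AE[OF adm])
  then show ?thesis unfolding 0 by (subst (asm) AE_distr_iff) auto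
next
  case (Suc i)
  let ?S = "Pi\<^sub>M {..i} (\<lambda>_. borel) :: (nat \<Rightarrow> real) measure"
  have "(\<lambda>i\<in>{..i}. v i \<omega>) \<in> space ?S" for \<omega>
    by (simp add: space_PiM)
  \<comment> \<open>The transition law with no condition on the past: both components of the kernel
    give [0,1] full mass, and \<rho> + (1 - \<rho>) = 1.\<close>
  then have "measure M {\<omega> \<in> space M. v (Suc i) \<omega> \<in> {0..1}} = 1"
    using transition[of "space ?S" i "{0..1}"] Upsilon_mem[of ps, OF adm] admissible_lenD(2)[OF adm]
    by (simp add: prob_space)
  then have "AE \<omega> in M. \<omega> \<in> {\<omega> \<in> space M. v (Suc i) \<omega> \<in> {0..1}}" by (rule AE_prob_1)
  then show ?thesis unfolding Suc by eventually_elim simp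
qed

end

section \<open>The extreme cases \<rho> = 0 and \<rho> = 1\<close>

context lazy_chain
begin

text \<open>For \<rho> = 0 the kernel ignores the past, so the last coordinate splits off as a
  constant factor.\<close>

lemma independent_transition:
  assumes "\<rho> = 0" and A: "\<And>m. A m \<in> sets borel"
  shows "measure M {\<omega> \<in> space M. \<forall>m<k. v m \<omega> \<in> A m} = (\<Prod>m<k. measure (ps m) (A m))"
proof (induction k)
  case 0
  then show ?case by (simp add: prob_space)
next
  case (Suc k)
  show ?case
  proof (cases k)
    case 0
    have "measure (ps 0) (A 0) = measure M {\<omega> \<in> space M. v 0 \<omega> \<in> A 0}"
      unfolding law_0[symmetric] using A by (subst measure_distr) (auto intro!: arg_cong2[where f=measure])
    then show ?thesis by (simp add: 0)
  next
    case k: (Suc j)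
    let ?B = "Pi\<^sub>E {..j} A"
    have B: "?B \<in> sets (Pi\<^sub>M {..j} (\<lambda>_. borel))" using A by (intro sets_PiM_I_finite) auto
    have *: "(\<lambda>i\<in>{..j}. v i \<omega>) \<in> ?B \<longleftrightarrow> (\<forall>m<k. v m \<omega> \<in> A m)" for \<omega>
      by (auto simp: PiE_iff k less_Suc_eq_le)
    have "measure M {\<omega> \<in> space M. \<forall>m<Suc k. v m \<omega> \<in> A m} = measure M {\<omega> \<in> space M. (\<lambda>i\<in>{..j}. v i \<omega>) \<in> ?B \<and> v (Suc j) \<omega> \<in> A (Suc j)}"
      unfolding * by (intro arg_cong2[where f=measure] refl) (auto simp: k less_Suc_eq)
    also have "\<dots> = (\<integral>\<omega>. indicator {\<omega> \<in> space M. \<forall>m<k. v m \<omega> \<in> A m} \<omega> * measure (ps (Suc j)) (A (Suc j)) \<partial>M)"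
      unfolding transition[OF B A]
    proof (intro Bochner_Integration.integral_cong refl)
      fix \<omega> assume "\<omega> \<in> space M"
      then have "indicator ?B (\<lambda>i\<in>{..j}. v i \<omega>) = (indicator {\<omega> \<in> space M. \<forall>m<k. v m \<omega> \<in> A m} \<omega> :: real)"
        by (simp only: indicator_def * mem_Collect_eq simp_thms)
      then show "indicator ?B (\<lambda>i\<in>{..j}. v i \<omega>) * (\<rho> * indicator (A (Suc j)) (Upsilon ps j (v j \<omega>)) + (1 - \<rho>) * measure (ps (Suc j)) (A (Suc j)))
          = indicator {\<omega> \<in> space M. \<forall>m<k. v m \<omega> \<in> A m} \<omega> * measure (ps (Suc j)) (A (Suc j))"
        using assms(1) by simp
    qed
    also have "\<dots> = measure M {\<omega> \<in> space M. \<forall>m<k. v m \<omega> \<in> A m} * measure (ps (Suc j)) (A (Suc j))"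
    proof -
      have "{\<omega> \<in> space M. \<forall>m<k. v m \<omega> \<in> A m} \<in> sets M" using A by measurable
      moreover have "(\<integral>\<omega>. indicator E \<omega> * c \<partial>M) = measure M E * c" if "E \<in> sets M" for E and c :: real
        using that by (simp add: sets.Int_space_eq2)
      ultimately show ?thesis by blast
    qed
    finally show ?thesis unfolding Suc.IH by (simp add: k)
  qed
qed

lemma distr_independent:
  assumes "\<rho> = 0"
  shows "distr M (PiM UNIV (\<lambda>_. borel)) (\<lambda>\<omega> i. v i \<omega>) = PiM UNIV ps"
proof (rule measure_eqI_initial_boxes)
  have V [measurable]: "(\<lambda>\<omega> i. v i \<omega>) \<in> measurable M (PiM UNIV (\<lambda>_. borel))"
    by (rule measurable_PiM_single') (auto simp: space_PiM)
  show "sets (PiM UNIV ps) = sets (PiM UNIV (\<lambda>_. borel))"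
    by (intro sets_PiM_cong) auto
  show "finite_measure (distr M (PiM UNIV (\<lambda>_. borel)) (\<lambda>\<omega> i. v i \<omega>))"
    by (intro finite_measureI) (simp add: emeasure_distr)
  fix k and A :: "nat \<Rightarrow> real set" assume A [measurable]: "\<And>m. A m \<in> sets borel"
  let ?B = "{w. \<forall>m<k. w m \<in> A m}"
  have "?B = {w \<in> space (PiM UNIV (\<lambda>_. borel)). \<forall>m<k. w m \<in> A m}" by (simp add: space_PiM)
  also have "\<dots> \<in> sets (PiM UNIV (\<lambda>_. borel))" by measurable
  finally have B [measurable]: "?B \<in> sets (PiM UNIV (\<lambda>_. borel))" .
  have "emeasure (distr M (PiM UNIV (\<lambda>_. borel)) (\<lambda>\<omega> i. v i \<omega>)) ?B = emeasure M {\<omega> \<in> space M. \<forall>m<k. v m \<omega> \<in> A m}"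
    by (subst emeasure_distr[OF V B]) (auto intro!: arg_cong2[where f=emeasure])
  also have "\<dots> = (\<Prod>m<k. emeasure (ps m) (A m))"
    using independent_transition[OF assms A, of k] finite_measure.emeasure_eq_measure[OF prob_space.finite_measure[OF prob_space_ps]]
    by (simp add: emeasure_eq_measure prod_ennreal measure_nonneg)
  also have "\<dots> = emeasure (PiM UNIV ps) (prod_emb UNIV ps {..<k} (Pi\<^sub>E {..<k} A))"
    using A by (subst emeasure_PiM_emb) (auto intro: prob_space_ps)
  moreover have "prod_emb UNIV ps {..<k} (Pi\<^sub>E {..<k} A) = ?B"
  proof -
    have "space (ps i) = UNIV" for i
      by (rule real_distribution.space_eq_univ[OF real_distribution_ps])
    then show ?thesis by (auto simp: prod_emb_def PiE_iff)
  qed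
  ultimately show "emeasure (distr M (PiM UNIV (\<lambda>_. borel)) (\<lambda>\<omega> i. v i \<omega>)) ?B = emeasure (PiM UNIV ps) ?B" by simp
qed simp

lemma distr_coordinate_independent:
  assumes "\<rho> = 0"
  shows "distr M borel (v j) = ps j"
proof -
  have V [measurable]: "(\<lambda>\<omega> i. v i \<omega>) \<in> measurable M (PiM UNIV (\<lambda>_. borel))"
    by (rule measurable_PiM_single') (auto simp: space_PiM)
  have "distr M borel (v j) = distr (distr M (PiM UNIV (\<lambda>_. borel)) (\<lambda>\<omega> i. v i \<omega>)) borel (\<lambda>x. x j)"
    by (subst distr_distr) (auto simp: comp_def)
  also have "\<dots> = distr (PiM UNIV ps) (ps j) (\<lambda>x. x j)"
    unfolding distr_independent[OF assms] by (intro distr_cong) auto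
  also have "\<dots> = ps j"
    by (rule distr_PiM_component) (auto intro: prob_space_ps)
  finally show ?thesis .
qed

lemma indep_vars_v:
  assumes "\<rho> = 0"
  shows "indep_vars (\<lambda>_. borel) v UNIV"
proof -
  have "distr M (PiM UNIV (\<lambda>_. borel)) (\<lambda>\<omega>. \<lambda>i\<in>UNIV. v i \<omega>) = PiM UNIV (\<lambda>i. distr M borel (v i))"
    unfolding distr_coordinate_independent[OF assms] distr_independent[OF assms, symmetric] restrict_UNIV ..
  then show ?thesis
    by (intro indep_vars_iff_distr_eq_PiM[THEN iffD2] v_measurable) simp_all
qed

text \<open>The transition law only speaks about events. For \<rho> = 1 the event that Upsilon lies
  in A while the next length lies outside A is null, because its integrand is the product of the
  indicators of A and of its complement.\<close>

lemma AE_deterministic_transition: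
  assumes "\<rho> = 1"
  shows "AE \<omega> in M. v (Suc j) \<omega> = Upsilon ps j (v j \<omega>)"
proof -
  have zero: "AE \<omega> in M. \<not> (Upsilon ps j (v j \<omega>) \<in> A \<and> v (Suc j) \<omega> \<in> - A)" if A [measurable]: "A \<in> sets borel" for A
  proof -
    let ?A = "{x \<in> space (Pi\<^sub>M {..j} (\<lambda>_. borel)). Upsilon ps j (x j) \<in> A}"
    have "?A \<in> sets (Pi\<^sub>M {..j} (\<lambda>_. borel))" by measurable
    from transition[OF this, of "- A"] 
    have "measure M {\<omega> \<in> space M. (\<lambda>i\<in>{..j}. v i \<omega>) \<in> ?A \<and> v (Suc j) \<omega> \<in> - A} = 
      (\<integral>\<omega>. indicator ?A (\<lambda>i\<in>{..j}. v i \<omega>) * indicator (- A) (Upsilon ps j (v j \<omega>)) \<partial>M)"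
      using assms A by simp
    also have "\<dots> = (\<integral>\<omega>. 0 \<partial>M)"
      by (intro Bochner_Integration.integral_cong refl) (auto simp: indicator_def)
    also have "{\<omega> \<in> space M. (\<lambda>i\<in>{..j}. v i \<omega>) \<in> ?A \<and> v (Suc j) \<omega> \<in> - A}
      = {\<omega> \<in> space M. \<not> \<not> (Upsilon ps j (v j \<omega>) \<in> A \<and> v (Suc j) \<omega> \<in> - A)}"
      by (auto simp: space_PiM)
    finally show ?thesis
      by (subst AE_iff_measurable[OF _ refl]) (auto simp: emeasure_eq_measure)
  qed
  \<comment> \<open>Rational half-lines in both directions form a countable family, and two distinct
    reals are separated by one of them.\<close>
  have "AE \<omega> in M. \<forall>q\<in>\<rat>. \<not> (Upsilon ps j (v j \<omega>) \<in> {..q} \<and> v (Suc j) \<omega> \<in> - {..q}) \<and> \<not> (Upsilon ps j (v j \<omega>) \<in> {q..} \<and> v (Suc j) \<omega> \<in> - {q..})"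
    using zero[of "{.._}"] zero[of "{_..}"] by (intro AE_ball_countable[THEN iffD2] countable_rat ballI AE_conjI) auto
  then show ?thesis
  proof eventually_elim
    case (elim \<omega>)
    show ?case
    proof (rule ccontr)
      assume "v (Suc j) \<omega> \<noteq> Upsilon ps j (v j \<omega>)"
      then consider "v (Suc j) \<omega> < Upsilon ps j (v j \<omega>)" | "Upsilon ps j (v j \<omega>) < v (Suc j) \<omega>" by linarith
      then show False
      proof cases
        case 1
        with Rats_dense_in_real[OF 1] elim show False by force
      next
        case 2
        with Rats_dense_in_real[OF 2] elim show False by force
      qed
    qed
  qed
qed

end

text \<open>The ratio r of the two densities is decreasing: where r x >= 1 compare the masses of the left
  tails, otherwise those of the right tails.\<close>

lemma cdf_beta_mono:
  assumes pos: "0 < a" "0 < b" and le: "b \<le> c"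
  shows "cdf (beta_measure a b) x \<le> cdf (beta_measure a c) x"
proof -
  have c: "0 < c" using assms by simp
  interpret b: prob_space "beta_measure a b" using pos by (intro prob_space_beta_measure)
  interpret c: prob_space "beta_measure a c" using pos c by (intro prob_space_beta_measure)
  have B: "0 < Beta a b" "0 < Beta a c" using pos c by (auto intro: Beta_real_pos)
  define r where "r t = (1 - t) powr (c - b) * (Beta a b / Beta a c)" for t :: real
  have ratio: "beta_kernel a c t / Beta a c = r t * (beta_kernel a b t / Beta a b)" for t
  proof (cases "0 < t \<and> t < 1")
    case True
    have "c - 1 = (c - b) + (b - 1)" by simp
    then have "(1 - t) powr (c - 1) = (1 - t) powr (c - b) * (1 - t) powr (b - 1)"
      by (simp only: powr_add)
    then show ?thesis using B by (simp add: r_def beta_kernel_def)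
  qed (auto simp: beta_kernel_def)
  have r_mono: "r t \<le> r s" if "s \<le> t" "t \<le> 1" for s t
    unfolding r_def using that le B by (intro mult_right_mono powr_mono2) auto
  have em: "emeasure (beta_measure a d) S = (\<integral>\<^sup>+t. ennreal (beta_kernel a d t / Beta a d) * indicator S t \<partial>lborel)"
    if "S \<in> sets borel" for d S
    using that by (simp add: beta_measure_eq emeasure_density)
  have dens: "0 \<le> beta_kernel a b t / Beta a b" for t using B beta_kernel_nonneg[of a b t] by simp
  \<comment> \<open>\<open>r_mono\<close> compares points up to 1 only. For x at least 1 both
    distribution functions are equal to 1, so that range needs no density argument.\<close>
  show ?thesis
  proof (cases "1 \<le> r x \<or> 1 \<le> x")
    case True
    show ?thesis
    proof (cases "1 \<le> x")
      case True
      have "cdf (beta_measure a d) x = 1" if "prob_space (beta_measure a d)" for d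
        unfolding cdf_def using that True AE_beta_measure[of a d]
        by (intro prob_space.AE_in_set_eq_1[THEN iffD1]) (auto elim: eventually_mono)
      then show ?thesis using b.prob_space_axioms c.prob_space_axioms by simp
    next
      case False
      with True have "1 \<le> r x" by simp
      have "emeasure (beta_measure a b) {..x} \<le> emeasure (beta_measure a c) {..x}"
        unfolding em[of "{..x}", simplified]
      proof (intro nn_integral_mono)
        fix t :: real
        show "ennreal (beta_kernel a b t / Beta a b) * indicator {..x} t \<le> ennreal (beta_kernel a c t / Beta a c) * indicator {..x} t"
        proof (cases "t \<le> x")
          case True
          then have "1 \<le> r t" using r_mono[of t x] \<open>1 \<le> r x\<close> False by linarith
          then have "1 * (beta_kernel a b t / Beta a b) \<le> r t * (beta_kernel a b t / Beta a b)"
            by (intro mult_right_mono dens)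
          then show ?thesis by (auto simp: ratio intro!: mult_right_mono ennreal_leI)
        qed simp
      qed
      then show ?thesis by (simp add: cdf_def b.emeasure_eq_measure c.emeasure_eq_measure)
    qed
  next
    case False
    have "emeasure (beta_measure a c) {x<..} \<le> emeasure (beta_measure a b) {x<..}"
      unfolding em[of "{x<..}", simplified]
    proof (intro nn_integral_mono)
      fix t :: real
      show "ennreal (beta_kernel a c t / Beta a c) * indicator {x<..} t \<le> ennreal (beta_kernel a b t / Beta a b) * indicator {x<..} t"
      proof (cases "x < t \<and> t < 1")
        case True
        then have "r t \<le> 1" using r_mono[of x t] False by linarith
        then have "r t * (beta_kernel a b t / Beta a b) \<le> 1 * (beta_kernel a b t / Beta a b)"
          by (intro mult_right_mono dens)
        then show ?thesis by (auto simp: ratio intro!: mult_right_mono ennreal_leI)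
      next
        case False
        then show ?thesis by (auto simp: beta_kernel_def indicator_def)
      qed
    qed
    then have "measure (beta_measure a c) {x<..} \<le> measure (beta_measure a b) {x<..}"
      by (simp add: b.emeasure_eq_measure c.emeasure_eq_measure)
    moreover have "{x<..} = UNIV - {..x}" by auto
    ultimately show ?thesis
      using b.prob_compl[of "{..x}"] c.prob_compl[of "{..x}"] by (simp add: cdf_def)
  qed
qed

text \<open>If Upsilon x exceeded x, strict monotonicity would give F_(j+1) x < F_(j+1) (Upsilon x)
  = F_j x.\<close>

lemma Upsilon_le:
  assumes adm: "\<And>j. admissible_len (ps j)" and cdf: "cdf (ps j) x \<le> cdf (ps (Suc j)) x" and x: "x \<in> {0..1}"
  shows "Upsilon ps j x \<le> x"
proof (rule ccontr)
  assume "\<not> ?thesis"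
  then have "cdf (ps (Suc j)) x < cdf (ps (Suc j)) (Upsilon ps j x)"
    using strict_mono_onD[OF admissible_lenD(4)[OF adm] x Upsilon_mem[of ps, OF adm]] by simp
  then show False using cdf cdf_Upsilon[of ps, OF adm] by simp
qed

lemma sb_weights_antimono:
  assumes v: "\<And>i. v i \<in> {0..1}" and le: "v (Suc j) \<le> v j"
  shows "sb_weights v (Suc j) \<le> sb_weights v j"
proof -
  have "v (Suc j) * (1 - v j) \<le> v (Suc j) * 1"
    using v[of j] v[of "Suc j"] by (intro mult_left_mono) auto
  with le have "v (Suc j) * (1 - v j) \<le> v j" by linarith
  moreover have "0 \<le> (\<Prod>i<j. 1 - v i)" using v by (intro prod_nonneg) auto
  ultimately have "(v (Suc j) * (1 - v j)) * (\<Prod>i<j. 1 - v i) \<le> v j * (\<Prod>i<j. 1 - v i)"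
    by (rule mult_right_mono)
  then show ?thesis by (simp add: sb_weights_def ac_simps)
qed

section \<open>Weak convergence\<close>

text \<open>Nonnegativity matches the form of \<open>expectation_transition\<close>. Nothing is
  lost, because the span used in the Stone-Weierstrass step admits negative coefficients.\<close>

definition nice_fun :: "(real \<Rightarrow> real) \<Rightarrow> bool" where
  "nice_fun g \<longleftrightarrow> continuous_on UNIV g \<and> (\<forall>x. 0 \<le> g x) \<and> bounded (range g)"

lemma nice_fun_const: "0 \<le> c \<Longrightarrow> nice_fun (\<lambda>_. c)"
  by (simp add: nice_fun_def)

lemma nice_fun_bounds:
  assumes "nice_fun g"
  shows "\<exists>B. \<forall>x. 0 \<le> g x \<and> g x \<le> B"
proof -
  obtain B where "\<And>x. norm (g x) \<le> B"
    using assms unfolding nice_fun_def bounded_iff by blast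
  then show ?thesis using assms by (intro exI[of _ B]) (auto simp: nice_fun_def abs_le_iff)
qed

lemma nice_fun_mult:
  assumes "nice_fun f" "nice_fun g"
  shows "nice_fun (\<lambda>x. f x * g x)"
proof -
  obtain B C where B: "\<And>x. 0 \<le> f x" "\<And>x. f x \<le> B" and C: "\<And>x. 0 \<le> g x" "\<And>x. g x \<le> C"
    using nice_fun_bounds[OF assms(1)] nice_fun_bounds[OF assms(2)] by blast
  have "norm (f x * g x) \<le> B * C" for x
    using B[of x] C[of x] by (auto simp: abs_mult intro!: mult_mono)
  then show ?thesis
    using assms by (auto simp: nice_fun_def bounded_iff intro!: continuous_intros)
qed

lemma nice_fun_compose:
  assumes "nice_fun g" "continuous_on UNIV u"
  shows "nice_fun (\<lambda>x. g (u x))"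
  using assms bounded_subset[of "range g" "range (\<lambda>x. g (u x))"]
  by (auto simp: nice_fun_def intro: continuous_on_compose2)

lemma nice_fun_measurable: "nice_fun g \<Longrightarrow> g \<in> borel_measurable borel"
  by (auto simp: nice_fun_def intro: borel_measurable_continuous_onI)

text \<open>An injective nice function, used to separate points coordinate by coordinate. The shift
  by 2 makes it positive since \<pi> / 2 < 2.\<close>

lemma nice_fun_arctan: "nice_fun (\<lambda>x. arctan x + 2)"
proof -
  have "norm (arctan x + 2) \<le> 4" "0 \<le> arctan x + 2" for x
    using arctan_bounded[of x] pi_less_4 by auto
  then have "bounded (range (\<lambda>x. arctan x + 2))" unfolding bounded_iff by blast
  then show ?thesis
    using \<open>\<And>x. 0 \<le> arctan x + 2\<close> by (auto simp: nice_fun_def intro!: continuous_intros)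
qed

section \<open>From product test functions to joint convergence of sequences\<close>

lemma compact_box: "compact {x :: nat \<Rightarrow> real. \<forall>i. x i \<in> {a..b}}"
proof -
  have "compactin (product_topology (\<lambda>_. euclidean) UNIV) (PiE (UNIV :: nat set) (\<lambda>_. {a..b}))"
    by (simp add: compactin_PiE)
  moreover have "PiE (UNIV :: nat set) (\<lambda>_. {a..b}) = {x. \<forall>i. x i \<in> {a..b}}"
    by auto
  ultimately show ?thesis by (simp only: euclidean_product_topology compactin_euclidean_iff)
qed

lemma measurable_sequence:
  fixes X :: "nat \<Rightarrow> 'a \<Rightarrow> real"
  assumes "\<And>i. X i \<in> borel_measurable M"
  shows "(\<lambda>\<omega> i. X i \<omega>) \<in> borel_measurable M"
  by (rule measurable_coordinatewise_then_product) (rule assms)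

text \<open>The asymmetric test class is adapted to the application: X will be the weights, tested
  as a whole, and Y the values at the iid atoms, tested one coordinate at a time.\<close>

lemma joint_weak_convergence:
  fixes M :: "'a measure" and X Y :: "nat \<Rightarrow> 'a \<Rightarrow> real" and Mn :: "nat \<Rightarrow> 'a measure"
    and Xn Yn :: "nat \<Rightarrow> nat \<Rightarrow> 'a \<Rightarrow> real" and h :: "(nat \<Rightarrow> real) \<times> (nat \<Rightarrow> real) \<Rightarrow> real"
  assumes M: "prob_space M" "\<And>i. X i \<in> borel_measurable M" "\<And>i. Y i \<in> borel_measurable M"
      "AE \<omega> in M. \<forall>i. X i \<omega> \<in> {a..b} \<and> Y i \<omega> \<in> {a..b}"
    and Mn: "\<And>n. prob_space (Mn n)" "\<And>n i. Xn n i \<in> borel_measurable (Mn n)" "\<And>n i. Yn n i \<in> borel_measurable (Mn n)"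
      "\<And>n. AE \<omega> in Mn n. \<forall>i. Xn n i \<omega> \<in> {a..b} \<and> Yn n i \<omega> \<in> {a..b}"
    and conv: "\<And>f k g. continuous_on UNIV f \<Longrightarrow> bounded (range f) \<Longrightarrow> (\<And>i. nice_fun (g i)) \<Longrightarrow>
      (\<lambda>n. \<integral>\<omega>. f (\<lambda>i. Xn n i \<omega>) * (\<Prod>i<k. g i (Yn n i \<omega>)) \<partial>Mn n)
        \<longlonglongrightarrow> (\<integral>\<omega>. f (\<lambda>i. X i \<omega>) * (\<Prod>i<k. g i (Y i \<omega>)) \<partial>M)"
    and h: "continuous_on UNIV h"
  shows "(\<lambda>n. \<integral>\<omega>. h (\<lambda>i. Xn n i \<omega>, \<lambda>i. Yn n i \<omega>) \<partial>Mn n) \<longlonglongrightarrow> (\<integral>\<omega>. h (\<lambda>i. X i \<omega>, \<lambda>i. Y i \<omega>) \<partial>M)"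
proof -
  define F :: "((nat \<Rightarrow> real) \<times> (nat \<Rightarrow> real) \<Rightarrow> real) set" where
    "F = {\<lambda>z. f (fst z) * (\<Prod>i<k. g i (snd z i)) | f k g.
        continuous_on UNIV f \<and> bounded (range f) \<and> (\<forall>i. nice_fun (g i))}"
  have FI: "(\<lambda>z. f (fst z) * (\<Prod>i<k. g i (snd z i))) \<in> F"
    if "continuous_on UNIV f" "bounded (range f)" "\<And>i. nice_fun (g i)" for f k g
    unfolding F_def using that by blast
  let ?B = "{x :: nat \<Rightarrow> real. \<forall>i. x i \<in> {a..b}}"
  let ?K = "?B \<times> ?B"
  have F_cont: "continuous_on UNIV \<phi>" if in_F: "\<phi> \<in> F" for \<phi>
  proof -
    obtain f k g where \<phi>: "\<phi> = (\<lambda>z. f (fst z) * (\<Prod>i<k. g i (snd z i)))"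
      and f: "continuous_on UNIV f" and g: "\<And>i. nice_fun (g i)"
      using in_F unfolding F_def by blast
    have "continuous_on UNIV (\<lambda>z :: (nat \<Rightarrow> real) \<times> (nat \<Rightarrow> real). g i (snd z i))" for i
    proof (rule continuous_on_compose2[of UNIV "g i"])
      show "continuous_on UNIV (g i)" using g[of i] by (simp add: nice_fun_def)
      show "continuous_on UNIV (\<lambda>z :: (nat \<Rightarrow> real) \<times> (nat \<Rightarrow> real). snd z i)"
        by (rule continuous_on_product_then_coordinatewise) (rule continuous_on_snd[OF continuous_on_id])
    qed simp
    moreover have "continuous_on UNIV (\<lambda>z :: (nat \<Rightarrow> real) \<times> (nat \<Rightarrow> real). f (fst z))"
      by (rule continuous_on_compose2[OF f continuous_on_fst[OF continuous_on_id]]) simp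
    ultimately show ?thesis unfolding \<phi> by (intro continuous_intros)
  qed
  have XY: "(\<lambda>\<omega>. (\<lambda>i. U i \<omega>, \<lambda>i. V i \<omega>)) \<in> borel_measurable N"
    if "\<And>i. U i \<in> borel_measurable N" "\<And>i. V i \<in> borel_measurable N" for U V :: "nat \<Rightarrow> 'a \<Rightarrow> real" and N
    unfolding borel_prod[symmetric] by (intro measurable_Pair measurable_sequence that)
  have meas: "\<phi> \<in> borel_measurable borel" if "continuous_on UNIV \<phi>"
    for \<phi> :: "(nat \<Rightarrow> real) \<times> (nat \<Rightarrow> real) \<Rightarrow> real"
    using that by (rule borel_measurable_continuous_onI)
  let ?\<mu> = "distr M borel (\<lambda>\<omega>. (\<lambda>i. X i \<omega>, \<lambda>i. Y i \<omega>))"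
  let ?\<mu>n = "\<lambda>n. distr (Mn n) borel (\<lambda>\<omega>. (\<lambda>i. Xn n i \<omega>, \<lambda>i. Yn n i \<omega>))"
  have K: "compact ?K" by (intro compact_Times compact_box)
  have AE_K: "AE z in distr N borel (\<lambda>\<omega>. (\<lambda>i. U i \<omega>, \<lambda>i. V i \<omega>)). z \<in> ?K"
    if "\<And>i. U i \<in> borel_measurable N" "\<And>i. V i \<in> borel_measurable N"
      "AE \<omega> in N. \<forall>i. U i \<omega> \<in> {a..b} \<and> V i \<omega> \<in> {a..b}" for U V :: "nat \<Rightarrow> 'a \<Rightarrow> real" and N
  proof (subst AE_distr_iff)
    show "{z \<in> space borel. z \<in> ?K} \<in> sets borel" using borel_closed[OF compact_imp_closed[OF K]] by simp
    show "AE \<omega> in N. (\<lambda>i. U i \<omega>, \<lambda>i. V i \<omega>) \<in> ?K" using that(3) by eventually_elim auto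
  qed (intro XY that)
  have int_M: "(\<integral>z. \<phi> z \<partial>?\<mu>) = (\<integral>\<omega>. \<phi> (\<lambda>i. X i \<omega>, \<lambda>i. Y i \<omega>) \<partial>M)" if "continuous_on UNIV \<phi>" for \<phi> :: "_ \<Rightarrow> real"
    using that by (intro integral_distr XY M meas)
  have int_Mn: "(\<integral>z. \<phi> z \<partial>?\<mu>n n) = (\<integral>\<omega>. \<phi> (\<lambda>i. Xn n i \<omega>, \<lambda>i. Yn n i \<omega>) \<partial>Mn n)" if "continuous_on UNIV \<phi>" for \<phi> :: "_ \<Rightarrow> real" and n
    using that by (intro integral_distr XY Mn meas)
  have "(\<lambda>n. \<integral>z. h z \<partial>?\<mu>n n) \<longlonglongrightarrow> (\<integral>z. h z \<partial>?\<mu>)"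
  proof (rule weak_convergence_from_class[OF K])
    show "continuous_on ?K \<phi>" "\<phi> \<in> borel_measurable borel" if "\<phi> \<in> F" for \<phi>
      using continuous_on_subset[OF F_cont[OF that]] meas[OF F_cont[OF that]] by auto
    show "(\<lambda>_. 1) \<in> F" using FI[of "\<lambda>_. 1" "\<lambda>_ _. 1" 0] by (simp add: nice_fun_const)
    show "(\<lambda>z. \<phi> z * \<psi> z) \<in> F" if "\<phi> \<in> F" "\<psi> \<in> F" for \<phi> \<psi>
    proof -
      obtain f k g where \<phi>: "\<phi> = (\<lambda>z. f (fst z) * (\<Prod>i<k. g i (snd z i)))"
        and f: "continuous_on UNIV f" "bounded (range f)" and g: "\<And>i. nice_fun (g i)"
        using \<open>\<phi> \<in> F\<close> unfolding F_def by blast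
      obtain f' k' g' where \<psi>: "\<psi> = (\<lambda>z. f' (fst z) * (\<Prod>i<k'. g' i (snd z i)))"
        and f': "continuous_on UNIV f'" "bounded (range f')" and g': "\<And>i. nice_fun (g' i)"
        using \<open>\<psi> \<in> F\<close> unfolding F_def by blast
      \<comment> \<open>Both products are padded with ones to the common length max k k', so that
        their product is again of the form required by F.\<close>
      let ?G = "\<lambda>i x. (if i < k then g i x else 1) * (if i < k' then g' i x else 1)"
      have pad: "(\<Prod>i<m. q i) = (\<Prod>i<max k k'. if i < m then q i else 1)" if "m \<le> max k k'" for m and q :: "nat \<Rightarrow> real"
        using that by (intro prod.mono_neutral_cong_left) auto
      have eq: "(\<lambda>z. \<phi> z * \<psi> z) = (\<lambda>z. (f (fst z) * f' (fst z)) * (\<Prod>i<max k k'. ?G i (snd z i)))"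
        unfolding \<phi> \<psi> by (rule ext) (simp add: pad[of k] pad[of k'] prod.distrib mult_ac)
      obtain c c' where c: "\<And>x. \<bar>f x\<bar> \<le> c" "\<And>x. \<bar>f' x\<bar> \<le> c'"
        using f f' by (auto simp: bounded_iff)
      have "norm (f x * f' x) \<le> c * c'" for x
        unfolding real_norm_def abs_mult using c[of x] by (intro mult_mono) (auto intro: order_trans[OF abs_ge_zero])
      then have "bounded (range (\<lambda>x. f x * f' x))" unfolding bounded_iff by blast
      moreover have "nice_fun (?G i)" for i
        using g[of i] g'[of i] by (cases "i < k"; cases "i < k'") (simp_all add: nice_fun_mult nice_fun_const)
      ultimately show ?thesis
        unfolding eq using f f' by (intro FI continuous_intros)
    qed
    show "\<exists>\<phi>\<in>F. \<phi> z \<noteq> \<phi> z'" if ne: "z \<noteq> z'" for z z'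
    proof (cases "fst z = fst z'")
      case False
      then obtain i where i: "fst z i \<noteq> fst z' i" by (auto simp: fun_eq_iff)
      have "continuous_on UNIV (\<lambda>x :: nat \<Rightarrow> real. arctan (x i) + 2)"
        by (intro continuous_intros continuous_on_arctan continuous_on_product_coordinates)
      moreover have "bounded (range (\<lambda>x :: nat \<Rightarrow> real. arctan (x i) + 2))"
        using nice_fun_arctan by (auto simp: nice_fun_def intro: bounded_subset)
      ultimately have "(\<lambda>z. (arctan (fst z i) + 2) * (\<Prod>i<0. 1)) \<in> F"
        using FI[of "\<lambda>x. arctan (x i) + 2" "\<lambda>_ _. 1" 0] by (simp add: nice_fun_const)
      then show ?thesis using i by (intro bexI) (auto simp: arctan_eq_iff)
    next
      case True
      with ne obtain i where i: "snd z i \<noteq> snd z' i" by (auto simp: fun_eq_iff prod_eq_iff)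
      let ?g = "\<lambda>j x. if j = i then arctan x + 2 else 1"
      have "nice_fun (?g j)" for j using nice_fun_arctan nice_fun_const[of 1] by (cases "j = i") simp_all
      then have "(\<lambda>z. 1 * (\<Prod>j<Suc i. ?g j (snd z j))) \<in> F"
        by (intro FI) simp_all
      then show ?thesis using i by (intro bexI) (auto simp: arctan_eq_iff)
    qed
    show "prob_space ?\<mu>" "\<And>n. prob_space (?\<mu>n n)"
      using M Mn by (auto intro!: prob_space.prob_space_distr XY)
    show "AE z in ?\<mu>. z \<in> ?K" "\<And>n. AE z in ?\<mu>n n. z \<in> ?K"
      by (intro AE_K M Mn)+
    show "(\<lambda>n. \<integral>z. \<phi> z \<partial>?\<mu>n n) \<longlonglongrightarrow> (\<integral>z. \<phi> z \<partial>?\<mu>)" if "\<phi> \<in> F" for \<phi>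
    proof -
      obtain f k g where \<phi>: "\<phi> = (\<lambda>z. f (fst z) * (\<Prod>i<k. g i (snd z i)))"
        and f: "continuous_on UNIV f" "bounded (range f)" and g: "\<And>i. nice_fun (g i)"
        using \<open>\<phi> \<in> F\<close> unfolding F_def by blast
      show ?thesis
        unfolding int_M[OF F_cont[OF that]] int_Mn[OF F_cont[OF that]] unfolding \<phi>
        using conv[OF f g, where k=k] by simp
    qed
    show "continuous_on ?K h" using h continuous_on_subset by blast
    show "h \<in> borel_measurable borel" by (rule meas[OF h])
  qed simp_all
  then show ?thesis unfolding int_M[OF h] int_Mn[OF h] .
qed

text \<open>Conditioning on the lengths up to index j, the last factor is either evaluated at
  Upsilon of the j-th length, and can be merged into the j-th test function, or contributes an
  integral against a marginal. The merging changes the test functions, so the induction must range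
  over all of them.\<close>

lemma lazy_chain_product_convergence:
  fixes M :: "'a measure" and Mn :: "nat \<Rightarrow> 'a measure"
  assumes C: "lazy_chain M \<rho> ps v" and Cn: "\<And>n. lazy_chain (Mn n) (\<rho>n n) (psn n) (vn n)"
    and conv_rho: "\<rho>n \<longlonglongrightarrow> \<rho>" and conv_ps: "\<And>j. weak_conv_meas (\<lambda>n. psn n j) (ps j)"
    and "\<And>i. nice_fun (g i)"
  shows "(\<lambda>n. \<integral>\<omega>. (\<Prod>i\<le>j. g i (vn n i \<omega>)) \<partial>Mn n) \<longlonglongrightarrow> (\<integral>\<omega>. (\<Prod>i\<le>j. g i (v i \<omega>)) \<partial>M)"
  using assms(5)
proof (induction j arbitrary: g)
  case 0
  have "(\<lambda>n. \<integral>x. g 0 x \<partial>psn n 0) \<longlonglongrightarrow> (\<integral>x. g 0 x \<partial>ps 0)"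
    using conv_ps[of 0] 0[of 0] by (simp add: weak_conv_meas_def nice_fun_def)
  moreover have law: "(\<integral>x. g 0 x \<partial>qs 0) = (\<integral>\<omega>. g 0 (u 0 \<omega>) \<partial>N)" if "lazy_chain N r qs u" for N :: "'a measure" and r qs u
  proof -
    interpret lazy_chain N r qs u by fact
    show ?thesis unfolding law_0[symmetric] by (intro integral_distr nice_fun_measurable 0 v_measurable)
  qed
  ultimately show ?case unfolding law[OF C] law[OF Cn] by simp
next
  case (Suc j)
  interpret C: lazy_chain M \<rho> ps v by fact
  interpret Cn: lazy_chain "Mn n" "\<rho>n n" "psn n" "vn n" for n by (rule Cn)
  note [measurable] = nice_fun_measurable[OF Suc.prems]
  define \<Phi> where "\<Phi> x = (\<Prod>i\<le>j. g i (x i))" for x :: "nat \<Rightarrow> real"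
  have \<Phi>_measurable: "\<Phi> \<in> borel_measurable (Pi\<^sub>M {..j} (\<lambda>_. borel))"
    unfolding \<Phi>_def by measurable
  have "\<exists>B. \<forall>i. \<forall>x. 0 \<le> g i x \<and> g i x \<le> B i"
    by (intro choice allI nice_fun_bounds Suc.prems)
  then obtain B where B: "\<And>i x. 0 \<le> g i x" "\<And>i x. g i x \<le> B i" by blast
  have \<Phi>: "0 \<le> \<Phi> x" "\<Phi> x \<le> (\<Prod>i\<le>j. B i)" for x
    unfolding \<Phi>_def using B by (auto intro!: prod_nonneg prod_mono)
  have \<Phi>_restrict: "\<Phi> (\<lambda>i\<in>{..j}. u i) = (\<Prod>i\<le>j. g i (u i))" for u
    unfolding \<Phi>_def by (intro prod.cong) auto
  let ?g = "g (Suc j)"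
  \<comment> \<open>The merged test functions: the j-th one absorbs the last factor composed with
    the limiting Upsilon. Continuity of Upsilon keeps them admissible for the induction
    hypothesis.\<close>
  let ?g' = "\<lambda>i x. g i x * (if i = j then ?g (Upsilon ps j x) else 1)"
  have nice': "nice_fun (?g' i)" for i
  proof (cases "i = j")
    case True
    then show ?thesis
      using nice_fun_mult[OF Suc.prems[of j] nice_fun_compose[OF Suc.prems[of "Suc j"] continuous_on_Upsilon[of ps, OF C.adm]]] by simp
  qed (simp add: Suc.prems)
  have prod': "(\<Prod>i\<le>j. ?g' i (u i)) = (\<Prod>i\<le>j. g i (u i)) * ?g (Upsilon ps j (u j))" for u
    by (simp add: prod.distrib prod.delta)
  \<comment> \<open>\<open>An\<close> contains the limiting Upsilon and is covered by the induction
    hypothesis; \<open>An'\<close> contains the n-th map, which is the one produced by the n-th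
    chain. Their difference vanishes by uniform convergence of these maps.\<close>
  define A where "A = (\<integral>\<omega>. (\<Prod>i\<le>j. g i (v i \<omega>)) * ?g (Upsilon ps j (v j \<omega>)) \<partial>M)"
  define An where "An n = (\<integral>\<omega>. (\<Prod>i\<le>j. g i (vn n i \<omega>)) * ?g (Upsilon ps j (vn n j \<omega>)) \<partial>Mn n)" for n
  define An' where "An' n = (\<integral>\<omega>. (\<Prod>i\<le>j. g i (vn n i \<omega>)) * ?g (Upsilon (psn n) j (vn n j \<omega>)) \<partial>Mn n)" for n
  have An: "An \<longlonglongrightarrow> A"
    using Suc.IH[of ?g', OF nice'] unfolding prod' A_def An_def .
  have "(\<lambda>n. An' n - An n) \<longlonglongrightarrow> 0"
  proof (rule LIMSEQ_I)
    fix e :: real assume e: "0 < e"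
    let ?C = "\<Prod>i\<le>j. B i"
    have C: "0 \<le> ?C" using \<Phi>[of undefined] by linarith
    have "uniformly_continuous_on {0..1} ?g"
      using Suc.prems[of "Suc j"] by (intro compact_uniformly_continuous) (auto simp: nice_fun_def intro: continuous_on_subset)
    \<comment> \<open>\<open>?C\<close> bounds the product of the first factors, so this modulus
      leaves an error of e/2. The summand 1 avoids division by zero.\<close>
    moreover have "0 < e / (2 * (?C + 1))" using C e by simp
    ultimately obtain d where d: "0 < d" "\<And>x y. x \<in> {0..1} \<Longrightarrow> y \<in> {0..1} \<Longrightarrow> dist x y < d \<Longrightarrow> dist (?g x) (?g y) < e / (2 * (?C + 1))"
      unfolding uniformly_continuous_on_def by metis
    from uniform_limitD[OF uniform_limit_Upsilon[of psn ps j, OF Cn.adm C.adm conv_ps] d(1)]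
    obtain N where N: "\<And>n x. N \<le> n \<Longrightarrow> dist (Upsilon (psn n) j x) (Upsilon ps j x) < d"
      unfolding eventually_sequentially by blast
    show "\<exists>N. \<forall>n\<ge>N. norm (An' n - An n - 0) < e"
    proof (intro exI allI impI)
      fix n assume n: "N \<le> n"
      have bound: "\<bar>(\<Prod>i\<le>j. g i (vn n i \<omega>)) * ?g x\<bar> \<le> ?C * B (Suc j)" for \<omega> x
        using \<Phi>[of "\<lambda>i. vn n i \<omega>"] B[of "Suc j" x] C unfolding \<Phi>_def by (auto simp: abs_mult intro!: mult_mono)
      have int: "integrable (Mn n) (\<lambda>\<omega>. (\<Prod>i\<le>j. g i (vn n i \<omega>)) * ?g (u \<omega>))" if [measurable]: "u \<in> borel_measurable (Mn n)" for u
        using bound by (intro Cn.integrable_const_bound[where B="?C * B (Suc j)"]) auto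
      have [measurable]: "Upsilon ps j \<in> borel_measurable borel" by (rule C.Upsilon_measurable)
      have "\<bar>An' n - An n\<bar> \<le> e / 2"
        unfolding An'_def An_def
      proof (rule integral_dist_le[where K=UNIV])
        fix \<omega>
        have "\<bar>?g (Upsilon (psn n) j (vn n j \<omega>)) - ?g (Upsilon ps j (vn n j \<omega>))\<bar> \<le> e / (2 * (?C + 1))"
          using d(2)[OF Upsilon_mem[of "psn n", OF Cn.adm] Upsilon_mem[of ps, OF C.adm] N[OF n]] by (simp add: dist_real_def less_imp_le)
        then have "\<bar>\<Phi> (\<lambda>i. vn n i \<omega>)\<bar> * \<bar>?g (Upsilon (psn n) j (vn n j \<omega>)) - ?g (Upsilon ps j (vn n j \<omega>))\<bar> \<le> (?C + 1) * (e / (2 * (?C + 1)))"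
          using \<Phi>[of "\<lambda>i. vn n i \<omega>"] C by (intro mult_mono) auto
        also have "\<dots> = e / 2" using C by (simp add: field_simps)
        finally show "\<bar>(\<Prod>i\<le>j. g i (vn n i \<omega>)) * ?g (Upsilon (psn n) j (vn n j \<omega>)) - (\<Prod>i\<le>j. g i (vn n i \<omega>)) * ?g (Upsilon ps j (vn n j \<omega>))\<bar> \<le> e / 2"
          unfolding \<Phi>_def by (simp add: abs_mult right_diff_distrib[symmetric])
      qed (auto intro!: int Cn.prob_space_axioms)
      then show "norm (An' n - An n - 0) < e" using e by simp
    qed
  qed
  from tendsto_add[OF this An] have An': "An' \<longlonglongrightarrow> A" by simp
  have step: "(\<integral>\<omega>. (\<Prod>i\<le>Suc j. g i (u i \<omega>)) \<partial>N) = r * (\<integral>\<omega>. (\<Prod>i\<le>j. g i (u i \<omega>)) * ?g (Upsilon qs j (u j \<omega>)) \<partial>N)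
      + (1 - r) * (\<integral>\<omega>. (\<Prod>i\<le>j. g i (u i \<omega>)) \<partial>N) * (\<integral>x. ?g x \<partial>qs (Suc j))"
    if "lazy_chain N r qs u" for N :: "'a measure" and r qs u
  proof -
    interpret lazy_chain N r qs u by fact
    show ?thesis
      using expectation_transition[OF \<Phi>_measurable nice_fun_measurable[OF Suc.prems] \<Phi> B(1) B(2)]
      by (simp add: \<Phi>_restrict)
  qed
  have "(\<lambda>n. \<integral>x. ?g x \<partial>psn n (Suc j)) \<longlonglongrightarrow> (\<integral>x. ?g x \<partial>ps (Suc j))"
    using conv_ps[of "Suc j"] Suc.prems[of "Suc j"] by (simp add: weak_conv_meas_def nice_fun_def)
  then show ?case
    unfolding step[OF C] step[OF Cn] A_def[symmetric] An'_def[symmetric]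
    by (intro tendsto_intros conv_rho An' Suc.IH Suc.prems)
qed

text \<open>The case of \<open>joint_weak_convergence\<close> in which the first sequence is
  identically 0, so that its test function is a constant factor.\<close>

lemma lazy_chain_weak_convergence:
  fixes M :: "'a measure" and Mn :: "nat \<Rightarrow> 'a measure" and h :: "(nat \<Rightarrow> real) \<Rightarrow> real"
  assumes C: "lazy_chain M \<rho> ps v" and Cn: "\<And>n. lazy_chain (Mn n) (\<rho>n n) (psn n) (vn n)"
    and conv_rho: "\<rho>n \<longlonglongrightarrow> \<rho>" and conv_ps: "\<And>j. weak_conv_meas (\<lambda>n. psn n j) (ps j)"
    and h: "continuous_on UNIV h"
  shows "(\<lambda>n. \<integral>\<omega>. h (\<lambda>i. vn n i \<omega>) \<partial>Mn n) \<longlonglongrightarrow> (\<integral>\<omega>. h (\<lambda>i. v i \<omega>) \<partial>M)"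
proof -
  interpret C: lazy_chain M \<rho> ps v by fact
  interpret Cn: lazy_chain "Mn n" "\<rho>n n" "psn n" "vn n" for n by (rule Cn)
  have "(\<lambda>n. \<integral>\<omega>. (h \<circ> snd) (\<lambda>i::nat. 0::real, \<lambda>i. vn n i \<omega>) \<partial>Mn n) \<longlonglongrightarrow> (\<integral>\<omega>. (h \<circ> snd) (\<lambda>i::nat. 0::real, \<lambda>i. v i \<omega>) \<partial>M)"
  proof (rule joint_weak_convergence[where a=0 and b=1 and X="\<lambda>_ _. 0" and Xn="\<lambda>_ _ _. 0" and h="h \<circ> snd"])
    fix f :: "(nat \<Rightarrow> real) \<Rightarrow> real" and k :: nat and g :: "nat \<Rightarrow> real \<Rightarrow> real"
    assume g: "\<And>i. nice_fun (g i)"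
    have "(\<lambda>n. \<integral>\<omega>. (\<Prod>i<k. g i (vn n i \<omega>)) \<partial>Mn n) \<longlonglongrightarrow> (\<integral>\<omega>. (\<Prod>i<k. g i (v i \<omega>)) \<partial>M)"
    proof (cases k)
      case 0
      then show ?thesis by (simp add: C.prob_space Cn.prob_space)
    next
      case (Suc j)
      then show ?thesis
        using lazy_chain_product_convergence[OF C Cn conv_rho conv_ps g, where j=j] by (simp only: lessThan_Suc_atMost)
    qed
    then show "(\<lambda>n. \<integral>\<omega>. f (\<lambda>i. 0) * (\<Prod>i<k. g i (vn n i \<omega>)) \<partial>Mn n) \<longlonglongrightarrow> (\<integral>\<omega>. f (\<lambda>i. 0) * (\<Prod>i<k. g i (v i \<omega>)) \<partial>M)"
      by (simp add: tendsto_mult_left)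
  next
    show "continuous_on UNIV (h \<circ> snd)"
      by (intro continuous_on_compose continuous_on_snd continuous_on_id continuous_on_subset[OF h]) auto
    show "AE \<omega> in M. \<forall>i. 0 \<in> {0..1::real} \<and> v i \<omega> \<in> {0..1}"
      using C.AE_v_mem by (auto simp: AE_all_countable)
    show "AE \<omega> in Mn n. \<forall>i. 0 \<in> {0..1::real} \<and> vn n i \<omega> \<in> {0..1}" for n
      using Cn.AE_v_mem by (auto simp: AE_all_countable)
  qed (auto intro: C.prob_space_axioms Cn.prob_space_axioms)
  then show ?thesis by simp
qed

section \<open>Continuity of the weights and truncation of the random series\<close>

lemma continuous_sb_weights: "continuous_on UNIV sb_weights"
  unfolding sb_weights_def
  by (intro continuous_on_coordinatewise_then_product continuous_intros continuous_on_product_coordinates)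

text \<open>If the discarded part of the series is below \<delta>, uniform continuity of h gives
  \<epsilon>. Otherwise \<delta> is at most B R, with R the remaining mass, so the crude bound
  \<open>2 * H\<close> is at most \<open>2 * H * B * R / \<delta>\<close>. Thus the error depends on
  the tail only through the expectation of R.\<close>

lemma truncation_error:
  fixes W Y :: "nat \<Rightarrow> 'a \<Rightarrow> real" and h :: "real \<Rightarrow> real"
  assumes M: "prob_space M" and W [measurable]: "\<And>i. W i \<in> borel_measurable M" and Y [measurable]: "\<And>i. Y i \<in> borel_measurable M"
    and sum1: "AE \<omega> in M. (\<forall>j. 0 \<le> W j \<omega>) \<and> (\<lambda>j. W j \<omega>) sums 1"
    and B: "\<And>j \<omega>. \<bar>Y j \<omega>\<bar> \<le> B" and h [measurable]: "h \<in> borel_measurable borel" and H: "\<And>x. \<bar>h x\<bar> \<le> H"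
    and \<delta>: "0 < \<delta>" "\<And>s t. \<bar>s\<bar> \<le> B \<Longrightarrow> \<bar>t\<bar> \<le> B \<Longrightarrow> \<bar>s - t\<bar> < \<delta> \<Longrightarrow> \<bar>h s - h t\<bar> \<le> \<epsilon>" and \<epsilon>: "0 \<le> \<epsilon>"
  shows "\<bar>(\<integral>\<omega>. h (\<Sum>j. W j \<omega> * Y j \<omega>) \<partial>M) - (\<integral>\<omega>. h (\<Sum>j<k. W j \<omega> * Y j \<omega>) \<partial>M)\<bar>
    \<le> \<epsilon> + 2 * H * B / \<delta> * (\<integral>\<omega>. 1 - (\<Sum>j<k. W j \<omega>) \<partial>M)"
proof -
  interpret prob_space M by fact
  have B0: "0 \<le> B" using B[of undefined undefined] by linarith
  have H0: "0 \<le> H" using H[of 0] by linarith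
  let ?R = "\<lambda>\<omega>. 1 - (\<Sum>j<k. W j \<omega>)"
  have key: "AE \<omega> in M. 0 \<le> ?R \<omega> \<and> ?R \<omega> \<le> 1 \<and>
      \<bar>h (\<Sum>j. W j \<omega> * Y j \<omega>) - h (\<Sum>j<k. W j \<omega> * Y j \<omega>)\<bar> \<le> \<epsilon> + 2 * H * B / \<delta> * ?R \<omega>"
    using sum1
  proof eventually_elim
    case (elim \<omega>)
    let ?S = "\<Sum>j. W j \<omega> * Y j \<omega>" and ?T = "\<Sum>j<k. W j \<omega> * Y j \<omega>"
    have sW: "summable (\<lambda>j. W j \<omega>)" "(\<Sum>j. W j \<omega>) = 1" using elim by (auto simp: sums_iff)
    have le: "norm (W j \<omega> * Y j \<omega>) \<le> B * W j \<omega>" for j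
      using elim mult_left_mono[OF B[of j \<omega>], of "W j \<omega>"] by (simp add: abs_mult mult.commute)
    have sBW: "summable (\<lambda>j. B * W j \<omega>)" using sW by (intro summable_mult)
    have sN: "summable (\<lambda>j. norm (W j \<omega> * Y j \<omega>))"
      by (rule summable_comparison_test'[OF sBW, of 0]) (use le in auto)
    have s: "summable (\<lambda>j. W j \<omega> * Y j \<omega>)" using sN by (rule summable_norm_cancel)
    have R: "?R \<omega> = (\<Sum>j. W (j + k) \<omega>)"
      using suminf_minus_initial_segment[OF sW(1), of k] sW(2) by simp
    have shift: "summable (\<lambda>j. W (j + k) \<omega>)" "summable (\<lambda>j. B * W (j + k) \<omega>)" "summable (\<lambda>j. norm (W (j + k) \<omega> * Y (j + k) \<omega>))"
      using sW(1) sBW sN summable_iff_shift[of "\<lambda>j. W j \<omega>" k] summable_iff_shift[of "\<lambda>j. B * W j \<omega>" k]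
        summable_iff_shift[of "\<lambda>j. norm (W j \<omega> * Y j \<omega>)" k] by simp_all
    have R0: "0 \<le> ?R \<omega>" unfolding R using elim shift(1) by (intro suminf_nonneg) auto
    have R1: "?R \<omega> \<le> 1" using elim by (simp add: sum_nonneg)
    have "?S - ?T = (\<Sum>j. W (j + k) \<omega> * Y (j + k) \<omega>)"
      using suminf_minus_initial_segment[OF s, of k] by simp
    also have "\<bar>\<dots>\<bar> \<le> (\<Sum>j. norm (W (j + k) \<omega> * Y (j + k) \<omega>))"
      using summable_norm[of "\<lambda>j. W (j + k) \<omega> * Y (j + k) \<omega>"] shift(3) by simp
    also have "\<dots> \<le> (\<Sum>j. B * W (j + k) \<omega>)"
      by (intro suminf_le le shift)
    also have "\<dots> = B * ?R \<omega>"
      unfolding R by (intro suminf_mult shift)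
    finally have ST: "\<bar>?S - ?T\<bar> \<le> B * ?R \<omega>" .
    have "\<bar>?S\<bar> \<le> (\<Sum>j. norm (W j \<omega> * Y j \<omega>))" using summable_norm[OF sN] by simp
    also have "\<dots> \<le> (\<Sum>j. B * W j \<omega>)" by (intro suminf_le le sN sBW)
    also have "\<dots> = B" using sW by (subst suminf_mult) auto
    finally have S: "\<bar>?S\<bar> \<le> B" .
    have "\<bar>?T\<bar> \<le> (\<Sum>j<k. norm (W j \<omega> * Y j \<omega>))" by (simp add: sum_abs)
    also have "\<dots> \<le> (\<Sum>j<k. B * W j \<omega>)" by (intro sum_mono le)
    also have "\<dots> = B * (1 - ?R \<omega>)" by (simp add: sum_distrib_left)
    also have "\<dots> \<le> B * 1" using B0 R0 by (intro mult_left_mono) auto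
    finally have T: "\<bar>?T\<bar> \<le> B" by simp
    have "\<bar>h ?S - h ?T\<bar> \<le> \<epsilon> + 2 * H * B / \<delta> * ?R \<omega>"
    proof (cases "\<bar>?S - ?T\<bar> < \<delta>")
      case True
      have "0 \<le> 2 * H * B / \<delta> * ?R \<omega>" using H0 B0 R0 \<delta>(1) by simp
      with \<delta>(2)[OF S T True] show ?thesis by linarith
    next
      case False
      have "\<bar>h ?S - h ?T\<bar> \<le> 2 * H * 1" using H[of ?S] H[of ?T] by linarith
      also have "\<dots> \<le> 2 * H * (B * ?R \<omega> / \<delta>)"
        using False ST \<delta>(1) H0 by (intro mult_left_mono) (auto simp: pos_le_divide_eq)
      finally show ?thesis using \<epsilon> by (simp add: ac_simps)
    qed
    with R0 R1 show ?case by simp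
  qed
  have intR: "integrable M ?R"
    using key by (intro integrable_const_bound[of _ 1], eventually_elim) auto
  have int1: "integrable M (\<lambda>\<omega>. h (\<Sum>j. W j \<omega> * Y j \<omega>))" and int2: "integrable M (\<lambda>\<omega>. h (\<Sum>j<k. W j \<omega> * Y j \<omega>))"
    using H by (auto intro!: integrable_const_bound[of _ H])
  have "\<bar>(\<integral>\<omega>. h (\<Sum>j. W j \<omega> * Y j \<omega>) \<partial>M) - (\<integral>\<omega>. h (\<Sum>j<k. W j \<omega> * Y j \<omega>) \<partial>M)\<bar>
      = \<bar>\<integral>\<omega>. h (\<Sum>j. W j \<omega> * Y j \<omega>) - h (\<Sum>j<k. W j \<omega> * Y j \<omega>) \<partial>M\<bar>"
    using int1 int2 by simp
  also have "\<dots> \<le> (\<integral>\<omega>. \<bar>h (\<Sum>j. W j \<omega> * Y j \<omega>) - h (\<Sum>j<k. W j \<omega> * Y j \<omega>)\<bar> \<partial>M)"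
    by (rule integral_abs_bound)
  also have "\<dots> \<le> (\<integral>\<omega>. \<epsilon> + 2 * H * B / \<delta> * ?R \<omega> \<partial>M)"
  proof (rule integral_mono_AE)
    show "integrable M (\<lambda>\<omega>. \<bar>h (\<Sum>j. W j \<omega> * Y j \<omega>) - h (\<Sum>j<k. W j \<omega> * Y j \<omega>)\<bar>)"
      by (intro integrable_abs Bochner_Integration.integrable_diff int1 int2)
    show "integrable M (\<lambda>\<omega>. \<epsilon> + 2 * H * B / \<delta> * ?R \<omega>)"
      by (intro Bochner_Integration.integrable_add integrable_const integrable_mult_right intR)
    show "AE \<omega> in M. \<bar>h (\<Sum>j. W j \<omega> * Y j \<omega>) - h (\<Sum>j<k. W j \<omega> * Y j \<omega>)\<bar> \<le> \<epsilon> + 2 * H * B / \<delta> * ?R \<omega>"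
      using key by eventually_elim simp
  qed
  also have "\<dots> = \<epsilon> + 2 * H * B / \<delta> * (\<integral>\<omega>. ?R \<omega> \<partial>M)"
    by (subst Bochner_Integration.integral_add) (simp_all only: integrable_const integrable_mult_right[OF intR] integral_mult_right_zero, simp add: prob_space)
  finally show ?thesis .
qed

lemma expected_remainder_tendsto_0:
  fixes W :: "nat \<Rightarrow> 'a \<Rightarrow> real"
  assumes M: "prob_space M" and W [measurable]: "\<And>i. W i \<in> borel_measurable M"
    and sum1: "AE \<omega> in M. (\<forall>j. 0 \<le> W j \<omega>) \<and> (\<lambda>j. W j \<omega>) sums 1"
  shows "(\<lambda>k. \<integral>\<omega>. 1 - (\<Sum>j<k. W j \<omega>) \<partial>M) \<longlonglongrightarrow> 0"
proof -
  interpret prob_space M by fact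
  have "(\<lambda>k. \<integral>\<omega>. 1 - (\<Sum>j<k. W j \<omega>) \<partial>M) \<longlonglongrightarrow> (\<integral>\<omega>. 0 \<partial>M)"
  proof (rule integral_dominated_convergence[where w="\<lambda>_. 1"])
    show "AE \<omega> in M. (\<lambda>k. 1 - (\<Sum>j<k. W j \<omega>)) \<longlonglongrightarrow> 0"
      using sum1
    proof eventually_elim
      case (elim \<omega>)
      then have "(\<lambda>k. 1 - (\<Sum>j<k. W j \<omega>)) \<longlonglongrightarrow> 1 - 1" unfolding sums_def by (intro tendsto_intros) auto
      then show ?case by simp
    qed
    show "AE \<omega> in M. norm (1 - (\<Sum>j<k. W j \<omega>)) \<le> 1" for k
      using sum1
    proof eventually_elim
      case (elim \<omega>)
      have "(\<Sum>j<k. W j \<omega>) \<le> 1"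
        using sum_le_suminf[of "\<lambda>j. W j \<omega>" "{..<k}"] elim by (auto simp: sums_iff)
      moreover have "0 \<le> (\<Sum>j<k. W j \<omega>)" using elim by (auto intro: sum_nonneg)
      ultimately show ?case by simp
    qed
  qed auto
  then show ?thesis by simp
qed

text \<open>The interchange of the two limits: k is fixed from the limiting weights, and convergence
  of the expected remainder at this fixed k transfers the smallness to all large n.\<close>

lemma weighted_series_weak_convergence:
  fixes M :: "'a measure" and W Y :: "nat \<Rightarrow> 'a \<Rightarrow> real" and Mn :: "nat \<Rightarrow> 'a measure"
    and Wn Yn :: "nat \<Rightarrow> nat \<Rightarrow> 'a \<Rightarrow> real" and h :: "real \<Rightarrow> real"
  assumes M: "prob_space M" "\<And>i. W i \<in> borel_measurable M" "\<And>i. Y i \<in> borel_measurable M"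
      "AE \<omega> in M. (\<forall>j. 0 \<le> W j \<omega>) \<and> (\<lambda>j. W j \<omega>) sums 1" "\<And>j \<omega>. \<bar>Y j \<omega>\<bar> \<le> B"
    and Mn: "\<And>n. prob_space (Mn n)" "\<And>n i. Wn n i \<in> borel_measurable (Mn n)" "\<And>n i. Yn n i \<in> borel_measurable (Mn n)"
      "\<And>n. AE \<omega> in Mn n. (\<forall>j. 0 \<le> Wn n j \<omega>) \<and> (\<lambda>j. Wn n j \<omega>) sums 1" "\<And>n j \<omega>. \<bar>Yn n j \<omega>\<bar> \<le> B"
    and conv: "\<And>\<phi> :: (nat \<Rightarrow> real) \<times> (nat \<Rightarrow> real) \<Rightarrow> real. continuous_on UNIV \<phi> \<Longrightarrow>
      (\<lambda>n. \<integral>\<omega>. \<phi> (\<lambda>i. Wn n i \<omega>, \<lambda>i. Yn n i \<omega>) \<partial>Mn n) \<longlonglongrightarrow> (\<integral>\<omega>. \<phi> (\<lambda>i. W i \<omega>, \<lambda>i. Y i \<omega>) \<partial>M)"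
    and h: "continuous_on UNIV h" "bounded (range h)"
  shows "(\<lambda>n. \<integral>\<omega>. h (\<Sum>j. Wn n j \<omega> * Yn n j \<omega>) \<partial>Mn n) \<longlonglongrightarrow> (\<integral>\<omega>. h (\<Sum>j. W j \<omega> * Y j \<omega>) \<partial>M)"
proof (rule LIMSEQ_I)
  fix e :: real assume e: "0 < e"
  have h_meas: "h \<in> borel_measurable borel" using h(1) by (rule borel_measurable_continuous_onI)
  obtain H where H: "\<And>x. \<bar>h x\<bar> \<le> H" using h(2) by (auto simp: bounded_iff)
  have H0: "0 \<le> H" using H[of 0] by linarith
  have B0: "0 \<le> B" using M(5)[of undefined undefined] by linarith
  have coord: "continuous_on UNIV (\<lambda>z :: (nat \<Rightarrow> real) \<times> (nat \<Rightarrow> real). fst z i)"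
    "continuous_on UNIV (\<lambda>z :: (nat \<Rightarrow> real) \<times> (nat \<Rightarrow> real). snd z i)" for i
    by (rule continuous_on_product_then_coordinatewise, intro continuous_intros)+
  have "uniformly_continuous_on {-B..B} h"
    using h(1) by (intro compact_uniformly_continuous) (auto intro: continuous_on_subset)
  then obtain \<delta> where \<delta>: "0 < \<delta>" "\<And>s t. s \<in> {-B..B} \<Longrightarrow> t \<in> {-B..B} \<Longrightarrow> dist s t < \<delta> \<Longrightarrow> dist (h s) (h t) < e / 8"
    unfolding uniformly_continuous_on_def using e by (metis zero_less_divide_iff zero_less_numeral)
  have \<delta>': "\<bar>h s - h t\<bar> \<le> e / 8" if "\<bar>s\<bar> \<le> B" "\<bar>t\<bar> \<le> B" "\<bar>s - t\<bar> < \<delta>" for s t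
    using \<delta>(2)[of s t] that by (auto simp: dist_real_def abs_le_iff)
  let ?c = "2 * H * B / \<delta>"
  have c: "0 \<le> ?c" using H0 B0 \<delta>(1) by simp
  have "(\<lambda>k. ?c * (\<integral>\<omega>. 1 - (\<Sum>j<k. W j \<omega>) \<partial>M)) \<longlonglongrightarrow> ?c * 0"
    by (intro tendsto_mult_left expected_remainder_tendsto_0 M)
  from order_tendstoD(2)[OF this, of "e / 8"] e
  have "\<forall>\<^sub>F k in sequentially. ?c * (\<integral>\<omega>. 1 - (\<Sum>j<k. W j \<omega>) \<partial>M) < e / 8" by simp
  from eventually_happens'[OF sequentially_bot this]
  obtain k where k: "?c * (\<integral>\<omega>. 1 - (\<Sum>j<k. W j \<omega>) \<partial>M) < e / 8" ..
  \<comment> \<open>The remaining mass is continuous but unbounded as a function on sequence space,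
    which is why \<open>conv\<close> is stated for all continuous test functions.\<close>
  have "(\<lambda>n. ?c * (\<integral>\<omega>. 1 - (\<Sum>j<k. Wn n j \<omega>) \<partial>Mn n)) \<longlonglongrightarrow> ?c * (\<integral>\<omega>. 1 - (\<Sum>j<k. W j \<omega>) \<partial>M)"
    using conv[of "\<lambda>z. 1 - (\<Sum>j<k. fst z j)"] by (intro tendsto_mult_left) (simp add: continuous_intros coord)
  from order_tendstoD(2)[OF this k]
  have ev1: "\<forall>\<^sub>F n in sequentially. ?c * (\<integral>\<omega>. 1 - (\<Sum>j<k. Wn n j \<omega>) \<partial>Mn n) < e / 8" .
  have "continuous_on UNIV (\<lambda>z :: (nat \<Rightarrow> real) \<times> (nat \<Rightarrow> real). h (\<Sum>j<k. fst z j * snd z j))"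
    by (intro continuous_on_compose2[OF h(1)] continuous_intros coord) auto
  from conv[OF this] have "(\<lambda>n. \<integral>\<omega>. h (\<Sum>j<k. Wn n j \<omega> * Yn n j \<omega>) \<partial>Mn n) \<longlonglongrightarrow> (\<integral>\<omega>. h (\<Sum>j<k. W j \<omega> * Y j \<omega>) \<partial>M)"
    by simp
  then have ev2: "\<forall>\<^sub>F n in sequentially. dist (\<integral>\<omega>. h (\<Sum>j<k. Wn n j \<omega> * Yn n j \<omega>) \<partial>Mn n) (\<integral>\<omega>. h (\<Sum>j<k. W j \<omega> * Y j \<omega>) \<partial>M) < e / 4"
    using e by (intro tendstoD) auto
  have e8: "0 \<le> e / 8" using e by simp
  \<comment> \<open>The budget: each truncation costs less than e/8 + e/8 and the truncated
    expectations differ by less than e/4, which is below 3e/4 in total.\<close>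
  from ev1 ev2 have "\<forall>\<^sub>F n in sequentially. norm ((\<integral>\<omega>. h (\<Sum>j. Wn n j \<omega> * Yn n j \<omega>) \<partial>Mn n) - (\<integral>\<omega>. h (\<Sum>j. W j \<omega> * Y j \<omega>) \<partial>M)) < e"
  proof eventually_elim
    case (elim n)
    have 1: "\<bar>(\<integral>\<omega>. h (\<Sum>j. W j \<omega> * Y j \<omega>) \<partial>M) - (\<integral>\<omega>. h (\<Sum>j<k. W j \<omega> * Y j \<omega>) \<partial>M)\<bar> \<le> e / 8 + ?c * (\<integral>\<omega>. 1 - (\<Sum>j<k. W j \<omega>) \<partial>M)"
      by (rule truncation_error[OF M(1-5) h_meas H \<delta>(1) \<delta>' e8])
    have 2: "\<bar>(\<integral>\<omega>. h (\<Sum>j. Wn n j \<omega> * Yn n j \<omega>) \<partial>Mn n) - (\<integral>\<omega>. h (\<Sum>j<k. Wn n j \<omega> * Yn n j \<omega>) \<partial>Mn n)\<bar>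
        \<le> e / 8 + ?c * (\<integral>\<omega>. 1 - (\<Sum>j<k. Wn n j \<omega>) \<partial>Mn n)"
      by (rule truncation_error[OF Mn(1-5) h_meas H \<delta>(1) \<delta>' e8])
    show ?case
      using 1 2 elim k e unfolding dist_real_def real_norm_def by linarith
  qed
  then show "\<exists>N. \<forall>n\<ge>N. norm ((\<integral>\<omega>. h (\<Sum>j. Wn n j \<omega> * Yn n j \<omega>) \<partial>Mn n) - (\<integral>\<omega>. h (\<Sum>j. W j \<omega> * Y j \<omega>) \<partial>M)) < e"
    by (simp add: eventually_sequentially)
qed

section \<open>Application to proper stick-breaking processes\<close>

lemma proper_lazy_MSB_chain:
  assumes "proper_lazy_MSB M \<rho> ps P0 v \<theta>" "\<rho> \<in> {0..1}" "\<And>j. admissible_len (ps j)"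
  shows "lazy_chain M \<rho> ps v"
  using assms unfolding proper_lazy_MSB_def
  by (auto intro!: lazy_chain.intro lazy_chain_axioms.intro)

lemma proper_lazy_MSB_weights:
  assumes P: "proper_lazy_MSB M \<rho> ps P0 v \<theta>" "\<rho> \<in> {0..1}" "\<And>j. admissible_len (ps j)"
  shows "(\<lambda>\<omega>. sb_weights (\<lambda>i. v i \<omega>) j) \<in> borel_measurable M"
    and "AE \<omega> in M. (\<forall>j. 0 \<le> sb_weights (\<lambda>i. v i \<omega>) j) \<and> (\<lambda>j. sb_weights (\<lambda>i. v i \<omega>) j) sums 1"
proof -
  interpret lazy_chain M \<rho> ps v by (rule proper_lazy_MSB_chain[OF P])
  show "(\<lambda>\<omega>. sb_weights (\<lambda>i. v i \<omega>) j) \<in> borel_measurable M"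
    unfolding sb_weights_def by measurable
  have "AE \<omega> in M. \<forall>j. v j \<omega> \<in> {0..1}" using AE_v_mem by (simp add: AE_all_countable)
  moreover have "AE \<omega> in M. (\<lambda>j. sb_weights (\<lambda>i. v i \<omega>) j) sums 1" using P(1) by (simp add: proper_lazy_MSB_def)
  ultimately show "AE \<omega> in M. (\<forall>j. 0 \<le> sb_weights (\<lambda>i. v i \<omega>) j) \<and> (\<lambda>j. sb_weights (\<lambda>i. v i \<omega>) j) sums 1"
    by eventually_elim (auto intro!: sb_weights_nonneg)
qed

text \<open>The atoms are assumed independent of the weights, not of the lengths, so the first test
  function has to be a function of the weights. Independence among the atoms then factorises the
  rest.\<close>

lemma proper_lazy_MSB_expectation:
  fixes \<theta> :: "nat \<Rightarrow> 'a \<Rightarrow> 'x::topological_space" and f :: "(nat \<Rightarrow> real) \<Rightarrow> real" and \<phi> :: "'x \<Rightarrow> real"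
  assumes P: "proper_lazy_MSB M \<rho> ps P0 v \<theta>" and P0: "sets P0 = sets borel"
    and f: "continuous_on UNIV f" "bounded (range f)" and \<phi>: "continuous_on UNIV \<phi>" and g: "\<And>i. nice_fun (g i)"
  shows "(\<integral>\<omega>. f (\<lambda>j. sb_weights (\<lambda>i. v i \<omega>) j) * (\<Prod>i<k. g i (\<phi> (\<theta> i \<omega>))) \<partial>M) =
    (\<integral>\<omega>. f (\<lambda>j. sb_weights (\<lambda>i. v i \<omega>) j) \<partial>M) * (\<Prod>i<k. \<integral>x. g i (\<phi> x) \<partial>P0)"
proof -
  interpret prob_space M using P by (simp add: proper_lazy_MSB_def)
  let ?W = "\<lambda>\<omega> j. sb_weights (\<lambda>i. v i \<omega>) j" and ?T = "\<lambda>\<omega> j. \<theta> j \<omega>"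
  let ?S = "PiM UNIV (\<lambda>_. borel) :: (nat \<Rightarrow> real) measure" and ?S' = "PiM UNIV (\<lambda>_. borel) :: (nat \<Rightarrow> 'x) measure"
  have [measurable]: "v j \<in> borel_measurable M" "\<theta> j \<in> measurable M borel" for j
    using P by (auto simp: proper_lazy_MSB_def)
  have W [measurable]: "?W \<in> measurable M ?S"
    by (rule measurable_PiM_single') (auto simp: sb_weights_def space_PiM)
  have T [measurable]: "?T \<in> measurable M ?S'"
    by (rule measurable_PiM_single') (auto simp: space_PiM)
  have [measurable]: "\<phi> \<in> borel_measurable borel" "g i \<in> borel_measurable borel" for i
    using \<phi> g by (auto intro: borel_measurable_continuous_onI nice_fun_measurable)
  have f_meas [measurable]: "f \<in> borel_measurable ?S"
    using borel_measurable_continuous_onI[OF f(1)] by (simp add: measurable_cong_sets[OF sets_PiM_equal_borel refl])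
  define G where "G t = (\<Prod>i<k. g i (\<phi> (t i)))" for t
  have G_meas [measurable]: "G \<in> borel_measurable ?S'" unfolding G_def by measurable
  have "distr M borel (\<lambda>\<omega>. G (?T \<omega>)) \<Otimes>\<^sub>M distr M borel (\<lambda>\<omega>. f (?W \<omega>)) = distr M (borel \<Otimes>\<^sub>M borel) (\<lambda>\<omega>. (G (?T \<omega>), f (?W \<omega>)))"
  proof (rule pair_measure_eqI)
    show "sigma_finite_measure (distr M borel (\<lambda>\<omega>. G (?T \<omega>)))" "sigma_finite_measure (distr M borel (\<lambda>\<omega>. f (?W \<omega>)))"
      by (intro prob_space_imp_sigma_finite prob_space_distr; measurable)+
    fix A B assume "A \<in> sets (distr M borel (\<lambda>\<omega>. G (?T \<omega>)))" "B \<in> sets (distr M borel (\<lambda>\<omega>. f (?W \<omega>)))"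
    then have A: "A \<in> sets borel" and B: "B \<in> sets borel" by simp_all
    have "G -` A \<in> sets ?S'" "f -` B \<in> sets ?S"
      using measurable_sets[OF G_meas A] measurable_sets[OF f_meas B] by (simp_all add: space_PiM)
    then have "measure M {\<omega> \<in> space M. ?T \<omega> \<in> G -` A \<and> ?W \<omega> \<in> f -` B} = measure M {\<omega> \<in> space M. ?T \<omega> \<in> G -` A} * measure M {\<omega> \<in> space M. ?W \<omega> \<in> f -` B}"
      using P unfolding proper_lazy_MSB_def by blast
    moreover have "(\<lambda>\<omega>. G (?T \<omega>)) -` A \<inter> space M = {\<omega> \<in> space M. ?T \<omega> \<in> G -` A}" "(\<lambda>\<omega>. f (?W \<omega>)) -` B \<inter> space M = {\<omega> \<in> space M. ?W \<omega> \<in> f -` B}"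
      "(\<lambda>\<omega>. (G (?T \<omega>), f (?W \<omega>))) -` (A \<times> B) \<inter> space M = {\<omega> \<in> space M. ?T \<omega> \<in> G -` A \<and> ?W \<omega> \<in> f -` B}"
      by auto
    ultimately show "emeasure (distr M borel (\<lambda>\<omega>. G (?T \<omega>))) A * emeasure (distr M borel (\<lambda>\<omega>. f (?W \<omega>))) B
        = emeasure (distr M (borel \<Otimes>\<^sub>M borel) (\<lambda>\<omega>. (G (?T \<omega>), f (?W \<omega>)))) (A \<times> B)"
      using A B by (simp add: emeasure_distr emeasure_eq_measure ennreal_mult')
  qed simp
  then have ind: "indep_var borel (\<lambda>\<omega>. G (?T \<omega>)) borel (\<lambda>\<omega>. f (?W \<omega>))"
    by (simp add: indep_var_distribution_eq)
  have "\<exists>b. \<forall>i. \<forall>x. 0 \<le> g i x \<and> g i x \<le> b i"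
    by (intro choice allI nice_fun_bounds g)
  then obtain b where b: "\<And>i x. 0 \<le> g i x" "\<And>i x. g i x \<le> b i" by blast
  obtain c where c: "\<And>x. \<bar>f x\<bar> \<le> c" using f(2) by (auto simp: bounded_iff)
  have intG: "integrable M (\<lambda>\<omega>. G (?T \<omega>))"
  proof (rule integrable_const_bound)
    show "AE \<omega> in M. norm (G (?T \<omega>)) \<le> (\<Prod>i<k. b i)"
      unfolding G_def real_norm_def abs_prod using b by (intro AE_I2 prod_mono) auto
  qed measurable
  have intF: "integrable M (\<lambda>\<omega>. f (?W \<omega>))"
    using c by (intro integrable_const_bound[of _ c]) auto
  have "(\<integral>\<omega>. f (?W \<omega>) * G (?T \<omega>) \<partial>M) = (\<integral>\<omega>. f (?W \<omega>) \<partial>M) * (\<integral>\<omega>. G (?T \<omega>) \<partial>M)"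
    using indep_var_lebesgue_integral[OF ind intG intF] by (simp add: comp_def mult.commute)
  also have "(\<integral>\<omega>. G (?T \<omega>) \<partial>M) = (\<Prod>i<k. \<integral>\<omega>. g i (\<phi> (\<theta> i \<omega>)) \<partial>M)"
    unfolding G_def
  proof (rule indep_vars_lebesgue_integral)
    have "indep_vars (\<lambda>_. borel) \<theta> UNIV" using P by (simp add: proper_lazy_MSB_def)
    then show "indep_vars (\<lambda>_. borel) (\<lambda>i \<omega>. g i (\<phi> (\<theta> i \<omega>))) {..<k}"
      by (intro indep_vars_compose2[where M'="\<lambda>_. borel" and Y="\<lambda>i x. g i (\<phi> x)"]) (auto intro: indep_vars_subset)
    show "integrable M (\<lambda>\<omega>. g i (\<phi> (\<theta> i \<omega>)))" for i
      using b by (intro integrable_const_bound[of _ "b i"]) auto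
  qed simp
  finally have "(\<integral>\<omega>. f (?W \<omega>) * G (?T \<omega>) \<partial>M) = (\<integral>\<omega>. f (?W \<omega>) \<partial>M) * (\<Prod>i<k. \<integral>\<omega>. g i (\<phi> (\<theta> i \<omega>)) \<partial>M)" .
  moreover have "(\<integral>\<omega>. g i (\<phi> (\<theta> i \<omega>)) \<partial>M) = (\<integral>x. g i (\<phi> x) \<partial>P0)" for i
  proof -
    have "distr M borel (\<theta> i) = P0" using P by (simp add: proper_lazy_MSB_def)
    then show ?thesis by (auto simp: integral_distr)
  qed
  ultimately show ?thesis by (simp add: G_def)
qed

lemma sb_integral_measurable:
  fixes \<theta> :: "nat \<Rightarrow> 'a \<Rightarrow> 'x::topological_space"
  assumes P: "proper_lazy_MSB M \<rho> ps P0 v \<theta>" and f: "continuous_on UNIV f"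
  shows "sb_integral v \<theta> P0 f \<in> borel_measurable M"
proof -
  have [measurable]: "v j \<in> borel_measurable M" "\<theta> j \<in> measurable M borel" for j
    using P by (auto simp: proper_lazy_MSB_def)
  have [measurable]: "f \<in> borel_measurable borel" using f by (rule borel_measurable_continuous_onI)
  show ?thesis unfolding sb_integral_def[abs_def] sb_weights_def by measurable
qed

text \<open>Properness removes the \<open>P0\<close> term almost surely, which leaves a plain series
  of weights times values at the atoms.\<close>

lemma integral_distr_sb_integral:
  fixes \<theta> :: "nat \<Rightarrow> 'a \<Rightarrow> 'x::topological_space" and h :: "real \<Rightarrow> real"
  assumes P: "proper_lazy_MSB M \<rho> ps P0 v \<theta>" and f: "continuous_on UNIV f" and h [measurable]: "h \<in> borel_measurable borel"
  shows "(\<integral>x. h x \<partial>distr M borel (sb_integral v \<theta> P0 f)) = (\<integral>\<omega>. h (\<Sum>j. sb_weights (\<lambda>i. v i \<omega>) j * f (\<theta> j \<omega>)) \<partial>M)"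
proof -
  have [measurable]: "v j \<in> borel_measurable M" "\<theta> j \<in> measurable M borel" for j
    using P by (auto simp: proper_lazy_MSB_def)
  have [measurable]: "f \<in> borel_measurable borel" using f by (rule borel_measurable_continuous_onI)
  note [measurable] = sb_integral_measurable[OF P f]
  have "AE \<omega> in M. (\<lambda>j. sb_weights (\<lambda>i. v i \<omega>) j) sums 1" using P by (simp add: proper_lazy_MSB_def)
  then have AE: "AE \<omega> in M. h (sb_integral v \<theta> P0 f \<omega>) = h (\<Sum>j. sb_weights (\<lambda>i. v i \<omega>) j * f (\<theta> j \<omega>))"
    by eventually_elim (simp add: sb_integral_def sums_iff)
  have "(\<integral>x. h x \<partial>distr M borel (sb_integral v \<theta> P0 f)) = (\<integral>\<omega>. h (sb_integral v \<theta> P0 f \<omega>) \<partial>M)"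
    by (rule integral_distr) measurable
  also have "\<dots> = (\<integral>\<omega>. h (\<Sum>j. sb_weights (\<lambda>i. v i \<omega>) j * f (\<theta> j \<omega>)) \<partial>M)"
    by (rule integral_cong_AE[OF _ _ AE]) (simp_all add: sb_weights_def)
  finally show ?thesis .
qed

lemma proper_lazy_MSB_weights_convergence:
  fixes M :: "'a measure" and Mn :: "nat \<Rightarrow> 'a measure" and h :: "(nat \<Rightarrow> real) \<Rightarrow> real"
  assumes "lazy_chain M \<rho> ps v" and "\<And>n. lazy_chain (Mn n) (\<rho>n n) (psn n) (vn n)"
    and "\<rho>n \<longlonglongrightarrow> \<rho>" and "\<And>j. weak_conv_meas (\<lambda>n. psn n j) (ps j)"
    and h: "continuous_on UNIV h"
  shows "(\<lambda>n. \<integral>\<omega>. h (sb_weights (\<lambda>i. vn n i \<omega>)) \<partial>Mn n) \<longlonglongrightarrow> (\<integral>\<omega>. h (sb_weights (\<lambda>i. v i \<omega>)) \<partial>M)"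
  using lazy_chain_weak_convergence[OF assms(1-4), of "h \<circ> sb_weights"]
    continuous_on_compose[OF continuous_sb_weights continuous_on_subset[OF h]] by simp

text \<open>For fixed f the atoms enter only through the bounded reals
  \<open>f (\<theta> j)\<close>, so the question becomes one about two real sequences in a compact
  box.\<close>

lemma proper_lazy_MSB_convergence:
  fixes M :: "'a measure" and Mn :: "nat \<Rightarrow> 'a measure" and P0 :: "'x::topological_space measure"
    and f :: "'x \<Rightarrow> real"
  assumes rho: "\<rho> \<in> {0..1}" "\<And>n. \<rho>n n \<in> {0..1}"
    and adm: "\<And>j. admissible_len (ps j)" "\<And>n j. admissible_len (psn n j)"
    and P0: "sets P0 = sets borel" "\<And>n. sets (P0n n) = sets borel"
    and P: "proper_lazy_MSB M \<rho> ps P0 v \<theta>"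
    and Pn: "\<And>n. proper_lazy_MSB (Mn n) (\<rho>n n) (psn n) (P0n n) (vn n) (\<theta>n n)"
    and conv_rho: "\<rho>n \<longlonglongrightarrow> \<rho>" and conv_P0: "weak_conv_meas P0n P0"
    and conv_ps: "\<And>j. weak_conv_meas (\<lambda>n. psn n j) (ps j)"
    and f: "continuous_on UNIV f" "bounded (range f)"
  shows "weak_conv_meas (\<lambda>n. distr (Mn n) borel (sb_integral (vn n) (\<theta>n n) (P0n n) f)) (distr M borel (sb_integral v \<theta> P0 f))"
  unfolding weak_conv_meas_def
proof (intro allI impI)
  fix h :: "real \<Rightarrow> real" assume h: "continuous_on UNIV h" "bounded (range h)"
  have h_meas: "h \<in> borel_measurable borel" using h(1) by (rule borel_measurable_continuous_onI)
  obtain B0 where B0: "\<And>x. \<bar>f x\<bar> \<le> B0" using f(2) by (auto simp: bounded_iff)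
  \<comment> \<open>One box has to contain both the values of f and the weights, hence the maximum
    with 1.\<close>
  define B where "B = max 1 B0"
  have B: "\<bar>f x\<bar> \<le> B" "1 \<le> B" for x using B0[of x] by (auto simp: B_def)
  have chain: "lazy_chain M \<rho> ps v" and chain_n: "\<And>n. lazy_chain (Mn n) (\<rho>n n) (psn n) (vn n)"
    using proper_lazy_MSB_chain[OF P rho(1) adm(1)] proper_lazy_MSB_chain[OF Pn rho(2) adm(2)] by auto
  define W where "W j \<omega> = sb_weights (\<lambda>i. v i \<omega>) j" for j \<omega>
  define Wn where "Wn n j \<omega> = sb_weights (\<lambda>i. vn n i \<omega>) j" for n j \<omega>
  define Y where "Y j \<omega> = f (\<theta> j \<omega>)" for j \<omega>
  define Yn where "Yn n j \<omega> = f (\<theta>n n j \<omega>)" for n j \<omega>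
  have f_meas: "f \<in> borel_measurable borel" using f(1) by (rule borel_measurable_continuous_onI)
  have ps: "prob_space M" "prob_space (Mn n)" for n
    using P Pn by (auto simp: proper_lazy_MSB_def)
  have Y: "Y j \<in> borel_measurable M" "Yn n j \<in> borel_measurable (Mn n)" for n j
    unfolding Y_def[abs_def] Yn_def[abs_def] using P Pn
    by (auto simp: proper_lazy_MSB_def intro!: measurable_compose[OF _ f_meas])
  have YB: "\<bar>Y j \<omega>\<bar> \<le> B" "\<bar>Yn n j \<omega>\<bar> \<le> B" for n j \<omega>
    by (simp_all add: Y_def Yn_def B)
  note W = proper_lazy_MSB_weights[OF P rho(1) adm(1), folded W_def]
  note Wn = proper_lazy_MSB_weights[OF Pn rho(2) adm(2), folded Wn_def]
  have box: "AE \<omega> in N. \<forall>i. U i \<omega> \<in> {-B..B} \<and> Z i \<omega> \<in> {-B..B}"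
    if "AE \<omega> in N. (\<forall>j. 0 \<le> U j \<omega>) \<and> (\<lambda>j. U j \<omega>) sums 1" "\<And>j \<omega>. \<bar>Z j \<omega>\<bar> \<le> B" for U Z :: "nat \<Rightarrow> 'a \<Rightarrow> real" and N
    using that(1)
  proof eventually_elim
    case (elim \<omega>)
    have "U i \<omega> \<le> 1" for i
      using sum_le_suminf[of "\<lambda>j. U j \<omega>" "{i}"] elim by (auto simp: sums_iff)
    with elim B(2) that(2)[of _ \<omega>] show ?case
      by (auto simp: abs_le_iff intro: order_trans[of _ 1] order_trans[of _ 0]) (smt (verit))+
  qed
  have "(\<lambda>n. \<integral>\<omega>. h (\<Sum>j. Wn n j \<omega> * Yn n j \<omega>) \<partial>Mn n) \<longlonglongrightarrow> (\<integral>\<omega>. h (\<Sum>j. W j \<omega> * Y j \<omega>) \<partial>M)"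
  proof (rule weighted_series_weak_convergence[where B=B])
    fix \<phi> :: "(nat \<Rightarrow> real) \<times> (nat \<Rightarrow> real) \<Rightarrow> real" assume \<phi>: "continuous_on UNIV \<phi>"
    show "(\<lambda>n. \<integral>\<omega>. \<phi> (\<lambda>i. Wn n i \<omega>, \<lambda>i. Yn n i \<omega>) \<partial>Mn n) \<longlonglongrightarrow> (\<integral>\<omega>. \<phi> (\<lambda>i. W i \<omega>, \<lambda>i. Y i \<omega>) \<partial>M)"
    proof (rule joint_weak_convergence[where a="-B" and b=B])
      fix u :: "(nat \<Rightarrow> real) \<Rightarrow> real" and k :: nat and g :: "nat \<Rightarrow> real \<Rightarrow> real"
      assume u: "continuous_on UNIV u" "bounded (range u)" and g: "\<And>i. nice_fun (g i)"
      \<comment> \<open>Here the weak convergence of the base measures enters: g i composed with f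
        is a bounded continuous function on the space of atoms.\<close>
      have "(\<lambda>n. \<integral>x. g i (f x) \<partial>P0n n) \<longlonglongrightarrow> (\<integral>x. g i (f x) \<partial>P0)" for i
        using conv_P0 g[of i] f(1) unfolding weak_conv_meas_def nice_fun_def
        by (auto intro!: continuous_on_compose2[of UNIV "g i" UNIV f] intro: bounded_subset)
      moreover have "(\<lambda>n. \<integral>\<omega>. u (\<lambda>j. Wn n j \<omega>) \<partial>Mn n) \<longlonglongrightarrow> (\<integral>\<omega>. u (\<lambda>j. W j \<omega>) \<partial>M)"
        using proper_lazy_MSB_weights_convergence[OF chain chain_n conv_rho conv_ps u(1)] by (simp add: W_def Wn_def)
      ultimately show "(\<lambda>n. \<integral>\<omega>. u (\<lambda>i. Wn n i \<omega>) * (\<Prod>i<k. g i (Yn n i \<omega>)) \<partial>Mn n)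
          \<longlonglongrightarrow> (\<integral>\<omega>. u (\<lambda>i. W i \<omega>) * (\<Prod>i<k. g i (Y i \<omega>)) \<partial>M)"
        unfolding W_def Wn_def Y_def Yn_def
        by (simp only: proper_lazy_MSB_expectation[OF P P0(1) u f(1) g] proper_lazy_MSB_expectation[OF Pn P0(2) u f(1) g] tendsto_mult tendsto_prod)
    qed (intro W Wn Y ps box YB \<phi>)+
  qed (intro W Wn Y ps YB h)+
  then show "(\<lambda>n. \<integral>x. h x \<partial>distr (Mn n) borel (sb_integral (vn n) (\<theta>n n) (P0n n) f)) \<longlonglongrightarrow> (\<integral>x. h x \<partial>distr M borel (sb_integral v \<theta> P0 f))"
    by (simp only: integral_distr_sb_integral[OF P f(1) h_meas] integral_distr_sb_integral[OF Pn f(1) h_meas] W_def Wn_def Y_def Yn_def)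
qed

lemma distr_PiM_borel:
  "distr N (PiM UNIV (\<lambda>_. borel)) f = (distr N borel f :: (nat \<Rightarrow> real) measure)"
  by (intro distr_cong sets_PiM_equal_borel) simp_all

theorem mainTheorem15:
  fixes M :: "'a measure" and Mn :: "nat \<Rightarrow> 'a measure"
    and \<rho> :: real and \<rho>n :: "nat \<Rightarrow> real"
    and ps :: "nat \<Rightarrow> real measure" and psn :: "nat \<Rightarrow> nat \<Rightarrow> real measure"
    and P0 :: "'x::polish_space measure" and P0n :: "nat \<Rightarrow> 'x measure"
    and v :: "nat \<Rightarrow> 'a \<Rightarrow> real" and vn :: "nat \<Rightarrow> nat \<Rightarrow> 'a \<Rightarrow> real"
    and \<theta> :: "nat \<Rightarrow> 'a \<Rightarrow> 'x" and \<theta>n :: "nat \<Rightarrow> nat \<Rightarrow> 'a \<Rightarrow> 'x"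
  assumes rho: "\<rho> \<in> {0..1}" and rhon: "\<And>n. \<rho>n n \<in> {0..1}"
    and ps_adm: "\<And>j. admissible_len (ps j)"
    and pin_adm: "\<And>n j. admissible_len (psn n j)"
    and P0: "prob_space P0" "sets P0 = sets borel" "\<And>x. emeasure P0 {x} = 0"
    and P0n: "\<And>n. prob_space (P0n n)" "\<And>n. sets (P0n n) = sets borel"
             "\<And>n x. emeasure (P0n n) {x} = 0"
    and P: "proper_lazy_MSB M \<rho> ps P0 v \<theta>"
    and Pn: "\<And>n. proper_lazy_MSB (Mn n) (\<rho>n n) (psn n) (P0n n) (vn n) (\<theta>n n)"
    and conv_rho: "\<rho>n \<longlonglongrightarrow> \<rho>"
    and conv_P0: "weak_conv_meas P0n P0"
    and conv_ps: "\<And>j. weak_conv_meas (\<lambda>n. psn n j) (ps j)"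
  shows
    "(\<forall>f::'x \<Rightarrow> real. continuous_on UNIV f \<longrightarrow> bounded (range f) \<longrightarrow>
        weak_conv_meas (\<lambda>n. distr (Mn n) borel (sb_integral (vn n) (\<theta>n n) (P0n n) f))
                       (distr M borel (sb_integral v \<theta> P0 f)))
     \<and> weak_conv_meas (\<lambda>n. distr (Mn n) borel (\<lambda>\<omega> j. sb_weights (\<lambda>i. vn n i \<omega>) j))
                      (distr M borel (\<lambda>\<omega> j. sb_weights (\<lambda>i. v i \<omega>) j))
     \<and> (\<rho> = 0 \<longrightarrow>
          prob_space.indep_vars M (\<lambda>_. borel) v UNIV \<and> (\<forall>j. distr M borel (v j) = ps j) \<and>
          (\<forall>\<sigma> tht. 0 \<le> \<sigma> \<and> \<sigma> < 1 \<and> tht > - \<sigma> \<and>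
               (\<forall>j. ps j = beta_measure (1 - \<sigma>) (tht + real (Suc j) * \<sigma>)) \<longrightarrow>
             prob_space.indep_vars M (\<lambda>_. borel) v UNIV \<and>
             (\<forall>j. distr M borel (v j) = beta_measure (1 - \<sigma>) (tht + real (Suc j) * \<sigma>)) \<and>
             (\<forall>(N :: 'b measure) W rk. prob_space N \<and> W \<in> borel_measurable N \<and>
                 distr N borel W = distr M borel (\<lambda>\<omega> j. sb_weights (\<lambda>i. v i \<omega>) j) \<and>
                 size_biased_perm N W rk \<longrightarrow>
                 distr N borel (\<lambda>\<omega> j. W \<omega> (rk j \<omega>)) =
                 distr M borel (\<lambda>\<omega> j. sb_weights (\<lambda>i. v i \<omega>) j))))
     \<and> (\<rho> = 1 \<longrightarrow>
          distr M borel (v 0) = ps 0 \<and>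
          (AE \<omega> in M. \<forall>j. v (Suc j) \<omega> = Upsilon ps j (v j \<omega>)) \<and>
          (\<forall>\<sigma> tht. 0 \<le> \<sigma> \<and> \<sigma> < 1 \<and> tht > - \<sigma> \<and>
               (\<forall>j. ps j = beta_measure (1 - \<sigma>) (tht + real (Suc j) * \<sigma>)) \<longrightarrow>
             (AE \<omega> in M. \<forall>j. sb_weights (\<lambda>i. v i \<omega>) (Suc j) \<le> sb_weights (\<lambda>i. v i \<omega>) j)))"
proof (intro conjI allI impI)
  interpret P: lazy_chain M \<rho> ps v by (rule proper_lazy_MSB_chain[OF P rho ps_adm])
  have chain: "lazy_chain M \<rho> ps v" by unfold_locales
  have chain_n: "lazy_chain (Mn n) (\<rho>n n) (psn n) (vn n)" for n
    by (rule proper_lazy_MSB_chain[OF Pn rhon pin_adm])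
  let ?W = "\<lambda>\<omega> j. sb_weights (\<lambda>i. v i \<omega>) j"
  let ?S = "PiM UNIV (\<lambda>_. borel) :: (nat \<Rightarrow> real) measure"
  have W_borel: "?W \<in> borel_measurable M"
    by (rule measurable_coordinatewise_then_product) (rule proper_lazy_MSB_weights(1)[OF P rho ps_adm])
  show "weak_conv_meas (\<lambda>n. distr (Mn n) borel (sb_integral (vn n) (\<theta>n n) (P0n n) f)) (distr M borel (sb_integral v \<theta> P0 f))"
    if "continuous_on UNIV f" "bounded (range f)" for f :: "'x \<Rightarrow> real"
    by (rule proper_lazy_MSB_convergence[OF rho rhon ps_adm pin_adm P0(2) P0n(2) P Pn conv_rho conv_P0 conv_ps that])
  show "weak_conv_meas (\<lambda>n. distr (Mn n) borel (\<lambda>\<omega> j. sb_weights (\<lambda>i. vn n i \<omega>) j)) (distr M borel ?W)"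
    unfolding weak_conv_meas_def
  proof (intro allI impI)
    fix h :: "(nat \<Rightarrow> real) \<Rightarrow> real" assume h: "continuous_on UNIV h"
    have Wn_borel: "(\<lambda>\<omega> j. sb_weights (\<lambda>i. vn n i \<omega>) j) \<in> borel_measurable (Mn n)" for n
      by (rule measurable_coordinatewise_then_product) (rule proper_lazy_MSB_weights(1)[OF Pn rhon pin_adm])
    have h_meas: "h \<in> borel_measurable borel" using h by (rule borel_measurable_continuous_onI)
    show "(\<lambda>n. \<integral>x. h x \<partial>distr (Mn n) borel (\<lambda>\<omega> j. sb_weights (\<lambda>i. vn n i \<omega>) j)) \<longlonglongrightarrow> (\<integral>x. h x \<partial>distr M borel ?W)"
      unfolding integral_distr[OF W_borel h_meas] integral_distr[OF Wn_borel h_meas]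
      by (rule proper_lazy_MSB_weights_convergence[OF chain chain_n conv_rho conv_ps h])
  qed
  {
    assume "\<rho> = 0"
    note indep = P.indep_vars_v[OF this] and law = P.distr_coordinate_independent[OF this]
    show "prob_space.indep_vars M (\<lambda>_. borel) v UNIV" by (rule indep)
    show "distr M borel (v j) = ps j" for j by (rule law)
    show "prob_space.indep_vars M (\<lambda>_. borel) v UNIV" by (rule indep)
  next
    fix \<sigma> tht :: real and j
    assume "\<rho> = 0"
      and "0 \<le> \<sigma> \<and> \<sigma> < 1 \<and> - \<sigma> < tht \<and> (\<forall>j. ps j = beta_measure (1 - \<sigma>) (tht + real (Suc j) * \<sigma>))"
    then show "distr M borel (v j) = beta_measure (1 - \<sigma>) (tht + real (Suc j) * \<sigma>)"
      using P.distr_coordinate_independent by simp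
  next
    fix \<sigma> tht :: real and N :: "'b measure" and U rk
    assume "\<rho> = 0"
      and par: "0 \<le> \<sigma> \<and> \<sigma> < 1 \<and> - \<sigma> < tht \<and> (\<forall>j. ps j = beta_measure (1 - \<sigma>) (tht + real (Suc j) * \<sigma>))"
      and U: "prob_space N \<and> U \<in> borel_measurable N \<and> distr N borel U = distr M borel ?W \<and> size_biased_perm N U rk"
    have V [measurable]: "(\<lambda>\<omega> i. v i \<omega>) \<in> measurable M ?S"
      by (rule measurable_PiM_single') (auto simp: space_PiM)
    have "ps = (\<lambda>j. beta_measure (1 - \<sigma>) (tht + real (Suc j) * \<sigma>))" using par by auto
    then have law: "distr M ?S (\<lambda>\<omega> i. v i \<omega>) = gem_sticks \<sigma> tht"
      using P.distr_independent[OF \<open>\<rho> = 0\<close>] by (simp add: gem_sticks_def)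
    have law_W: "distr (gem_sticks \<sigma> tht) ?S sb_weights = distr M ?S ?W"
      unfolding law[symmetric] by (subst distr_distr) (auto simp: comp_def)
    \<comment> \<open>Properness of P is transported along the law of the lengths; it provides the
      hypothesis on total mass for the Beta sticks.\<close>
    have "AE \<omega> in M. (\<Sum>i. ennreal (?W \<omega> i)) = 1"
      using proper_lazy_MSB_weights(2)[OF P rho ps_adm]
      by eventually_elim (auto simp: sums_iff intro!: trans[OF suminf_ennreal_eq[where x=1]])
    then have proper: "AE v in gem_sticks \<sigma> tht. (\<Sum>i. ennreal (sb_weights v i)) = 1"
      unfolding law[symmetric] by (subst AE_distr_iff) auto
    have "distr N ?S (\<lambda>\<omega> j. U \<omega> (rk j \<omega>)) = distr M ?S ?W"
      unfolding law_W[symmetric]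
    proof (rule gem_size_biased_invariant[OF _ _ _ proper])
      show "U \<in> measurable N ?S" using U by (simp add: measurable_cong_sets[OF refl sets_PiM_equal_borel])
      show "distr N ?S U = distr (gem_sticks \<sigma> tht) ?S sb_weights"
        unfolding law_W using U by (simp add: distr_PiM_borel)
    qed (use par U in auto)
    then show "distr N borel (\<lambda>\<omega> j. U \<omega> (rk j \<omega>)) = distr M borel ?W"
      by (simp add: distr_PiM_borel)
  next
    assume "\<rho> = 1"
    show "distr M borel (v 0) = ps 0" by (rule P.law_0)
    show det: "AE \<omega> in M. \<forall>j. v (Suc j) \<omega> = Upsilon ps j (v j \<omega>)"
      using P.AE_deterministic_transition[OF \<open>\<rho> = 1\<close>] by (simp add: AE_all_countable)
    fix \<sigma> tht :: real
    assume par: "0 \<le> \<sigma> \<and> \<sigma> < 1 \<and> - \<sigma> < tht \<and> (\<forall>j. ps j = beta_measure (1 - \<sigma>) (tht + real (Suc j) * \<sigma>))"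
    have "AE \<omega> in M. \<forall>j. v j \<omega> \<in> {0..1}"
      using P.AE_v_mem by (simp add: AE_all_countable)
    with det show "AE \<omega> in M. \<forall>j. sb_weights (\<lambda>i. v i \<omega>) (Suc j) \<le> sb_weights (\<lambda>i. v i \<omega>) j"
    proof eventually_elim
      case (elim \<omega>)
      show ?case
      proof (intro allI sb_weights_antimono)
        show "v i \<omega> \<in> {0..1}" for i using elim by blast
        fix j
        \<comment> \<open>With \<sigma> nonnegative the second Beta parameter increases in j and
          stays positive, as \<open>cdf_beta_mono\<close> requires.\<close>
        have "0 \<le> real j * \<sigma>" using par by simp
        then have "0 < tht + real (Suc j) * \<sigma>" using par unfolding of_nat_Suc distrib_right by linarith
        then have "cdf (ps j) (v j \<omega>) \<le> cdf (ps (Suc j)) (v j \<omega>)"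
          using par cdf_beta_mono[of "1 - \<sigma>" "tht + real (Suc j) * \<sigma>" "tht + real (Suc (Suc j)) * \<sigma>" "v j \<omega>"]
          by (simp add: mult_right_mono)
        then show "v (Suc j) \<omega> \<le> v j \<omega>"
          using elim Upsilon_le[of ps j "v j \<omega>", OF ps_adm] by auto
      qed
    qed
  }
qed

end
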